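(* Suppose assumptions (A1)–(A3) and (A5) of the context hold, and run META-STORM (defined in the context) with $p\in[\frac{3-\sqrt7}2,\frac12]$, $p+2q=1$. Let $\hat p=\frac{3(1-p)}{4-p}\in[\frac37,\sqrt7-2]$ and $\mathbf H_T=\sum_{i=1}^T\|\nabla F(x_i)\|^2$. Write $S_T=1+\frac{2\sigma^2T}{a_0^2}$. Then $$\mathbb E[\mathbf H_T^{\hat p}]\le 4A_T+4\Big(K_5+\big(K_6+\tfrac{K_7}3\big)\log S_T+K_7\log\tfrac{K_8+K_9}{b_0}\Big)^{\frac{\hat p}{1-p}}S_T^{\hat p/3},$$ where, if $p\ne\frac12$, $$A_T=\Big(\tfrac{2K_1}{K_4}\Big)^{\frac{\hat p}{1-2p}}+\Big(\Big(\tfrac{2K_2}{K_4}\Big)^{\frac{\hat p}{1-2p}}+(2K_4)^{\frac{\hat p}{2p}}\Big)S_T^{\hat p/3},$$ and, if $p=\frac12$, $$A_T=\Big(2K_1+2\big(K_2+\tfrac{K_4}3\big)\log S_T+\tfrac{2K_4}{\hat p}\log\tfrac{4K_4}{b_0^{2\hat p}}\Big)^{\hat p}S_T^{\hat p/3}+b_0^{2\hat p}.$$ Here the $K_i$ are the constants defined in the context, which depend only on $a_0,b_0,\eta,\sigma,\widehat\sigma,\beta,p,q,F(x_1)-F^*$. Simplifying, and indicating only the dependency on $\beta$ and $F(x_1)-F^*$ (besides the factors $1+\sigma^2T$), $$\mathbb E[\mathbf H_T^{\hat p}]=O\left(\Big((F(x_1)-F^* )^{\frac{\hat p}{1-p}}+\beta^{\frac{\hat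 p}{p}}\log^{\frac{\hat p}{1-p}}\beta+\beta^{\frac{\hat p}{p}}\log^{\frac{\hat p}{1-p}}(1+\sigma^2T)\Big)(1+\sigma^2T)^{\frac{\hat p}{3}}\right).$$
   Context: Setting. $\mathcal D$ is a probability distribution; for each $\xi\in\mathrm{support}(\mathcal D)$, $f(\cdot,\xi):\mathbb R^d\to\mathbb R$ is differentiable; $F(x)=\mathbb E_{\xi\sim\mathcal D}[f(x,\xi)]$ (possibly non-convex), differentiable. $\|\cdot\|$ is the Euclidean norm; $\log^{r}(u)$ means $(\log u)^r$. Assumptions. (A1) $F^*:=\inf_x F(x)>-\infty$. (A2) $\mathbb E_\xi[\nabla f(x,\xi)]=\nabla F(x)$ and $\mathbb E_\xi\|\nabla f(x,\xi)-\nabla F(x)\|^2\le\sigma^2$ for all $x$, with $\sigma\ge0$. (A3) $\mathbb E_\xi\|\nabla f(x,\xi)-\nabla f(y,\xi)\|^2\le\beta^2\|x-y\|^2$ for all $x,y\in\mathbb R^d$. (A5) $\|\nabla f(x,\xi)-\nabla f(x,\xi')\|\le2\widehat\sigma$ for all $x\in\mathbb R^d$, $\xi,\xi'\in\mathrm{support}(\mathcal D)$, with $\widehat\sigma\ge0$. Algorithm META-STORM. Input: $x_1\in\mathbb R^d$; parameters $a_0,b_0,\eta>0$, $p\in[\frac{3-\sqrt7}2,\frac12]$, $q$ with $p+2q=1$. Let $\xi_1,\xi_2,\dots$ be i.i.d. from $\mathcal D$, $d_1=\nabla f(x_1,\xi_1)$, $a_1=1$. For $t=1,\dots,T$: $b_t=\big(b_0^{1/p}+\sum_{i=1}^t\|d_i\|^2\big)^p/a_t^q$;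 $x_{t+1}=x_t-\frac{\eta}{b_t}d_t$; $a_{t+1}=\big(1+\sum_{i=1}^t\|\nabla f(x_i,\xi_i)-\nabla f(x_i,\xi_{i+1})\|^2/a_0^2\big)^{-2/3}$; $d_{t+1}=\nabla f(x_{t+1},\xi_{t+1})+(1-a_{t+1})(d_t-\nabla f(x_t,\xi_{t+1}))$. Constants. Let $\beta_{\max}=\max\{\beta,1\}$, let $\lambda>0$ be any number, and let $K_0=\big(\max\{1,1728\widehat\sigma^6/a_0^6\}+4\widehat\sigma^2/a_0^2\big)^{-2/3}$. For $\ell\in[\frac14,\frac12]$ let $K_1(\ell)=3\Big(\sigma^2+\frac{24(1+\ell^2)\widehat\sigma^2}{\ell^2}\Big)+\frac{72\widehat\sigma^2\big(\sigma^2+8(1+6\widehat\sigma^{4/3}/a_0^{4/3})(3a_0^2+5\widehat\sigma^2)\big)}{a_0^2K_0^{2\ell-1/2}}$; $K_2(\ell)=\frac{9(1+2\ell^2)a_0^2}{\ell^2(4\ell-1)}$ if $\ell\ne\frac14$, and $K_2(\ell)=\frac{3(1+2\ell^2)a_0^2}{\ell^2}$ if $\ell=\frac14$; $K_3(\ell)=\frac{144\widehat\sigma^2}{K_0^{2\ell-1/2}a_0^2}\Big(1+\frac{6\widehat\sigma^{4/3}}{a_0^{4/3}}\Big)+\frac{3(1+2\ell^2)}{\ell^2}\Big(\frac{4\widehat\sigma^2}{a_0^2}\Big)^{4\ell/3}$. Then $K_1=K_1(q)$, $K_2=K_2(q)$, $K_3=K_3(q)$; $K_4=\big(K_3(q)+\frac{3(1+2q^2)}{q^2}\big)\frac{\eta^2\beta^2}{4q-1}$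 if $q>\frac14$, and $K_4=\big(K_3(q)+\frac{3(1+2q^2)}{q^2}\big)\eta^2\beta^2$ if $q=\frac14$; $K_5=b_0^{\frac1p-1}+\frac2\eta(F(x_1)-F^* )+\frac{\lambda K_1(1/4)}{\eta\beta_{\max}}$; $K_6=\frac{\lambda K_2(1/4)}{\eta\beta_{\max}}$; $K_7=\frac{(K_8+K_9)^{\frac1p-1}}{1-p}$; $K_8=(1+\lambda K_3(1/4))\eta\beta_{\max}$; $K_9=\big(\frac1\lambda+\frac{2\widehat\sigma^{2/3}}{a_0^{2/3}\lambda}+54\lambda\big)\eta\beta_{\max}$. *)

theory Defs
  imports "HOL-Probability.Probability"
begin

definition grad :: "('a::euclidean_space \<Rightarrow> real) \<Rightarrow> 'a \<Rightarrow> 'a" where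
  "grad h x = (THE g. GDERIV h x :> g)"

definition sgrad :: "('a::euclidean_space \<Rightarrow> 'b \<Rightarrow> real) \<Rightarrow> 'a \<Rightarrow> 'b \<Rightarrow> 'a" where
  "sgrad f x \<xi> = grad (\<lambda>y. f y \<xi>) x"

definition objective :: "'b measure \<Rightarrow> ('a::euclidean_space \<Rightarrow> 'b \<Rightarrow> real) \<Rightarrow> 'a \<Rightarrow> real" where
  "objective D f x = (\<integral>\<xi>. f x \<xi> \<partial>D)"

text \<open>The sample space carries no topology, so the support of \<open>D\<close> is represented by a set
  \<open>\<Xi>\<close> about which only the following is assumed. On a second countable Borel space
  the topological support is such a set (lemma below); nothing is assumed outside
  \<open>\<Xi>\<close> except integrability.\<close>

definition supported_on :: "'b measure \<Rightarrow> 'b set \<Rightarrow> bool" where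
  "supported_on D \<Xi> \<longleftrightarrow> \<Xi> \<in> sets D \<and> (AE \<xi> in D. \<xi> \<in> \<Xi>)"

lemma supported_on_topological_support:
  fixes D :: "'b::second_countable_topology measure"
  assumes sets: "sets D = sets borel"
  shows "supported_on D {\<xi>. \<forall>U. open U \<longrightarrow> \<xi> \<in> U \<longrightarrow> emeasure D U > 0}"
proof -
  define S where "S = {\<xi>::'b. \<forall>U. open U \<longrightarrow> \<xi> \<in> U \<longrightarrow> emeasure D U > 0}"
  obtain B :: "'b set set" where B: "countable B" "topological_basis B"
    using ex_countable_basis by auto
  define N where "N = \<Union>{U \<in> B. emeasure D U = 0}"
  have opB: "open U" if "U \<in> B" for U
    using B(2) that by (rule topological_basis_open)
  have null: "N \<in> null_sets D"
    unfolding N_def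
  proof (rule null_sets_UN'[where N = "\<lambda>U. U", simplified])
    show "countable {U \<in> B. emeasure D U = 0}"
      using B(1) by (rule countable_subset[rotated]) auto
    show "U \<in> null_sets D" if "U \<in> {U \<in> B. emeasure D U = 0}" for U
      using that opB by (auto simp: null_sets_def sets)
  qed
  have compl: "- S = N"
  proof (intro equalityI subsetI)
    fix x assume "x \<in> - S"
    then obtain U where U: "open U" "x \<in> U" "emeasure D U = 0"
      unfolding S_def by (auto simp: zero_less_iff_neq_zero)
    obtain V where V: "V \<in> B" "x \<in> V" "V \<subseteq> U"
      using topological_basisE[OF B(2) U(1,2)] by metis
    have "emeasure D V \<le> emeasure D U"
      using V(3) U(1) by (intro emeasure_mono) (auto simp: sets)
    then show "x \<in> N"
      using V U(3) unfolding N_def by auto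
  next
    fix x assume "x \<in> N"
    then show "x \<in> - S"
      using opB unfolding N_def S_def by (auto simp: zero_less_iff_neq_zero)
  qed
  have "open (- S)"
    unfolding compl N_def using opB by (intro open_Union) auto
  then have "S \<in> sets D"
    unfolding sets by (metis borel_closed closed_def)
  moreover have "AE x in D. x \<in> S"
    using AE_not_in[OF null] by eventually_elim (use compl in blast)
  ultimately show ?thesis
    unfolding supported_on_def S_def by simp
qed

definition stochastic_objective ::
    "'b measure \<Rightarrow> 'b set \<Rightarrow> ('a::euclidean_space \<Rightarrow> 'b \<Rightarrow> real) \<Rightarrow> bool" where
  "stochastic_objective D \<Xi> f \<longleftrightarrow>
     prob_space D \<and> supported_on D \<Xi> \<and>
     (\<forall>\<xi>\<in>\<Xi>. \<forall>x. (\<lambda>y. f y \<xi>) differentiable (at x)) \<and>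
     (\<forall>x. integrable D (f x)) \<and>
     (\<forall>x. objective D f differentiable (at x))"

definition bounded_below :: "'b measure \<Rightarrow> ('a::euclidean_space \<Rightarrow> 'b \<Rightarrow> real) \<Rightarrow> bool" where
  "bounded_below D f \<longleftrightarrow> bdd_below (range (objective D f))"

definition opt_value :: "'b measure \<Rightarrow> ('a::euclidean_space \<Rightarrow> 'b \<Rightarrow> real) \<Rightarrow> real" where
  "opt_value D f = (INF x. objective D f x)"

text \<open>The integrability conditions below are needed because the Bochner integral of a
  non-integrable function is \<open>0\<close>.\<close>

definition unbiased_bounded_variance ::
    "'b measure \<Rightarrow> ('a::euclidean_space \<Rightarrow> 'b \<Rightarrow> real) \<Rightarrow> real \<Rightarrow> bool" where
  "unbiased_bounded_variance D f \<sigma> \<longleftrightarrow>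
     (\<forall>x. integrable D (sgrad f x) \<and>
          (\<integral>\<xi>. sgrad f x \<xi> \<partial>D) = grad (objective D f) x \<and>
          integrable D (\<lambda>\<xi>. (norm (sgrad f x \<xi> - grad (objective D f) x))\<^sup>2) \<and>
          (\<integral>\<xi>. (norm (sgrad f x \<xi> - grad (objective D f) x))\<^sup>2 \<partial>D) \<le> \<sigma>\<^sup>2)"

definition mean_square_smooth ::
    "'b measure \<Rightarrow> ('a::euclidean_space \<Rightarrow> 'b \<Rightarrow> real) \<Rightarrow> real \<Rightarrow> bool" where
  "mean_square_smooth D f \<beta> \<longleftrightarrow>
     (\<forall>x y. integrable D (\<lambda>\<xi>. (norm (sgrad f x \<xi> - sgrad f y \<xi>))\<^sup>2) \<and>
            (\<integral>\<xi>. (norm (sgrad f x \<xi> - sgrad f y \<xi>))\<^sup>2 \<partial>D) \<le> \<beta>\<^sup>2 * (norm (x - y))\<^sup>2)"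

definition bounded_gradient_differences ::
    "'b set \<Rightarrow> ('a::euclidean_space \<Rightarrow> 'b \<Rightarrow> real) \<Rightarrow> real \<Rightarrow> bool" where
  "bounded_gradient_differences \<Xi> f \<sigma>h \<longleftrightarrow>
     (\<forall>x. \<forall>\<xi>\<in>\<Xi>. \<forall>\<xi>'\<in>\<Xi>. norm (sgrad f x \<xi> - sgrad f x \<xi>') \<le> 2 * \<sigma>h)"

text \<open>\<open>G x \<xi>\<close> is the stochastic gradient at \<open>x\<close> and \<open>s t\<close> the sample
  \<open>\<xi>\<^sub>t\<close>. Indices start at 1; the values at index 0 are dummies.\<close>

context
  fixes G :: "'a::euclidean_space \<Rightarrow> 'b \<Rightarrow> 'a"
    and x1 :: 'a and a0 b0 \<eta> p q :: real and s :: "nat \<Rightarrow> 'b"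
begin

function storm_x :: "nat \<Rightarrow> 'a" and storm_d :: "nat \<Rightarrow> 'a"
    and storm_a :: "nat \<Rightarrow> real" and storm_b :: "nat \<Rightarrow> real" where
  "storm_x 0 = x1"
| "storm_x (Suc 0) = x1"
| "storm_x (Suc (Suc t)) = storm_x (Suc t) - (\<eta> / storm_b (Suc t)) *\<^sub>R storm_d (Suc t)"
| "storm_d 0 = 0"
| "storm_d (Suc 0) = G x1 (s 1)"
| "storm_d (Suc (Suc t)) =
     G (storm_x (Suc (Suc t))) (s (Suc (Suc t))) +
     (1 - storm_a (Suc (Suc t))) *\<^sub>R (storm_d (Suc t) - G (storm_x (Suc t)) (s (Suc (Suc t))))"
| "storm_a 0 = 1"
| "storm_a (Suc 0) = 1"
| "storm_a (Suc (Suc t)) =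
     (1 + (\<Sum>i=1..Suc t. (norm (G (storm_x i) (s i) - G (storm_x i) (s (Suc i))))\<^sup>2 / a0\<^sup>2))
       powr (-2/3)"
| "storm_b t =
     (b0 powr (1/p) + (\<Sum>i=1..t. (norm (storm_d i))\<^sup>2)) powr p / storm_a t powr q"
  by pat_completeness auto
termination
  by (relation "Wellfounded.measure (\<lambda>z. case z of
        Inl (Inl t) \<Rightarrow> 4 * t | Inl (Inr t) \<Rightarrow> 4 * t + 1
      | Inr (Inl t) \<Rightarrow> 4 * t | Inr (Inr t) \<Rightarrow> 4 * t + 2)") auto

end

definition iid_samples :: "'w measure \<Rightarrow> 'b measure \<Rightarrow> (nat \<Rightarrow> 'w \<Rightarrow> 'b) \<Rightarrow> bool" where
  "iid_samples M D \<xi> \<longleftrightarrow>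
     prob_space M \<and> prob_space.indep_vars M (\<lambda>_. D) \<xi> {1..} \<and>
     (\<forall>t\<ge>1. distr M D (\<xi> t) = D)"

definition grad_norm_sum ::
    "'b measure \<Rightarrow> ('a::euclidean_space \<Rightarrow> 'b \<Rightarrow> real) \<Rightarrow> 'a \<Rightarrow> real \<Rightarrow> real \<Rightarrow> real \<Rightarrow> real \<Rightarrow> real \<Rightarrow>
     (nat \<Rightarrow> 'b) \<Rightarrow> nat \<Rightarrow> real" where
  "grad_norm_sum D f x1 a0 b0 \<eta> p q s T =
     (\<Sum>i=1..T. (norm (grad (objective D f) (storm_x (sgrad f) x1 a0 b0 \<eta> p q s i)))\<^sup>2)"

definition phat :: "real \<Rightarrow> real" where
  "phat p = 3 * (1 - p) / (4 - p)"

text \<open>A nonnegative integral rather than a Bochner integral, so that an upper bound is not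
  trivially true for a non-integrable random variable.\<close>

definition expected_grad_norm ::
    "'w measure \<Rightarrow> (nat \<Rightarrow> 'w \<Rightarrow> 'b) \<Rightarrow> 'b measure \<Rightarrow> ('a::euclidean_space \<Rightarrow> 'b \<Rightarrow> real) \<Rightarrow> 'a \<Rightarrow>
     real \<Rightarrow> real \<Rightarrow> real \<Rightarrow> real \<Rightarrow> real \<Rightarrow> nat \<Rightarrow> ennreal" where
  "expected_grad_norm M \<xi> D f x1 a0 b0 \<eta> p q T =
     (\<integral>\<^sup>+\<omega>. ennreal (grad_norm_sum D f x1 a0 b0 \<eta> p q (\<lambda>t. \<xi> t \<omega>) T powr phat p) \<partial>M)"

definition storm_assumptions ::
    "'w measure \<Rightarrow> (nat \<Rightarrow> 'w \<Rightarrow> 'b) \<Rightarrow> 'b measure \<Rightarrow> 'b set \<Rightarrow> ('a::euclidean_space \<Rightarrow> 'b \<Rightarrow> real) \<Rightarrow>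
     real \<Rightarrow> real \<Rightarrow> real \<Rightarrow> bool" where
  "storm_assumptions M \<xi> D \<Xi> f \<sigma> \<sigma>h \<beta> \<longleftrightarrow>
     stochastic_objective D \<Xi> f \<and> bounded_below D f \<and>
     0 \<le> \<sigma> \<and> unbiased_bounded_variance D f \<sigma> \<and>
     0 \<le> \<beta> \<and> mean_square_smooth D f \<beta> \<and>
     0 \<le> \<sigma>h \<and> bounded_gradient_differences \<Xi> f \<sigma>h \<and>
     iid_samples M D \<xi>"

text \<open>\<open>\<sigma>h\<close> is the bound in the almost sure gradient difference condition, \<open>lam\<close> the
  free parameter and \<open>\<Delta>\<close> the initial gap \<open>F(x\<^sub>1) - F\<^sup>*\<close>.\<close>

definition \<beta>max :: "real \<Rightarrow> real" where
  "\<beta>max \<beta> = max \<beta> 1"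

definition K0 :: "real \<Rightarrow> real \<Rightarrow> real" where
  "K0 a0 \<sigma>h = (max 1 (1728 * \<sigma>h ^ 6 / a0 ^ 6) + 4 * \<sigma>h\<^sup>2 / a0\<^sup>2) powr (-2/3)"

definition K1 :: "real \<Rightarrow> real \<Rightarrow> real \<Rightarrow> real \<Rightarrow> real" where
  "K1 a0 \<sigma> \<sigma>h l =
     3 * (\<sigma>\<^sup>2 + 24 * (1 + l\<^sup>2) * \<sigma>h\<^sup>2 / l\<^sup>2) +
     72 * \<sigma>h\<^sup>2 * (\<sigma>\<^sup>2 + 8 * (1 + 6 * \<sigma>h powr (4/3) / a0 powr (4/3)) * (3 * a0\<^sup>2 + 5 * \<sigma>h\<^sup>2)) /
       (a0\<^sup>2 * K0 a0 \<sigma>h powr (2 * l - 1/2))"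

definition K2 :: "real \<Rightarrow> real \<Rightarrow> real" where
  "K2 a0 l =
     (if l \<noteq> 1/4 then 9 * (1 + 2 * l\<^sup>2) * a0\<^sup>2 / (l\<^sup>2 * (4 * l - 1))
      else 3 * (1 + 2 * l\<^sup>2) * a0\<^sup>2 / l\<^sup>2)"

definition K3 :: "real \<Rightarrow> real \<Rightarrow> real \<Rightarrow> real" where
  "K3 a0 \<sigma>h l =
     144 * \<sigma>h\<^sup>2 / (K0 a0 \<sigma>h powr (2 * l - 1/2) * a0\<^sup>2) * (1 + 6 * \<sigma>h powr (4/3) / a0 powr (4/3)) +
     3 * (1 + 2 * l\<^sup>2) / l\<^sup>2 * (4 * \<sigma>h\<^sup>2 / a0\<^sup>2) powr (4 * l / 3)"

definition K4 :: "real \<Rightarrow> real \<Rightarrow> real \<Rightarrow> real \<Rightarrow> real \<Rightarrow> real" where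
  "K4 a0 \<eta> \<sigma>h \<beta> q =
     (if q > 1/4 then (K3 a0 \<sigma>h q + 3 * (1 + 2 * q\<^sup>2) / q\<^sup>2) * (\<eta>\<^sup>2 * \<beta>\<^sup>2 / (4 * q - 1))
      else (K3 a0 \<sigma>h q + 3 * (1 + 2 * q\<^sup>2) / q\<^sup>2) * \<eta>\<^sup>2 * \<beta>\<^sup>2)"

definition K5 :: "real \<Rightarrow> real \<Rightarrow> real \<Rightarrow> real \<Rightarrow> real \<Rightarrow> real \<Rightarrow> real \<Rightarrow> real \<Rightarrow> real \<Rightarrow> real" where
  "K5 a0 b0 \<eta> \<sigma> \<sigma>h \<beta> p lam \<Delta> =
     b0 powr (1/p - 1) + 2 / \<eta> * \<Delta> + lam * K1 a0 \<sigma> \<sigma>h (1/4) / (\<eta> * \<beta>max \<beta>)"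

definition K6 :: "real \<Rightarrow> real \<Rightarrow> real \<Rightarrow> real \<Rightarrow> real" where
  "K6 a0 \<eta> \<beta> lam = lam * K2 a0 (1/4) / (\<eta> * \<beta>max \<beta>)"

definition K8 :: "real \<Rightarrow> real \<Rightarrow> real \<Rightarrow> real \<Rightarrow> real \<Rightarrow> real" where
  "K8 a0 \<eta> \<sigma>h \<beta> lam = (1 + lam * K3 a0 \<sigma>h (1/4)) * \<eta> * \<beta>max \<beta>"

definition K9 :: "real \<Rightarrow> real \<Rightarrow> real \<Rightarrow> real \<Rightarrow> real \<Rightarrow> real" where
  "K9 a0 \<eta> \<sigma>h \<beta> lam =
     (1 / lam + 2 * \<sigma>h powr (2/3) / (a0 powr (2/3) * lam) + 54 * lam) * \<eta> * \<beta>max \<beta>"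

definition K7 :: "real \<Rightarrow> real \<Rightarrow> real \<Rightarrow> real \<Rightarrow> real \<Rightarrow> real \<Rightarrow> real" where
  "K7 a0 \<eta> \<sigma>h \<beta> p lam =
     (K8 a0 \<eta> \<sigma>h \<beta> lam + K9 a0 \<eta> \<sigma>h \<beta> lam) powr (1/p - 1) / (1 - p)"

definition S_T :: "real \<Rightarrow> real \<Rightarrow> nat \<Rightarrow> real" where
  "S_T a0 \<sigma> T = 1 + 2 * \<sigma>\<^sup>2 * real T / a0\<^sup>2"

text \<open>For \<open>p = 1/2\<close> the base of the power can be negative, where a real power is undefined in
  mathematics; there \<open>powr\<close> takes the power of the absolute value. For \<open>p \<noteq> 1/2\<close> the formula
  divides by \<open>K4\<close> and is meaningful only for \<open>\<beta> > 0\<close>.\<close>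

definition A_T :: "real \<Rightarrow> real \<Rightarrow> real \<Rightarrow> real \<Rightarrow> real \<Rightarrow> real \<Rightarrow> real \<Rightarrow> real \<Rightarrow> nat \<Rightarrow> real" where
  "A_T a0 b0 \<eta> \<sigma> \<sigma>h \<beta> p q T =
     (let k1 = K1 a0 \<sigma> \<sigma>h q; k2 = K2 a0 q; k4 = K4 a0 \<eta> \<sigma>h \<beta> q; S = S_T a0 \<sigma> T; r = phat p
      in if p \<noteq> 1/2 then
           (2 * k1 / k4) powr (r / (1 - 2 * p)) +
           ((2 * k2 / k4) powr (r / (1 - 2 * p)) + (2 * k4) powr (r / (2 * p))) * S powr (r / 3)
         else
           (2 * k1 + 2 * (k2 + k4 / 3) * ln S + 2 * k4 / r * ln (4 * k4 / b0 powr (2 * r))) powr r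
             * S powr (r / 3) + b0 powr (2 * r))"

definition storm_bound ::
    "real \<Rightarrow> real \<Rightarrow> real \<Rightarrow> real \<Rightarrow> real \<Rightarrow> real \<Rightarrow> real \<Rightarrow> real \<Rightarrow> real \<Rightarrow> real \<Rightarrow> nat \<Rightarrow> real" where
  "storm_bound a0 b0 \<eta> \<sigma> \<sigma>h \<beta> p q lam \<Delta> T =
     (let k5 = K5 a0 b0 \<eta> \<sigma> \<sigma>h \<beta> p lam \<Delta>; k6 = K6 a0 \<eta> \<beta> lam; k7 = K7 a0 \<eta> \<sigma>h \<beta> p lam;
          k8 = K8 a0 \<eta> \<sigma>h \<beta> lam; k9 = K9 a0 \<eta> \<sigma>h \<beta> lam; S = S_T a0 \<sigma> T; r = phat p
      in 4 * A_T a0 b0 \<eta> \<sigma> \<sigma>h \<beta> p q T +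
         4 * (k5 + (k6 + k7 / 3) * ln S + k7 * ln ((k8 + k9) / b0)) powr (r / (1 - p))
           * S powr (r / 3))"

definition storm_rate :: "real \<Rightarrow> real \<Rightarrow> real \<Rightarrow> real \<Rightarrow> nat \<Rightarrow> real" where
  "storm_rate \<sigma> \<beta> p \<Delta> T =
     (let r = phat p; V = 1 + \<sigma>\<^sup>2 * real T
      in (\<Delta> powr (r / (1 - p)) +
          \<beta> powr (r / p) * ln \<beta> powr (r / (1 - p)) +
          \<beta> powr (r / p) * ln V powr (r / (1 - p))) * V powr (r / 3))"

end

theory Submission
  imports Defs
begin

text \<open>Let \<open>\<epsilon>\<^sub>t = d\<^sub>t - \<nabla>F(x\<^sub>t)\<close> and \<open>A\<^sub>t = a\<^sub>t powr (-3/2)\<close>, so that \<open>E[A\<^sub>T]\<close> is at most \<open>S\<^sub>T\<close>.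
  For \<open>l\<close> between 1/4 and 1/2 the potential \<open>(max A\<^sub>t m) powr (4l/3) \<cdot> \<parallel>\<epsilon>\<^sub>t\<parallel>\<^sup>2\<close>, with
  \<open>m = max 1 (1728 \<sigma>h^6/a\<^sub>0^6)\<close>, contracts in expectation up to the noise and the squared steps. This bounds
  the expectation of the sum of \<open>a\<^sub>t\<^sub>+\<^sub>1 powr (1 - 2l) \<cdot> \<parallel>\<epsilon>\<^sub>t\<parallel>\<^sup>2\<close> with the constants \<open>K1\<close>, \<open>K2\<close>, \<open>K3\<close>. The case \<open>l = 1/4\<close>
  together with the descent inequality bounds the expectation of \<open>a\<^sub>T powr q \<cdot> D\<^sub>T powr (1 - p)\<close>, where
  \<open>D\<^sub>T\<close> is the sum of the \<open>\<parallel>d\<^sub>t\<parallel>\<^sup>2\<close>; the case \<open>l = q\<close> bounds the error sum, in terms of itself when it dominates \<open>D\<^sub>T\<close>.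
  Hoelder's inequality removes the powers of \<open>a\<^sub>T\<close> at the cost of powers of \<open>S\<^sub>T\<close>, and
  \<open>\<parallel>\<nabla>F(x\<^sub>t)\<parallel>\<^sup>2 \<le> 2\<parallel>\<epsilon>\<^sub>t\<parallel>\<^sup>2 + 2\<parallel>d\<^sub>t\<parallel>\<^sup>2\<close>.\<close>

text \<open>Two couplings shape the argument. First, \<open>a s (Suc t)\<close> is computed from the
  very sample that produces the noise of that step. Weights and cross terms therefore use
  \<open>A s t\<close>, known beforehand, and the exchange is paid by the increments of
  \<open>A\<close>, at most \<open>4 * u\<close> with \<open>u = sh\<^sup>2 / a0\<^sup>2\<close>;
  above \<open>m\<close> an increment is at most \<open>A powr (1/3) / 3\<close>, so the relative
  growth of the weight is comparable with the momentum. The noise is not observed, but given the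
  past its mean square is at most that of the gradient difference that \<open>A\<close> accumulates,
  so noise sums become Riemann sums in \<open>A\<close>. Second, the error bound contains the
  squared steps and the descent inequality contains the errors. The loop is cut by a quadratic term
  with coefficient \<open>Q = K8 + K9\<close>, which the step size rule supplies
  (\<open>stepsize_sum\<close>) at the cost of the logarithm multiplying \<open>K7\<close>. The
  exponent \<open>phat p\<close> is the one for which the powers of \<open>A\<close> cancel when the
  directions are interpolated, and the lower limit on \<open>p\<close> amounts to
  \<open>1 - 2*p \<le> phat p\<close>, which lets Jensen close the self-referential error
  bound.\<close>

lemma powr_le_tangent:
  fixes x \<theta> :: real
  assumes "0 \<le> \<theta>" "\<theta> \<le> 1" "0 < x"
  shows "x powr \<theta> \<le> 1 + \<theta> * (x - 1)"
  using Youngs_inequality_0[of \<theta> "1 - \<theta>" x 1] assms by (simp add: algebra_simps)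

lemma powr_minus_ge_tangent:
  fixes x \<theta> :: real
  assumes "0 \<le> \<theta>" "0 < x"
  shows "1 - \<theta> * (x - 1) \<le> x powr (-\<theta>)"
proof -
  have "1 + (- \<theta> * ln x) \<le> exp (- \<theta> * ln x)" by (rule exp_ge_add_one_self)
  moreover have "\<theta> * ln x \<le> \<theta> * (x - 1)"
    using assms ln_le_minus_one by (intro mult_left_mono) auto
  moreover have "x powr (-\<theta>) = exp (- \<theta> * ln x)" using assms by (simp add: powr_def)
  ultimately show ?thesis by simp
qed

lemma powr_add_le:
  fixes x y \<theta> :: real
  assumes "0 \<le> x" "0 \<le> y" "0 \<le> \<theta>" "\<theta> \<le> 1"
  shows "(x + y) powr \<theta> \<le> x powr \<theta> + y powr \<theta>"
proof (cases "x + y = 0")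
  case True then show ?thesis by simp
next
  case False
  then have pos: "x + y > 0" using assms by simp
  have "x / (x + y) \<le> (x / (x + y)) powr \<theta>" "y / (x + y) \<le> (y / (x + y)) powr \<theta>"
    using powr_mono'[of \<theta> 1 "x / (x + y)"] powr_mono'[of \<theta> 1 "y / (x + y)"] assms pos by auto
  then have "x / (x + y) + y / (x + y) \<le> (x powr \<theta> + y powr \<theta>) / (x + y) powr \<theta>"
    by (simp add: powr_divide add_divide_distrib)
  moreover have "x / (x + y) + y / (x + y) = 1" using pos by (simp flip: add_divide_distrib)
  ultimately show ?thesis using pos by (simp add: le_divide_eq)
qed

text \<open>Mean value estimates for increments of powers, here from the tangent at the left end of
  the interval; the following lemmas use the right end, the form in which a sum over steps is
  compared with an integral.\<close>

lemma powr_diff_le: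
  fixes x y \<theta> :: real
  assumes "0 \<le> \<theta>" "\<theta> \<le> 1" "0 < x" "x \<le> y"
  shows "y powr \<theta> - x powr \<theta> \<le> \<theta> * x powr \<theta> * ((y - x) / x)"
proof -
  have "(y / x) powr \<theta> \<le> 1 + \<theta> * (y / x - 1)" using assms by (intro powr_le_tangent) auto
  then have "x powr \<theta> * (y / x) powr \<theta> \<le> x powr \<theta> * (1 + \<theta> * (y / x - 1))"
    by (intro mult_left_mono) auto
  moreover have "x powr \<theta> * (y / x) powr \<theta> = y powr \<theta>"
    using assms by (simp add: powr_divide)
  moreover have "y / x - 1 = (y - x) / x" using assms by (simp add: field_simps)
  ultimately show ?thesis by (simp add: algebra_simps)
qed

lemma powr_diff_ge:
  fixes x y \<theta> :: real
  assumes "0 \<le> \<theta>" "\<theta> \<le> 1" "0 \<le> x" "x \<le> y" "0 < y"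
  shows "\<theta> * (y powr (\<theta> - 1) * (y - x)) \<le> y powr \<theta> - x powr \<theta>"
proof -
  have "(x / y) powr \<theta> \<le> 1 + \<theta> * (x / y - 1)" 
  proof (cases "x = 0")
    case True then show ?thesis using assms by simp
  next
    case False then show ?thesis using assms by (intro powr_le_tangent) auto
  qed
  then have "y powr \<theta> * (x / y) powr \<theta> \<le> y powr \<theta> * (1 + \<theta> * (x / y - 1))"
    by (intro mult_left_mono) auto
  moreover have "y powr \<theta> * (x / y) powr \<theta> = x powr \<theta>"
    using assms by (simp add: powr_divide)
  moreover have "y powr \<theta> * (1 + \<theta> * (x / y - 1)) = y powr \<theta> - \<theta> * (y powr (\<theta> - 1) * (y - x))"
    using assms by (simp add: powr_diff field_simps)
  ultimately show ?thesis by linarith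
qed

lemma powr_minus_diff_ge:
  fixes x y \<theta> :: real
  assumes "0 \<le> \<theta>" "0 < x" "x \<le> y"
  shows "\<theta> * (y powr (- \<theta> - 1) * (y - x)) \<le> x powr (-\<theta>) - y powr (-\<theta>)"
proof -
  have "1 - \<theta> * (x / y - 1) \<le> (x / y) powr (-\<theta>)" using assms by (intro powr_minus_ge_tangent) auto
  then have "y powr (-\<theta>) * (1 - \<theta> * (x / y - 1)) \<le> y powr (-\<theta>) * (x / y) powr (-\<theta>)"
    by (intro mult_left_mono) auto
  moreover have "y powr (-\<theta>) * (x / y) powr (-\<theta>) = x powr (-\<theta>)"
    using assms by (simp add: powr_divide)
  moreover have "y powr (-\<theta>) * (1 - \<theta> * (x / y - 1)) = y powr (-\<theta>) + \<theta> * (y powr (-\<theta> - 1) * (y - x))"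
    using assms by (simp add: powr_diff field_simps)
  ultimately show ?thesis by linarith
qed

lemma ln_diff_ge:
  fixes x y :: real
  assumes "0 < x" "x \<le> y"
  shows "(y - x) / y \<le> ln y - ln x"
proof -
  have "ln (x / y) \<le> x / y - 1" using assms by (intro ln_le_minus_one) auto
  then show ?thesis using assms by (simp add: ln_div field_simps)
qed

text \<open>Reduces the numerical bounds on two-thirds powers below to a comparison of a square with
  a cube of rationals.\<close>

lemma powr_two_thirds_le:
  fixes x c :: real
  assumes "0 \<le> x" "0 \<le> c" "x\<^sup>2 \<le> c ^ 3"
  shows "x powr (2/3) \<le> c"
proof -
  have "x powr (2/3) = (x\<^sup>2) powr (1/3)"
    using powr_powr[of x 2 "1/3"] assms by simp
  also have "\<dots> \<le> (c ^ 3) powr (1/3)" using assms by (intro powr_mono2) auto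
  also have "\<dots> = c" using powr_powr[of c 3 "1/3"] assms by simp
  finally show ?thesis .
qed

section \<open>The adaptive momentum\<close>

text \<open>The constant is \<open>1728 = 12 ^ 3\<close>. A step changes \<open>A\<close> by at most
  \<open>4 * u\<close>, so above the threshold the change is at most \<open>B powr (1/3) / 3\<close>
  and also at most \<open>B / 3\<close>.\<close>

lemma threshold:
  fixes u B :: real
  assumes "0 \<le> u" "max 1 (1728 * u ^ 3) \<le> B"
  shows "12 * u \<le> B powr (1/3)" "12 * u \<le> B"
proof -
  have "12 * u = ((12 * u) ^ 3) powr (1/3)"
    using powr_powr[of "12 * u" 3 "1/3"] assms by simp
  also have "\<dots> \<le> B powr (1/3)" using assms by (intro powr_mono2) (auto simp: power_mult_distrib)
  finally show *: "12 * u \<le> B powr (1/3)" .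
  also have "B powr (1/3) \<le> B powr 1" using assms by (intro powr_mono) auto
  finally show "12 * u \<le> B" using assms by auto
qed

text \<open>One step multiplies \<open>B\<close> by at most 4/3, the exponent is at most 2/3, and
  \<open>(4/3) powr (2/3) \<le> 61/50\<close>.\<close>

lemma weight_ratio:
  fixes u B A' l :: real
  assumes u: "0 \<le> u" "max 1 (1728 * u ^ 3) \<le> B" and A': "0 \<le> A'" "A' \<le> B + 4 * u"
    and l: "1/4 \<le> l" "l \<le> 1/2"
  shows "A' powr (4*l/3) \<le> 61/50 * B powr (4*l/3)"
proof -
  have "A' \<le> 4/3 * B" using threshold(2)[OF u] A' by simp
  then have "A' powr (4*l/3) \<le> (4/3 * B) powr (4*l/3)" using A' l by (intro powr_mono2) auto
  also have "\<dots> = (4/3) powr (4*l/3) * B powr (4*l/3)" by (rule powr_mult)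
  also have "(4/3::real) powr (4*l/3) \<le> (4/3) powr (2/3)" using l by (intro powr_mono) auto
  also have "(4/3::real) powr (2/3) \<le> 61/50" by (rule powr_two_thirds_le) (simp_all add: field_simps)
  finally show ?thesis by (simp add: mult_right_mono)
qed

text \<open>\<open>B0\<close> and \<open>B1\<close> are floored values at consecutive times and
  \<open>A'\<close> is the next value of \<open>A\<close>, so the right side is a fraction of weight
  times momentum. By the tangent bound the relative growth is at most
  \<open>4*l/3 * B0 powr (-2/3) / 3\<close>; as \<open>A' \<le> 16/9 * B0\<close>, passing to
  \<open>A'\<close> costs \<open>(16/9) powr (2/3) \<le> 147/100\<close>, and
  \<open>2/3 * 147/100 / 3 = 49/150\<close>.\<close>

lemma weight_growth:
  fixes u B0 B1 A' l :: real
  assumes u: "0 \<le> u" "max 1 (1728 * u ^ 3) \<le> B0" and B: "B0 \<le> B1" "B1 \<le> B0 + 4 * u"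
    and A': "0 < A'" "A' \<le> B1 + 4 * u" and l: "1/4 \<le> l" "l \<le> 1/2"
  shows "B1 powr (4*l/3) - B0 powr (4*l/3) \<le> 33/100 * (B1 powr (4*l/3) * A' powr (-2/3))"
proof -
  have B0: "B0 \<ge> 1" using u by simp
  have t: "12 * u \<le> B0 powr (1/3)" "12 * u \<le> B0" using threshold[OF u] .
  have "B1 powr (4*l/3) - B0 powr (4*l/3) \<le> (4*l/3) * B0 powr (4*l/3) * ((B1 - B0) / B0)"
    using l B B0 by (intro powr_diff_le) auto
  also have "(B1 - B0) / B0 \<le> (B0 powr (1/3) / 3) / B0"
    using t B B0 by (intro divide_right_mono) auto
  also have "(B0 powr (1/3) / 3) / B0 = B0 powr (-2/3) / 3"
    using B0 powr_diff[of B0 "1/3" 1] by simp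
  also have "(4*l/3) * B0 powr (4*l/3) * (B0 powr (-2/3) / 3)
      \<le> (4*(1/2)/3) * B1 powr (4*l/3) * ((147/100 * A' powr (-2/3)) / 3)"
  proof (intro mult_mono)
    have "A' \<le> 16/9 * B0" using A' t B by simp
    then have "(16/9 * B0) powr (-2/3) \<le> A' powr (-2/3)"
      using A' by (intro powr_mono2') auto
    then have "(16/9 * B0) powr (-2/3) * (16/9) powr (2/3) \<le> A' powr (-2/3) * (16/9) powr (2/3)"
      by (intro mult_right_mono) auto
    moreover have "(16/9 * B0) powr (-2/3) * (16/9) powr (2/3) = B0 powr (-2/3)"
    proof -
      have "(16/9::real) powr (-2/3) * (16/9) powr (2/3) = 1"
        by (simp flip: powr_add)
      moreover have "(16/9 * B0) powr (-2/3) = (16/9) powr (-2/3) * B0 powr (-2/3)"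
        by (rule powr_mult)
      ultimately show ?thesis by (simp add: mult.commute mult.left_commute)
    qed
    moreover have "A' powr (-2/3) * (16/9) powr (2/3) \<le> A' powr (-2/3) * (147/100)"
      by (intro mult_left_mono powr_two_thirds_le) (simp_all add: field_simps)
    ultimately show "B0 powr (-2/3) / 3 \<le> (147/100 * A' powr (-2/3)) / 3" by linarith
    show "B0 powr (4*l/3) \<le> B1 powr (4*l/3)" using B B0 l by (intro powr_mono2) auto
  qed (use l in auto)
  also have "\<dots> = 49/150 * (B1 powr (4*l/3) * A' powr (-2/3))"
    by simp
  also have "\<dots> \<le> 33/100 * (B1 powr (4*l/3) * A' powr (-2/3))"
    by (intro mult_right_mono) auto
  finally show ?thesis using l B0 by (simp add: mult_left_mono)
qed

text \<open>This quantity is what \<open>error_recursion\<close> pays for exchanging the two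
  momenta. The first bound telescopes and serves below the threshold, where its constant factor is
  tolerable; the second is quadratic in the relative increment of \<open>A\<close> and serves above
  it.\<close>

lemma momentum_change:
  fixes u A A' :: real
  defines "a \<equiv> A powr (-2/3)" and "a' \<equiv> A' powr (-2/3)"
  assumes u: "0 \<le> u" and A: "1 \<le> A" "A \<le> A'" "A' \<le> A + 4 * u"
  shows "(a - a')\<^sup>2 / a' \<le> (a - a') * (4 * u) powr (2/3)"
    and "max 1 (1728 * u ^ 3) \<le> A \<Longrightarrow> (a - a')\<^sup>2 / a' \<le> 4/9 * (a * ((A' - A) / A)\<^sup>2)"
proof -
  have le: "a' \<le> a" unfolding a_def a'_def using A by (intro powr_mono2') auto
  have pos: "0 < a'" "0 < a" unfolding a_def a'_def using A by auto
  have ratio: "a / a' = (A' / A) powr (2/3)"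
    unfolding a_def a'_def using A powr_minus[of A "2/3"] powr_minus[of A' "2/3"]
    by (simp add: powr_divide field_simps)
  have eq: "(a - a')\<^sup>2 / a' = (a - a') * (a / a' - 1)"
    using pos by (simp add: power2_eq_square field_simps)
  have "A' / A \<le> 1 + 4 * u"
  proof -
    have "A' \<le> A * (1 + 4 * u)" using A u mult_right_mono[of 1 A "4*u"] by (simp add: algebra_simps)
    then show ?thesis using A by (simp add: field_simps)
  qed
  then have "(A' / A) powr (2/3) \<le> (1 + 4 * u) powr (2/3)" using A by (intro powr_mono2) auto
  also have "\<dots> \<le> 1 powr (2/3) + (4 * u) powr (2/3)" using u by (intro powr_add_le) auto
  finally have "a / a' - 1 \<le> (4 * u) powr (2/3)" using ratio by simp
  then show "(a - a')\<^sup>2 / a' \<le> (a - a') * (4 * u) powr (2/3)"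
    unfolding eq using le by (intro mult_left_mono) auto
  define v where "v = 2/3 * ((A' - A) / A)"
  have v0: "v \<ge> 0" unfolding v_def using A by auto
  have "(A' / A) powr (2/3) \<le> 1 + 2/3 * (A' / A - 1)" using A by (intro powr_le_tangent) auto
  also have "A' / A - 1 = (A' - A) / A" using A by (simp add: field_simps)
  finally have r: "a / a' - 1 \<le> v" using ratio by (simp add: v_def)
  have "(a - a') \<le> a * (a / a' - 1)"
  proof -
    have "a * (a / a' - 1) - (a - a') = (a - a')\<^sup>2 / a'"
      using pos by (simp add: power2_eq_square field_simps)
    then show ?thesis using pos by (smt (verit) divide_nonneg_pos zero_le_power2)
  qed
  also have "\<dots> \<le> a * v" using r pos by (intro mult_left_mono) auto
  finally have "(a - a') * (a / a' - 1) \<le> (a * v) * v"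
    using r le pos v0 by (intro mult_mono) (auto simp: field_simps)
  also have "\<dots> = 4/9 * (a * ((A' - A) / A)\<^sup>2)"
    unfolding v_def by (simp add: power2_eq_square field_simps)
  finally show "(a - a')\<^sup>2 / a' \<le> 4/9 * (a * ((A' - A) / A)\<^sup>2)" unfolding eq .
qed

text \<open>The momentum \<open>a'\<close> depends on the new sample, so the cross term is expressed with the
  previous momentum \<open>a\<close>: only then does it vanish in expectation.\<close>

lemma error_recursion:
  fixes e Z N :: "'a::real_inner"
  assumes a: "0 < a'" "a' \<le> a" "a \<le> 1"
  shows "(norm ((1 - a') *\<^sub>R e + Z + a' *\<^sub>R N))\<^sup>2 \<le> (1 - 3/4 * a') * (norm e)\<^sup>2
    + 2 * (1 - a) * (e \<bullet> (Z + a *\<^sub>R N)) + 8 * ((a - a')\<^sup>2 / a') * ((norm Z)\<^sup>2 + (norm N)\<^sup>2)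
    + 2 * (norm Z)\<^sup>2 + 2 * a\<^sup>2 * (norm N)\<^sup>2"
proof -
  \<comment> \<open>Young's inequality with weight \<open>a'/8\<close>. It is applied once to
    \<open>Z\<close> and once to \<open>N\<close>, which lowers the contraction from
    \<open>a'\<close> to \<open>3/4 * a'\<close>.\<close>
  have Y: "2 * (\<kappa> * (a - a') * (e \<bullet> V)) \<le> a'/8 * (norm e)\<^sup>2 + 8 * ((a - a')\<^sup>2 / a') * (norm V)\<^sup>2"
    if "\<bar>\<kappa>\<bar> \<le> 1" for V :: 'a and \<kappa> :: real
  proof -
    have "\<kappa> * (a - a') * (e \<bullet> V) \<le> \<bar>\<kappa>\<bar> * (a - a') * \<bar>e \<bullet> V\<bar>"
      using a by (metis abs_ge_self abs_mult abs_of_nonneg diff_ge_0_iff_ge)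
    also have "\<dots> \<le> 1 * (a - a') * (norm e * norm V)"
      using that a Cauchy_Schwarz_ineq2[of e V] by (intro mult_mono) auto
    finally have 1: "2 * (\<kappa> * (a - a') * (e \<bullet> V)) \<le> 2 * ((a - a') * (norm e * norm V))" by simp
    have "0 \<le> (a' * norm e - 8 * (a - a') * norm V)\<^sup>2 / (8 * a')" using a by simp
    also have "\<dots> = a'/8 * (norm e)\<^sup>2 + 8 * ((a - a')\<^sup>2 / a') * (norm V)\<^sup>2 - 2 * ((a - a') * (norm e * norm V))"
      using a by (simp add: power2_eq_square field_simps)
    finally show ?thesis using 1 by simp
  qed
  have ex: "(norm (c *\<^sub>R e + U))\<^sup>2 = c\<^sup>2 * (norm e)\<^sup>2 + 2 * c * (e \<bullet> U) + (norm U)\<^sup>2" for c and U :: 'a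
    unfolding power2_norm_eq_inner
    by (simp add: inner_add_left inner_add_right inner_commute power2_eq_square algebra_simps)
  have "(norm ((1 - a') *\<^sub>R e + (Z + a' *\<^sub>R N)))\<^sup>2
      = (1 - a')\<^sup>2 * (norm e)\<^sup>2 + 2 * (1 - a') * (e \<bullet> (Z + a' *\<^sub>R N)) + (norm (Z + a' *\<^sub>R N))\<^sup>2"
    by (rule ex)
  \<comment> \<open>The coefficient of \<open>e \<bullet> N\<close> changes by
    \<open>(1 - a') * a' - (1 - a) * a = (a + a' - 1) * (a - a')\<close>, whose first factor is at
    most 1 in absolute value.\<close>
  moreover have "2 * (1 - a') * (e \<bullet> (Z + a' *\<^sub>R N)) = 2 * (1 - a) * (e \<bullet> (Z + a *\<^sub>R N))
      + 2 * (1 * (a - a') * (e \<bullet> Z)) + 2 * ((a + a' - 1) * (a - a') * (e \<bullet> N))"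
    by (simp add: inner_add_right algebra_simps power2_eq_square)
  moreover have "(norm (Z + a' *\<^sub>R N))\<^sup>2 \<le> 2 * (norm Z)\<^sup>2 + 2 * a\<^sup>2 * (norm N)\<^sup>2"
  proof -
    have "norm (Z + a' *\<^sub>R N) \<le> norm Z + a' * norm N"
      using norm_triangle_ineq[of Z "a' *\<^sub>R N"] a by simp
    also have "\<dots> \<le> norm Z + a * norm N" using a by (simp add: mult_right_mono)
    finally have "(norm (Z + a' *\<^sub>R N))\<^sup>2 \<le> (norm Z + a * norm N)\<^sup>2" by (intro power_mono) auto
    also have "\<dots> \<le> 2 * (norm Z)\<^sup>2 + 2 * a\<^sup>2 * (norm N)\<^sup>2"
      using zero_le_power2[of "norm Z - a * norm N"] by (simp add: power2_eq_square algebra_simps)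
    finally show ?thesis .
  qed
  moreover have "(1 - a')\<^sup>2 * (norm e)\<^sup>2 \<le> (1 - a') * (norm e)\<^sup>2"
    using a by (intro mult_right_mono) (auto simp: power2_eq_square mult_left_le)
  moreover have "\<bar>a + a' - 1\<bar> \<le> 1" using a by auto
  moreover have "(1 - 3/4 * a') * (norm e)\<^sup>2 = (1 - a') * (norm e)\<^sup>2 + a'/8 * (norm e)\<^sup>2 + a'/8 * (norm e)\<^sup>2"
    by (simp add: algebra_simps)
  moreover have "8 * ((a - a')\<^sup>2 / a') * ((norm Z)\<^sup>2 + (norm N)\<^sup>2)
      = 8 * ((a - a')\<^sup>2 / a') * (norm Z)\<^sup>2 + 8 * ((a - a')\<^sup>2 / a') * (norm N)\<^sup>2"
    by (rule distrib_left)
  ultimately show ?thesis using Y[of 1 Z] Y[of "a + a' - 1" N]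
    unfolding add.assoc[of "(1 - a') *\<^sub>R e"] by linarith
qed

text \<open>Of the two factors \<open>A' - A\<close> in \<open>momentum_change\<close> one is kept
  as \<open>dl\<^sup>2\<close>; the other, and the factor \<open>4 * u\<close> coming from
  \<open>4 * sh\<^sup>2\<close>, are each at most \<open>A powr (1/3) / 3\<close>. Since
  \<open>A powr (2/3) / A\<^sup>2 = a\<^sup>2\<close>, the correction takes the form
  \<open>a\<^sup>2 * dl\<^sup>2\<close> of a noise term, with constant
  \<open>32/81 \<le> 2/5\<close>.\<close>

lemma noise_change_bound:
  fixes u A A' a0 sh dl :: real
  defines "a \<equiv> A powr (-2/3)" and "a' \<equiv> A' powr (-2/3)"
  assumes a0: "0 < a0" and u: "u = sh\<^sup>2 / a0\<^sup>2"
    and A: "1 \<le> A" "max 1 (1728 * u ^ 3) \<le> A" and A': "A' = A + dl\<^sup>2 / a0\<^sup>2" "dl\<^sup>2 \<le> 4 * sh\<^sup>2"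
  shows "8 * ((a - a')\<^sup>2 / a') * (4 * sh\<^sup>2) \<le> 2/5 * (a\<^sup>2 * dl\<^sup>2)"
    and "8 * ((a - a')\<^sup>2 / a') \<le> 2/5"
proof -
  have u0: "0 \<le> u" unfolding u by simp
  have sh: "sh\<^sup>2 = u * a0\<^sup>2" using a0 unfolding u by simp
  have dl: "dl\<^sup>2 = (A' - A) * a0\<^sup>2" using a0 A' by simp
  have "(A' - A) * a0\<^sup>2 \<le> 4 * u * a0\<^sup>2" using A' dl sh by simp
  then have inc: "A' \<le> A + 4 * u" using a0 by simp
  have le: "A \<le> A'" using A' by simp
  have Q: "(a - a')\<^sup>2 / a' \<le> 4/9 * (a * ((A' - A) / A)\<^sup>2)"
    unfolding a_def a'_def using momentum_change(2)[OF u0 A(1) le inc A(2)] .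
  have t: "12 * u \<le> A powr (1/3)" "12 * u \<le> A" using threshold[OF u0 A(2)] .
  have a1: "0 \<le> a" "a \<le> 1" unfolding a_def using A powr_mono2'[of "-2/3" 1 A] by auto
  have "(A' - A) / A \<le> 1/3" using inc t A by (simp add: field_simps)
  then have "((A' - A) / A)\<^sup>2 \<le> (1/3)\<^sup>2" using le A by (intro power_mono) auto
  then have "a * ((A' - A) / A)\<^sup>2 \<le> 1 * (1/3)\<^sup>2" using a1 by (intro mult_mono) auto
  then have "4/9 * (a * ((A' - A) / A)\<^sup>2) \<le> 4/81" by (simp add: power2_eq_square)
  then show "8 * ((a - a')\<^sup>2 / a') \<le> 2/5" using Q by simp
  have "8 * ((a - a')\<^sup>2 / a') * (4 * sh\<^sup>2) \<le> 8 * (4/9 * (a * ((A' - A) / A)\<^sup>2)) * (4 * sh\<^sup>2)"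
    using Q by (intro mult_right_mono) auto
  also have "\<dots> = 32/9 * (a * ((A' - A) * a0\<^sup>2)) * ((A' - A) * (4 * u)) / A\<^sup>2"
    unfolding sh by (simp add: power2_eq_square)
  also have "\<dots> \<le> 32/9 * (a * ((A' - A) * a0\<^sup>2)) * ((A powr (1/3) / 3) * (A powr (1/3) / 3)) / A\<^sup>2"
    using inc t u0 le a1 A by (intro divide_right_mono mult_left_mono mult_mono) auto
  also have "\<dots> = 32/81 * (a * dl\<^sup>2 * (A powr (1/3) * A powr (1/3) / A\<^sup>2))"
    unfolding dl by simp
  also have "A powr (1/3) * A powr (1/3) / A\<^sup>2 = a\<^sup>2"
  proof -
    have "A powr (1/3) * A powr (1/3) / A\<^sup>2 = A powr (2/3) / A powr 2"
      using A by (simp flip: powr_add)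
    also have "\<dots> = A powr (-4/3)" by (simp flip: powr_diff)
    also have "\<dots> = a\<^sup>2" unfolding a_def power2_eq_square by (simp flip: powr_add)
    finally show ?thesis .
  qed
  also have "32/81 * (a * dl\<^sup>2 * a\<^sup>2) \<le> 2/5 * (1 * dl\<^sup>2 * a\<^sup>2)"
    using a1 by (intro mult_mono) auto
  finally show "8 * ((a - a')\<^sup>2 / a') * (4 * sh\<^sup>2) \<le> 2/5 * (a\<^sup>2 * dl\<^sup>2)" by (simp add: mult.commute)
qed

text \<open>Flooring the weight at \<open>m\<close> covers the initial phase, in which the momentum may drop by a
  large factor in one step, without a stopping time: above \<open>m\<close> the weight changes by a small fraction
  of the contraction.\<close>

lemma potential_step:
  fixes e e' Z N :: "'a::real_inner" and u A0 A A' a0 sh dl l :: real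
  defines "a \<equiv> A powr (-2/3)" and "a' \<equiv> A' powr (-2/3)" and "m \<equiv> max 1 (1728 * u ^ 3)"
  defines "w0 \<equiv> max A0 m powr (4*l/3)" and "w \<equiv> max A m powr (4*l/3)"
  assumes a0: "0 < a0" and u: "u = sh\<^sup>2 / a0\<^sup>2" and l: "1/4 \<le> l" "l \<le> 1/2"
    and A: "1 \<le> A0" "A0 \<le> A" "A \<le> A0 + 4 * u" and A': "A' = A + dl\<^sup>2 / a0\<^sup>2" "dl\<^sup>2 \<le> 4 * sh\<^sup>2"
    and N: "(norm N)\<^sup>2 \<le> 4 * sh\<^sup>2"
    and e': "e' = (1 - a') *\<^sub>R e + Z + a' *\<^sub>R N"
  shows "1/3 * (A' powr (4*l/3 - 2/3) * (norm e)\<^sup>2) \<le> w0 * (norm e)\<^sup>2 - w * (norm e')\<^sup>2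
     + w * (2 * (1 - a) * (e \<bullet> (Z + a *\<^sub>R N)))
     + w * (if m \<le> A then 12/5 else 2 + 8 * (4*u) powr (2/3)) * (norm Z)\<^sup>2
     + 2 * (w * (a\<^sup>2 * (norm N)\<^sup>2))
     + (if m \<le> A then 2/5 * (A powr (4*l/3) * (a\<^sup>2 * dl\<^sup>2)) else 0)
     + (if 1 < m then m powr (4*l/3) * (32 * sh\<^sup>2 * (4*u) powr (2/3) * (a - a')) else 0)"
proof -
  have u0: "0 \<le> u" unfolding u by simp
  have A1: "1 \<le> A" using A by simp
  have le: "A \<le> A'" using A' by simp
  have "(A' - A) * a0\<^sup>2 \<le> 4 * u * a0\<^sup>2" using A' a0 unfolding u by simp
  then have inc: "A' \<le> A + 4 * u" using a0 by simp
  have a'a: "a' \<le> a" unfolding a_def a'_def using A1 le by (intro powr_mono2') auto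
  have a'0: "0 < a'" unfolding a'_def using A1 le by simp
  have a1: "a \<le> 1" unfolding a_def using powr_mono2'[of "-2/3" 1 A] A1 by simp
  have w0: "0 \<le> w" unfolding w_def by simp
  define R where "R = (a - a')\<^sup>2 / a'"
  define P where "P = 2 * (1 - a) * (e \<bullet> (Z + a *\<^sub>R N))"
  have ER: "(norm e')\<^sup>2 \<le> (1 - 3/4 * a') * (norm e)\<^sup>2 + P + 8 * R * ((norm Z)\<^sup>2 + (norm N)\<^sup>2)
    + 2 * (norm Z)\<^sup>2 + 2 * a\<^sup>2 * (norm N)\<^sup>2"
    unfolding e' R_def P_def by (rule error_recursion[OF a'0 a'a a1])
  have R1: "R \<le> (a - a') * (4 * u) powr (2/3)"
    unfolding R_def a_def a'_def by (rule momentum_change(1)[OF u0 A1 le inc])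
  have grow: "w - w0 \<le> 33/100 * (w * a')"
    unfolding w_def w0_def a'_def
    by (rule weight_growth[of u]) (use u0 A A1 le inc l in \<open>auto simp: m_def\<close>)
  have ratio: "A' powr (4*l/3) \<le> 61/50 * w"
    unfolding w_def by (rule weight_ratio[of u]) (use u0 A1 le inc l in \<open>auto simp: m_def\<close>)
  have "A' powr (4*l/3 - 2/3) = A' powr (4*l/3) * a'"
    unfolding a'_def by (simp flip: powr_add)
  also have "\<dots> \<le> 61/50 * w * a'" using ratio a'0 by (intro mult_right_mono) auto
  \<comment> \<open>Budget of the contraction \<open>3/4\<close>: the share \<open>33/100\<close>
    covers the growth of the weight, and \<open>42/100\<close>, which exceeds \<open>61/150\<close>,
    covers the summand to be bounded.\<close>
  finally have "1/3 * A' powr (4*l/3 - 2/3) \<le> 42/100 * (w * a')"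
    using mult_nonneg_nonneg[OF w0 less_imp_le[OF a'0]] by linarith
  then have "1/3 * A' powr (4*l/3 - 2/3) \<le> 3/4 * (w * a') - (w - w0)" using grow by linarith
  then have "1/3 * A' powr (4*l/3 - 2/3) * (norm e)\<^sup>2 \<le> (3/4 * (w * a') - (w - w0)) * (norm e)\<^sup>2"
    by (intro mult_right_mono) auto
  also have "\<dots> = w0 * (norm e)\<^sup>2 - w * ((1 - 3/4 * a') * (norm e)\<^sup>2)"
    by (simp add: algebra_simps)
  finally have 1: "1/3 * A' powr (4*l/3 - 2/3) * (norm e)\<^sup>2 \<le> w0 * (norm e)\<^sup>2 - w * ((1 - 3/4 * a') * (norm e)\<^sup>2)" .
  have 2: "w * (norm e')\<^sup>2 \<le> w * ((1 - 3/4 * a') * (norm e)\<^sup>2) + w * P + w * (8 * R + 2) * (norm Z)\<^sup>2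
      + w * (8 * R * (norm N)\<^sup>2) + 2 * (w * (a\<^sup>2 * (norm N)\<^sup>2))"
    using mult_left_mono[OF ER w0] by (simp add: algebra_simps)
  have RN: "8 * R * (norm N)\<^sup>2 \<le> 8 * R * (4 * sh\<^sup>2)"
    using N a'0 unfolding R_def by (intro mult_left_mono) auto
  have Z: "8 * R + 2 \<le> (if m \<le> A then 12/5 else 2 + 8 * (4*u) powr (2/3))"
  proof (cases "m \<le> A")
    case True
    then show ?thesis using noise_change_bound(2)[OF a0 u A1 _ A'] unfolding m_def R_def a_def a'_def by simp
  next
    case False
    have "(a - a') * (4 * u) powr (2/3) \<le> 1 * (4 * u) powr (2/3)" using a1 a'0 by (intro mult_right_mono) auto
    then show ?thesis using R1 False by simp
  qed
  have 3: "w * (8 * R + 2) * (norm Z)\<^sup>2 \<le> w * (if m \<le> A then 12/5 else 2 + 8 * (4*u) powr (2/3)) * (norm Z)\<^sup>2"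
    using Z w0 by (intro mult_right_mono mult_left_mono) auto
  have 4: "w * (8 * R * (norm N)\<^sup>2) \<le> (if m \<le> A then 2/5 * (A powr (4*l/3) * (a\<^sup>2 * dl\<^sup>2)) else 0)
     + (if 1 < m then m powr (4*l/3) * (32 * sh\<^sup>2 * (4*u) powr (2/3) * (a - a')) else 0)"
  proof (cases "m \<le> A")
    case True
    have "8 * R * (4 * sh\<^sup>2) \<le> 2/5 * (a\<^sup>2 * dl\<^sup>2)"
      using noise_change_bound(1)[OF a0 u A1 _ A'] True unfolding m_def R_def a_def a'_def by simp
    then have "w * (8 * R * (norm N)\<^sup>2) \<le> w * (2/5 * (a\<^sup>2 * dl\<^sup>2))" using RN w0 by (intro mult_left_mono) auto
    moreover have "w = A powr (4*l/3)" using True unfolding w_def by (simp add: max_def)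
    moreover have "0 \<le> (if 1 < m then m powr (4*l/3) * (32 * sh\<^sup>2 * (4*u) powr (2/3) * (a - a')) else 0)"
      using a'a by simp
    moreover have "w * (2/5 * (a\<^sup>2 * dl\<^sup>2)) = 2/5 * (w * (a\<^sup>2 * dl\<^sup>2))" by simp
    ultimately show ?thesis using True by (smt (verit))
  next
    case False
    then have m: "1 < m" "w = m powr (4*l/3)" using A1 unfolding w_def by (auto simp: max_def)
    have "8 * R * (4 * sh\<^sup>2) \<le> 8 * ((a - a') * (4 * u) powr (2/3)) * (4 * sh\<^sup>2)"
      using R1 by (intro mult_right_mono) auto
    also have "\<dots> = 32 * sh\<^sup>2 * (4*u) powr (2/3) * (a - a')" by simp
    finally have "8 * R * (norm N)\<^sup>2 \<le> 32 * sh\<^sup>2 * (4*u) powr (2/3) * (a - a')"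
      using RN by linarith
    then have "w * (8 * R * (norm N)\<^sup>2) \<le> w * (32 * sh\<^sup>2 * (4*u) powr (2/3) * (a - a'))"
      using w0 by (rule mult_left_mono)
    then show ?thesis using m False by simp
  qed
  show ?thesis using 1 2 3 4 unfolding P_def[symmetric] by linarith
qed

text \<open>A left-endpoint sum for the integral of \<open>x powr (-4/3)\<close>. The right-endpoint
  sum is at most 3; passing to the left endpoints costs the step bound \<open>4 * u\<close> times
  the telescoping drop of the integrand.\<close>

lemma sum_first_phase:
  fixes A :: "nat \<Rightarrow> real"
  assumes A: "A 1 = 1" "\<And>t. t \<ge> 1 \<Longrightarrow> 1 \<le> A t" "\<And>t. t \<ge> 1 \<Longrightarrow> A t \<le> A (Suc t)"
    "\<And>t. t \<ge> 1 \<Longrightarrow> A (Suc t) \<le> A t + 4 * u" and u: "0 \<le> u"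
  shows "(\<Sum>t=1..T. A t powr (-4/3) * (A (Suc t) - A t)) \<le> 3 + 4 * u"
proof -
  have "(\<Sum>t=1..T. A t powr (-4/3) * (A (Suc t) - A t))
      \<le> 3 * (1 - A (Suc T) powr (-1/3)) + 4 * u * (1 - A (Suc T) powr (-4/3))"
  proof (induction T)
    case 0 then show ?case using A by simp
  next
    case (Suc T)
    let ?x = "A (Suc T)" and ?y = "A (Suc (Suc T))"
    have x: "1 \<le> ?x" "?x \<le> ?y" "?y \<le> ?x + 4 * u" using A(2-4)[of "Suc T"] by auto
    have "1/3 * (?y powr (- (1/3) - 1) * (?y - ?x)) \<le> ?x powr (-(1/3)) - ?y powr (-(1/3))"
      using x by (intro powr_minus_diff_ge) auto
    then have 1: "?y powr (-4/3) * (?y - ?x) \<le> 3 * (?x powr (-1/3) - ?y powr (-1/3))" by simp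
    have "?y powr (-4/3) \<le> ?x powr (-4/3)" using x by (intro powr_mono2') auto
    then have "(?x powr (-4/3) - ?y powr (-4/3)) * (?y - ?x) \<le> (?x powr (-4/3) - ?y powr (-4/3)) * (4 * u)"
      using x by (intro mult_left_mono) auto
    then have "?x powr (-4/3) * (?y - ?x) \<le> 3 * (?x powr (-1/3) - ?y powr (-1/3)) + 4 * u * (?x powr (-4/3) - ?y powr (-4/3))"
      using 1 by (simp add: algebra_simps)
    then show ?case using Suc by (simp add: algebra_simps)
  qed
  also have "\<dots> \<le> 3 * 1 + 4 * u * 1" using u by (intro add_mono mult_left_mono) auto
  finally show ?thesis by simp
qed

text \<open>An antiderivative of \<open>x powr ((4*l - 4)/3)\<close>, that is, of the weight
  \<open>x powr (4*l/3)\<close> times the squared momentum \<open>x powr (-4/3)\<close>; the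
  exponent is \<open>-1\<close> exactly for \<open>l = 1/4\<close>.\<close>

definition growth :: "real \<Rightarrow> real \<Rightarrow> real" where
  "growth l x = (if l = 1/4 then ln x else 3 / (4*l - 1) * x powr ((4*l - 1) / 3))"

text \<open>Concavity gives the increment at the right endpoint. Above the threshold
  \<open>y \<le> 4/3 * x\<close>, so moving to the left endpoint costs at most
  \<open>(4/3) powr ((4 - 4*l)/3) \<le> 4/3\<close>.\<close>

lemma growth_step:
  fixes x y u l :: real
  assumes l: "1/4 \<le> l" "l \<le> 1/2" and x: "1 \<le> x" "x \<le> y" "y \<le> x + 4 * u"
  shows "growth l x \<le> growth l y"
    and "0 \<le> u \<Longrightarrow> max 1 (1728 * u ^ 3) \<le> x \<Longrightarrow> x powr (4*l/3) * ((x powr (-2/3))\<^sup>2 * (y - x)) \<le> 4/3 * (growth l y - growth l x)"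
proof -
  have inc: "y powr ((4*l-4)/3) * (y - x) \<le> growth l y - growth l x"
  proof (cases "l = 1/4")
    case True
    then have "(4*l-4)/3 = -1" by simp
    moreover have "y powr -1 * (y - x) = (y - x) / y" using x by simp
    ultimately show ?thesis using ln_diff_ge[of x y] x True by (simp only: growth_def if_True) simp
  next
    case False
    define \<theta> where "\<theta> = (4*l - 1) / 3"
    have th: "0 < \<theta>" "\<theta> \<le> 1" using l False unfolding \<theta>_def by auto
    have "\<theta> * (y powr (\<theta> - 1) * (y - x)) \<le> y powr \<theta> - x powr \<theta>"
      using th x by (intro powr_diff_ge) auto
    then have "y powr (\<theta> - 1) * (y - x) \<le> 1/\<theta> * (y powr \<theta> - x powr \<theta>)" using th by (simp add: field_simps)
    moreover have "\<theta> - 1 = (4*l-4)/3" "1/\<theta> = 3 / (4*l-1)" unfolding \<theta>_def using False by (auto simp: field_simps)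
    ultimately show ?thesis using False unfolding growth_def \<theta>_def by (simp add: right_diff_distrib)
  qed
  moreover have "0 \<le> y powr ((4*l-4)/3) * (y - x)" using x by simp
  ultimately show "growth l x \<le> growth l y" by linarith
  assume u: "0 \<le> u" "max 1 (1728 * u ^ 3) \<le> x"
  have y: "y \<le> 4/3 * x" using threshold(2)[OF u] x by simp
  have "x powr (4*l/3) * ((x powr (-2/3))\<^sup>2 * (y - x)) = x powr ((4*l-4)/3) * (y - x)"
    unfolding power2_eq_square by (simp add: diff_divide_distrib flip: powr_add mult.assoc)
  also have "x powr ((4*l-4)/3) \<le> 4/3 * y powr ((4*l-4)/3)"
  proof -
    have "(4/3 * x) powr ((4*l-4)/3) \<le> y powr ((4*l-4)/3)" using y x l by (intro powr_mono2') auto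
    then have "(4/3) powr ((4*l-4)/3) * x powr ((4*l-4)/3) \<le> y powr ((4*l-4)/3)" by (simp only: powr_mult)
    moreover have "(4/3) powr (-1) \<le> (4/3) powr ((4*l-4)/3)" using l by (intro powr_mono) auto
    then have "3/4 * x powr ((4*l-4)/3) \<le> (4/3) powr ((4*l-4)/3) * x powr ((4*l-4)/3)"
      by (intro mult_right_mono) auto
    ultimately show ?thesis by linarith
  qed
  then have "x powr ((4*l-4)/3) * (y - x) \<le> 4/3 * y powr ((4*l-4)/3) * (y - x)"
    using x by (intro mult_right_mono) auto
  also have "\<dots> \<le> 4/3 * (growth l y - growth l x)"
    unfolding mult.assoc using inc by (rule mult_left_mono) simp
  finally show "x powr (4*l/3) * ((x powr (-2/3))\<^sup>2 * (y - x)) \<le> 4/3 * (growth l y - growth l x)" .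
qed

lemma sum_second_phase:
  fixes A :: "nat \<Rightarrow> real"
  assumes A: "A 1 = 1" "\<And>t. t \<ge> 1 \<Longrightarrow> 1 \<le> A t" "\<And>t. t \<ge> 1 \<Longrightarrow> A t \<le> A (Suc t)"
    "\<And>t. t \<ge> 1 \<Longrightarrow> A (Suc t) \<le> A t + 4 * u" and u: "0 \<le> u" and l: "1/4 \<le> l" "l \<le> 1/2"
  shows "(\<Sum>t=1..T. if max 1 (1728 * u ^ 3) \<le> A t then A t powr (4*l/3) * ((A t powr (-2/3))\<^sup>2 * (A (Suc t) - A t)) else 0)
     \<le> 4/3 * growth l (A (Suc T))"
proof -
  have "(\<Sum>t=1..T. if max 1 (1728 * u ^ 3) \<le> A t then A t powr (4*l/3) * ((A t powr (-2/3))\<^sup>2 * (A (Suc t) - A t)) else 0)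
     \<le> (\<Sum>t=1..T. 4/3 * (growth l (A (Suc t)) - growth l (A t)))"
    by (intro sum_mono)
      (use growth_step[OF l A(2-4)] u in \<open>auto simp: atLeastAtMost_iff split: if_splits\<close>)
  also have "\<dots> = 4/3 * (growth l (A (Suc T)) - growth l (A 1))"
    unfolding sum_distrib_left[symmetric] by (subst sum_Suc_diff) auto
  also have "\<dots> \<le> 4/3 * growth l (A (Suc T))" using A(1) l by (simp add: growth_def)
  finally show ?thesis .
qed

section \<open>The step size\<close>

text \<open>The maximum of \<open>ln w / w\<close> is \<open>1 / exp 1\<close>, and the first six
  terms of the exponential series give \<open>exp 1 \<ge> 163/60\<close>.\<close>

lemma ln_div_self_le:
  fixes w :: real
  assumes w: "0 < w"
  shows "13/50 \<le> 1 - 2 * ln w / w"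
proof -
  have "ln (w / exp 1) \<le> w / exp 1 - 1" using w by (intro ln_le_minus_one) auto
  then have "ln w \<le> w / exp 1" using w by (simp add: ln_div)
  also have "\<dots> \<le> w / (163/60)"
  proof -
    have "(\<Sum>n<6. (1::real) ^ n /\<^sub>R fact n) \<le> exp 1"
      unfolding exp_def by (intro sum_le_suminf summable_exp_generic) auto
    then have "163/60 \<le> exp (1::real)" by (simp add: eval_nat_numeral)
    then show ?thesis using w by (intro divide_left_mono) auto
  qed
  finally show ?thesis using w by (simp add: field_simps)
qed

text \<open>The second factor 1 + (1 - 1/w) below leaves enough room to absorb the logarithm. For
  x at least 1 the left side exceeds x(1+x)^(-p) by at most p, and for x below 1 the worst case is
  p = 1/2.\<close>

lemma large_initial_stepsize:
  fixes p x w :: real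
  assumes p: "0 < p" "p \<le> 1/2" and x: "0 \<le> x" and w: "1 \<le> w"
  shows "x powr (1 - p) \<le> (2 - 1/w) * (x * (1 + x) powr (-p)) + (1 - 2 * ln w / w)"
proof -
  \<comment> \<open>\<open>\<theta>\<close> is the surplus of the factor over 1. The fact
    \<open>r1\<close> shows that the additive term is close to 1 for small \<open>\<theta>\<close>,
    and \<open>r2\<close> bounds it from below for all \<open>w\<close>.\<close>
  define \<theta> where "\<theta> = 1 - 1/w"
  have th: "0 \<le> \<theta>" "\<theta> \<le> 1" "2 - 1/w = 1 + \<theta>" using w unfolding \<theta>_def by auto
  have r1: "(1 - \<theta>)\<^sup>2 \<le> 1 - 2 * ln w / w"
  proof -
    have "2 * ln w \<le> w - 1/w"
    proof -
      define g where "g z = z - 1/z - 2 * ln z" for z :: real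
      have "g 1 \<le> g w"
      proof (rule DERIV_nonneg_imp_nondecreasing[OF w])
        fix z :: real assume z: "1 \<le> z" "z \<le> w"
        have "(g has_real_derivative (1 - 1/z)\<^sup>2) (at z)"
          unfolding g_def using z by (auto intro!: derivative_eq_intros simp: power2_eq_square field_simps)
        then show "\<exists>y. (g has_real_derivative y) (at z) \<and> 0 \<le> y" by (intro exI[of _ "(1 - 1/z)\<^sup>2"]) auto
      qed
      then show ?thesis unfolding g_def by simp
    qed
    then have "2 * ln w / w \<le> (w - 1/w) / w" using w by (intro divide_right_mono) auto
    also have "\<dots> = 1 - (1 - \<theta>)\<^sup>2" unfolding \<theta>_def using w by (simp add: power2_eq_square field_simps)
    finally show ?thesis by simp
  qed
  have r2: "13/50 \<le> 1 - 2 * ln w / w" by (rule ln_div_self_le) (use w in simp)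
  show ?thesis
  proof (cases "x \<le> 1")
    \<comment> \<open>For \<open>x \<le> 1\<close> the powers are compared with their values at
      \<open>p = 1/2\<close>. With \<open>y = sqrt x\<close> each subcase becomes a quadratic
      inequality in \<open>y\<close>, whose constant comes from \<open>r1\<close> for small
      \<open>\<theta>\<close> and from \<open>r2\<close> otherwise.\<close>
    case True
    have px: "(1 + x) powr (-1/2) \<le> (1 + x) powr (-p)" using x p by (intro powr_mono) auto
    have main: "x powr (1 - p) \<le> sqrt x"
      using powr_mono'[of "1/2" "1-p" x] p x True by (simp add: powr_half_sqrt)
    define y where "y = sqrt x"
    have y: "0 \<le> y" "y \<le> 1" "x = y\<^sup>2" using x True unfolding y_def by auto
    have low: "(1 + \<theta>) * (x * k) \<le> (1 + \<theta>) * (x * (1 + x) powr (-p))" if "k \<le> (1 + x) powr (-1/2)" for k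
      using that px th x by (intro mult_left_mono) auto
    have half: "k \<le> (1 + x) powr (-1/2)" if "k\<^sup>2 * (1 + x) \<le> 1" "0 \<le> k" for k
    proof -
      have "sqrt (k\<^sup>2 * (1 + x)) \<le> 1" using that by simp
      then have "k * sqrt (1 + x) \<le> 1" using that by (simp add: real_sqrt_mult)
      then show ?thesis using x by (simp add: powr_minus_divide powr_half_sqrt le_divide_eq)
    qed
    show ?thesis
    proof (cases "\<theta> \<le> 1/4")
      case True
      have "7/10 \<le> (1 + x) powr (-1/2)" by (rule half) (use \<open>x \<le> 1\<close> in \<open>auto simp: power2_eq_square\<close>)
      from low[OF this] have "(1 + \<theta>) * (x * (7/10)) \<le> (1 + \<theta>) * (x * (1 + x) powr (-p))" .
      moreover have "1 * (x * (7/10)) \<le> (1 + \<theta>) * (x * (7/10))" using th x by (intro mult_right_mono) auto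
      moreover have "9/16 \<le> (1 - \<theta>)\<^sup>2"
        using power_mono[of "3/4" "1 - \<theta>" 2] True by (simp add: power2_eq_square)
      moreover have "y \<le> x * (7/10) + 9/16"
        using zero_le_power2[of "y - 5/7"] unfolding y(3) by (simp add: power2_eq_square algebra_simps)
      ultimately show ?thesis using main r1 unfolding y_def[symmetric] th(3) by linarith
    next
      case False
      show ?thesis
      proof (cases "x \<le> 9/16")
        case True
        have "8/10 \<le> (1 + x) powr (-1/2)" by (rule half) (use True in \<open>auto simp: power2_eq_square\<close>)
        from low[OF this] have "(1 + \<theta>) * (x * (8/10)) \<le> (1 + \<theta>) * (x * (1 + x) powr (-p))" .
        moreover have "5/4 * (x * (8/10)) \<le> (1 + \<theta>) * (x * (8/10))" using False x by (intro mult_right_mono) auto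
        moreover have "y \<le> x + 1/4"
          using zero_le_power2[of "y - 1/2"] unfolding y(3) by (simp add: power2_eq_square algebra_simps)
        ultimately show ?thesis using main r2 unfolding y_def[symmetric] th(3) by linarith
      next
        case x2: False
        have "7/10 \<le> (1 + x) powr (-1/2)" by (rule half) (use \<open>x \<le> 1\<close> in \<open>auto simp: power2_eq_square\<close>)
        from low[OF this] have "(1 + \<theta>) * (x * (7/10)) \<le> (1 + \<theta>) * (x * (1 + x) powr (-p))" .
        moreover have "5/4 * (x * (7/10)) \<le> (1 + \<theta>) * (x * (7/10))" using False x by (intro mult_right_mono) auto
        moreover have "y \<le> x * (7/8) + 13/50"
        proof -
          have "3/4 \<le> y"
          proof (rule ccontr)
            assume "\<not> 3/4 \<le> y"
            then have "y\<^sup>2 \<le> (3/4)\<^sup>2" using y by (intro power_mono) auto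
            then show False using x2 y by (simp add: power2_eq_square)
          qed
          then have "0 \<le> (y - 3/4) * (7/8 * y - 11/32)" using y by (intro mult_nonneg_nonneg) auto
          moreover have "(y - 3/4) * (7/8 * y - 11/32) = 7/8 * (y * y) - y + 33/128" by (simp add: field_simps)
          ultimately show ?thesis unfolding y(3) power2_eq_square by linarith
        qed
        ultimately show ?thesis using main r2 unfolding y_def[symmetric] th(3) by linarith
      qed
    qed
  next
    case False
    then have x1: "1 < x" by simp
    \<comment> \<open>For \<open>x > 1\<close> the gap between \<open>x powr (1 - p)\<close> and
      \<open>x * (1 + x) powr (-p)\<close> is at most 1/2. The surplus pays
      \<open>7/10 * \<theta>\<close> and \<open>r1\<close> pays
      \<open>(1 - \<theta>)\<^sup>2\<close>, which together always exceed 1/2.\<close>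
    have tan: "(1 + x) powr (-p) \<ge> x powr (-p) * (1 - p / x)"
    proof -
      have "1 - p * ((1 + x) / x - 1) \<le> ((1 + x) / x) powr (-p)"
        using x1 p by (intro powr_minus_ge_tangent) auto
      then have "x powr (-p) * (1 - p * ((1 + x) / x - 1)) \<le> x powr (-p) * ((1 + x) / x) powr (-p)"
        by (intro mult_left_mono) auto
      moreover have "(1 + x) / x - 1 = 1 / x" using x1 by (simp add: field_simps)
      ultimately show ?thesis using x1 by (simp add: powr_divide)
    qed
    have eq: "x * x powr (-p) = x powr (1 - p)" using x1 powr_add[of x 1 "-p"] by simp
    have "x * (x powr (-p) * (1 - p / x)) \<le> x * (1 + x) powr (-p)" using tan x1 by (intro mult_left_mono) auto
    moreover have "x * (x powr (-p) * (1 - p / x)) = x powr (1 - p) - p * x powr (-p)"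
      unfolding eq[symmetric] using x1 by (simp add: field_simps)
    moreover have "p * x powr (-p) \<le> 1/2 * 1"
      using p x1 powr_mono2'[of "-p" 1 x] by (intro mult_mono) auto
    ultimately have h: "x powr (1 - p) \<le> x * (1 + x) powr (-p) + 1/2" by linarith
    have "7/10 \<le> x * (1 + x) powr (-p)"
    proof -
      have "7/10 \<le> (2::real) powr (-1/2)"
      proof -
        have "sqrt ((7/10)\<^sup>2 * 2) \<le> 1" by (simp add: power2_eq_square)
        then have "7/10 * sqrt 2 \<le> 1" by (simp only: real_sqrt_mult real_sqrt_power) simp
        then show ?thesis by (simp add: powr_minus_divide powr_half_sqrt field_simps)
      qed
      also have "(2::real) powr (-1/2) \<le> 2 powr (-p)" using p by (intro powr_mono) auto
      also have "\<dots> = 1 * 2 powr (-p)" by simp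
      also have "\<dots> \<le> x powr (1 - p) * 2 powr (-p)"
        using x1 p by (intro mult_right_mono ge_one_powr_ge_zero) auto
      also have "\<dots> = x * (2 * x) powr (-p)" unfolding eq[symmetric] by (simp add: powr_mult)
      also have "\<dots> \<le> x * (1 + x) powr (-p)" using x1 p by (intro mult_left_mono powr_mono2') auto
      finally show ?thesis .
    qed
    then have "\<theta> * (7/10) \<le> \<theta> * (x * (1 + x) powr (-p))" using th by (intro mult_left_mono) auto
    moreover have "1/2 \<le> \<theta> * (7/10) + (1 - \<theta>)\<^sup>2"
      using zero_le_power2[of "\<theta> - 13/20"] by (simp add: power2_eq_square algebra_simps)
    moreover have "(1 + \<theta>) * (x * (1 + x) powr (-p)) = x * (1 + x) powr (-p) + \<theta> * (x * (1 + x) powr (-p))"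
      by (simp add: algebra_simps)
    ultimately show ?thesis using h r1 unfolding th(3) by linarith
  qed
qed


text \<open>With \<open>c = 1/p - 1\<close>, the factor \<open>1/c\<close> gained here turns the
  \<open>1/p\<close> of the logarithmic increment in \<open>stepsize_sum\<close> into the
  \<open>1/(1 - p)\<close> of \<open>K7\<close>.\<close>

lemma stepsize_integrand:
  fixes y c :: real
  assumes "0 < y" "1 \<le> c"
  shows "c * (y powr (c - 1) * (1 - y)) \<le> 1"
proof -
  have "1 - (c - 1) * (y - 1) \<le> y powr (-(c - 1))"
    using assms by (intro powr_minus_ge_tangent) auto
  then have "y powr (c - 1) * (1 - (c - 1) * (y - 1)) \<le> y powr (c - 1) * y powr (-(c - 1))"
    by (intro mult_left_mono) auto
  also have "\<dots> = 1" using assms by (simp flip: powr_add)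
  also have "1 - (c - 1) * (y - 1) = c * (1 - y) + y" by (simp add: algebra_simps)
  finally have "y powr (c - 1) * (c * (1 - y)) + y powr (c - 1) * y \<le> 1" by (simp only: distrib_left)
  moreover have "0 \<le> y powr (c - 1) * y" using assms by simp
  ultimately show ?thesis by (simp add: mult.left_commute)
qed

text \<open>The summand equals \<open>n t / b t * (2 - q t / V t)\<close> with
  \<open>q t = Q * A t powr (p/3)\<close>. Where \<open>V t \<ge> q t\<close> the factor is at least
  1, and the sum of \<open>n t / b t\<close> dominates the left side up to the initial term. Where
  \<open>V t < q t\<close> the deficit is charged to the increase of \<open>ln (V t)\<close>,
  limited by \<open>ln (q T / b0)\<close>. If \<open>b0\<close> exceeds \<open>q T\<close> this
  logarithm is negative, and the surplus of the factor above 1 has to pay for it.\<close>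

lemma stepsize_sum:
  fixes n A :: "nat \<Rightarrow> real" and b0 p Q :: real
  defines "V \<equiv> \<lambda>t. (b0 powr (1/p) + (\<Sum>i=1..t. n i)) powr p"
  defines "b \<equiv> \<lambda>t. V t * A t powr ((1 - p)/3)"
  assumes b0: "0 < b0" and p: "0 < p" "p \<le> 1/2" and Q: "0 < Q" and n: "\<And>t. 0 \<le> n t"
    and A: "\<And>t. t \<ge> 1 \<Longrightarrow> 1 \<le> A t" "\<And>t. t \<ge> 1 \<Longrightarrow> A t \<le> A (Suc t)" and T: "1 \<le> T"
  shows "A T powr (-(1 - p)/3) * (\<Sum>i=1..T. n i) powr (1 - p)
    \<le> (\<Sum>t=1..T. 2 * n t / b t - Q * (n t * A t powr (1/3) / (b t)\<^sup>2)) + b0 powr (1/p - 1)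
      + Q powr (1/p - 1) / (1 - p) * (ln (Q / b0) + 1/3 * ln (A T))"
proof -
  define c where "c = 1/p - 1"
  have c: "1 \<le> c" "c * p = 1 - p" using p unfolding c_def by (auto simp: field_simps)
  define S where "S t = (\<Sum>i=1..t. n i)" for t
  define E where "E t = b0 powr (1/p) + S t" for t
  have S0: "0 \<le> S t" for t unfolding S_def using n by (intro sum_nonneg) auto
  have SS: "S (Suc t) = S t + n (Suc t)" for t unfolding S_def by simp
  have E0: "0 < E t" for t unfolding E_def using S0[of t] b0 by (simp add: add_pos_nonneg)
  have ES: "E (Suc t) = E t + n (Suc t)" for t unfolding E_def SS by simp
  have Emono: "s \<le> t \<Longrightarrow> E s \<le> E t" for s t
    by (rule lift_Suc_mono_le[of E]) (use ES n in auto)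
  have V: "V t = E t powr p" for t unfolding V_def E_def S_def ..
  have V0: "0 < V t" for t unfolding V using E0[of t] by simp
  have VE: "E t = V t powr (1/p)" for t unfolding V using p E0[of t] by (simp add: powr_powr)
  have Vb: "V 0 = b0" unfolding V E_def S_def using p b0 by (simp add: powr_powr)
  have Vmono: "s \<le> t \<Longrightarrow> V s \<le> V t" for s t
    unfolding V using Emono[of s t] E0[of s] p by (intro powr_mono2) auto
  have Amono: "A s \<le> A t" if "1 \<le> s" "s \<le> t" for s t
    using that(2,1) by (induction rule: dec_induct) (auto intro: order_trans[OF _ A(2)])
  have A0: "0 < A t" if "1 \<le> t" for t using A(1)[OF that] by simp
  have b: "0 < b t" if "1 \<le> t" for t unfolding b_def using A0[OF that] V0 by simp
  define \<alpha> where "\<alpha> = A T powr (-(1 - p)/3)"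
  have al: "0 < \<alpha>" "\<alpha> \<le> 1" unfolding \<alpha>_def
    using A0[OF T] A(1)[OF T] p powr_mono2'[of "-(1 - p)/3" 1 "A T"] by auto
  have inv_b: "1 / b t = A t powr (-(1 - p)/3) / V t" if "1 \<le> t" for t
    unfolding b_def minus_divide_left[symmetric] powr_minus_divide by simp
  have al_le: "\<alpha> \<le> A t powr (-(1 - p)/3)" if "1 \<le> t" "t \<le> T" for t
    unfolding \<alpha>_def using Amono[OF that] A0[OF that(1)] p by (intro powr_mono2') auto
  define q where "q t = Q * A t powr (p/3)" for t
  have q0: "0 < q t" if "1 \<le> t" for t unfolding q_def using Q A0[OF that] by simp
  have qmono: "q t \<le> q T" if "1 \<le> t" "t \<le> T" for t
    unfolding q_def using Q p Amono[OF that] A0[OF that(1)] by (intro mult_left_mono powr_mono2) auto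
  have qb: "Q * A t powr (1/3) / b t = q t / V t" if "1 \<le> t" for t
  proof -
    have "Q * A t powr (1/3) * (1 / b t) = Q * (A t powr (1/3) * A t powr (-(1 - p)/3)) / V t"
      unfolding inv_b[OF that] by simp
    also have "A t powr (1/3) * A t powr (-(1 - p)/3) = A t powr (p/3)"
      by (simp add: add_divide_distrib diff_divide_distrib flip: powr_add)
    finally show ?thesis unfolding q_def by simp
  qed
  have summand: "2 * n t / b t - Q * (n t * A t powr (1/3) / (b t)\<^sup>2) = n t / b t * (2 - q t / V t)" if "1 \<le> t" for t
    unfolding qb[OF that, symmetric] using b[OF that] by (simp add: power2_eq_square field_simps)
  define K where "K = Q powr c / (1 - p)"
  have K0: "0 < K" unfolding K_def using Q p by simp
  have lnA: "0 \<le> ln (A T)" using A(1)[OF T] by simp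
  have bc: "0 < b0 powr c" using b0 by simp
  have lnq: "ln (q T / b0) \<le> ln (Q / b0) + 1/3 * ln (A T)"
  proof -
    have "ln (q T / b0) = ln (Q / b0) + p/3 * ln (A T)"
      unfolding q_def using Q b0 A0[OF T] by (simp add: ln_div ln_mult)
    also have "p/3 * ln (A T) \<le> 1/3 * ln (A T)" using p lnA by (intro mult_right_mono) auto
    finally show ?thesis by simp
  qed
  have fin: "\<alpha> * S T powr (1 - p) \<le> (\<Sum>t=1..T. n t / b t * (2 - q t / V t)) + b0 powr c + K * ln (q T / b0)"
  proof (cases "b0 \<le> q T")
    case True
    \<comment> \<open>Once \<open>V t\<close> exceeds \<open>q T\<close> no deficit can occur, so
      the logarithm may be truncated there; its total increase is then at most
      \<open>ln (q T / b0)\<close>.\<close>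
    define g where "g t = ln (min (V t) (q T))" for t
    have tele: "(\<Sum>t=1..T. g t - g (t - 1)) = g T - g 0"
      by (induction T) auto
    have "g T \<le> ln (q T)" unfolding g_def using V0[of T] q0[OF T] by simp
    moreover have "g 0 = ln b0" unfolding g_def Vb using True by (simp add: min_def)
    ultimately have gT: "g T - g 0 \<le> ln (q T / b0)" using b0 q0[OF T] by (simp add: ln_div)
    have up: "n t / b t * (q t / V t - 1) \<le> K * (g t - g (t - 1))" if t: "t \<in> {1..T}" for t
    proof -
      have t1: "1 \<le> t" "t \<le> T" using t by auto
      have gm: "g (t - 1) \<le> g t" unfolding g_def using V0[of "t-1"] q0[OF T] Vmono[of "t-1" t] by auto
      show ?thesis
      proof (cases "V t \<le> q t")
        case False
        then have "n t / b t * (q t / V t - 1) \<le> 0"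
          using n[of t] b[OF t1(1)] V0[of t] by (intro mult_nonneg_nonpos) (auto simp: divide_simps)
        then show ?thesis using K0 gm by (smt (verit) mult_nonneg_nonneg)
      next
        case True
        define y where "y = V t / q t"
        have y: "0 < y" "y \<le> 1" unfolding y_def using V0[of t] q0[OF t1(1)] True by auto
        have Vq: "V t \<le> q T" "V (t - 1) \<le> q T" using True qmono[OF t1] Vmono[of "t-1" t] by auto
        have "n t = E t - E (t - 1)" using ES[of "t-1"] t1 by simp
        then have "n t / E t \<le> ln (E t) - ln (E (t - 1))"
          using ln_diff_ge[of "E (t-1)" "E t"] E0 Emono[of "t-1" t] by simp
        also have "\<dots> = 1/p * (g t - g (t - 1))"
          unfolding g_def VE using Vq V0 by (simp add: min_def algebra_simps)
        finally have nE: "n t / E t \<le> 1/p * (g t - g (t - 1))" .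
        \<comment> \<open>All powers of \<open>A t\<close> cancel because
          \<open>p/3 * c = (1 - p)/3\<close>; what remains is \<open>Q powr c\<close> times a
          function of \<open>y = V t / q t\<close>.\<close>
        have Ec: "E t / b t * (q t / V t - 1) = Q powr c * (y powr (c - 1) * (1 - y))"
        proof -
          have 1: "q t / V t - 1 = (1 - y) / y" unfolding y_def using V0[of t] q0[OF t1(1)] by (simp add: field_simps)
          have Vy: "V t = y * q t" unfolding y_def using q0[OF t1(1)] by simp
          have "E t / b t = E t * (1 / b t)" by simp
          also have "\<dots> = V t powr (1/p) / V t * A t powr (-(1 - p)/3)"
            unfolding inv_b[OF t1(1)] by (subst VE) simp
          also have "V t powr (1/p) / V t = V t powr c" unfolding c_def using V0[of t] by (simp add: powr_diff)
          also have "V t powr c = y powr c * (Q powr c * A t powr (p/3 * c))"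
            unfolding Vy q_def by (simp add: powr_mult powr_powr)
          also have "p/3 * c = (1 - p)/3" using c by (simp add: mult.commute)
          also have "y powr c * (Q powr c * A t powr ((1 - p)/3)) * A t powr (-(1 - p)/3)
              = y powr c * Q powr c * (A t powr ((1 - p)/3) * A t powr (-(1 - p)/3))" by simp
          also have "A t powr ((1 - p)/3) * A t powr (-(1 - p)/3) = 1"
          proof -
            have "(1 - p)/3 + -(1 - p)/3 = 0" by (simp add: field_simps)
            then show ?thesis unfolding powr_add[symmetric] using A0[OF t1(1)] by simp
          qed
          finally have "E t / b t = y powr c * Q powr c" by simp
          then show ?thesis unfolding 1 using y by (simp add: powr_diff)
        qed
        have "n t / b t * (q t / V t - 1) = n t / E t * (E t / b t * (q t / V t - 1))"
          using E0[of t] by simp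
        also have "\<dots> = n t / E t * (Q powr c * (y powr (c - 1) * (1 - y)))" unfolding Ec ..
        also have "\<dots> \<le> 1/p * (g t - g (t - 1)) * (Q powr c * (1 / c))"
        proof (intro mult_mono nE mult_left_mono)
          show "y powr (c - 1) * (1 - y) \<le> 1 / c"
            using stepsize_integrand[OF y(1) c(1)] c by (simp add: le_divide_eq mult.commute)
        qed (use gm p y in auto)
        also have "\<dots> = K * (g t - g (t - 1))"
          unfolding K_def using c p by (simp add: field_simps)
        finally show ?thesis .
      qed
    qed
    have "\<alpha> * (E T powr (1 - p) - b0 powr c) \<le> (\<Sum>t=1..T. n t / b t)"
    proof -
      have one: "E (Suc t) powr (1 - p) - E t powr (1 - p) \<le> n (Suc t) / V (Suc t)" for t
      proof -
        have "E (Suc t) powr (1 - p) = E (Suc t) * E (Suc t) powr (- p)"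
          using powr_add[of "E (Suc t)" 1 "-p"] E0[of "Suc t"] by simp
        moreover have "E t * E (Suc t) powr (-p) \<le> E t * E t powr (-p)"
          using E0[of t] Emono[of t "Suc t"] p by (intro mult_left_mono powr_mono2') auto
        moreover have "E t powr (1 - p) = E t * E t powr (- p)"
          using powr_add[of "E t" 1 "-p"] E0[of t] by simp
        ultimately have "E (Suc t) powr (1 - p) - E t powr (1 - p) \<le> (E (Suc t) - E t) * E (Suc t) powr (-p)"
          by (simp add: algebra_simps)
        then show ?thesis unfolding V ES by (simp add: powr_minus_divide)
      qed
      have "\<alpha> * (E t powr (1 - p) - E 0 powr (1 - p)) \<le> (\<Sum>t=1..t. n t / b t)" if "t \<le> T" for t
        using that
      proof (induction t)
        case 0 then show ?case by simp
      next
        case (Suc t)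
        have "\<alpha> * (E (Suc t) powr (1 - p) - E t powr (1 - p)) \<le> \<alpha> * (n (Suc t) / V (Suc t))"
          using one al by (intro mult_left_mono) auto
        also have "\<dots> \<le> A (Suc t) powr (-(1 - p)/3) * (n (Suc t) / V (Suc t))"
          using al_le[of "Suc t"] Suc.prems n[of "Suc t"] V0[of "Suc t"] by (intro mult_right_mono) auto
        also have "\<dots> = n (Suc t) * (1 / b (Suc t))" unfolding inv_b[of "Suc t", simplified] by simp
        finally show ?case using Suc by (simp add: algebra_simps)
      qed
      from this[of T] show ?thesis unfolding E_def c_def using p b0
        by (simp add: S_def powr_powr diff_divide_distrib)
    qed
    moreover have "\<alpha> * S T powr (1 - p) \<le> \<alpha> * E T powr (1 - p)"
      using al S0[of T] p b0 unfolding E_def by (intro mult_left_mono powr_mono2) auto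
    moreover have "\<alpha> * b0 powr c \<le> 1 * b0 powr c" using al bc by (intro mult_right_mono) auto
    moreover have "(\<Sum>t=1..T. n t / b t) - K * (g T - g 0) \<le> (\<Sum>t=1..T. n t / b t * (2 - q t / V t))"
    proof -
      have "(\<Sum>t=1..T. n t / b t - K * (g t - g (t - 1))) \<le> (\<Sum>t=1..T. n t / b t * (2 - q t / V t))"
      proof (rule sum_mono)
        fix t assume "t \<in> {1..T}"
        moreover have "n t / b t * (2 - q t / V t) = n t / b t - n t / b t * (q t / V t - 1)"
          by (simp add: right_diff_distrib)
        ultimately show "n t / b t - K * (g t - g (t - 1)) \<le> n t / b t * (2 - q t / V t)"
          using up[of t] by linarith
      qed
      then show ?thesis unfolding sum_subtractf tele[unfolded sum_subtractf] sum_distrib_left[symmetric] .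
    qed
    moreover have "K * (g T - g 0) \<le> K * ln (q T / b0)" using gT K0 by (intro mult_left_mono) auto
    ultimately show ?thesis by (simp add: algebra_simps)
  next
    case False
    \<comment> \<open>Now \<open>V t > q t\<close> throughout, so every factor is at least
      \<open>2 - 1/w\<close>. Scaling by \<open>b0 powr (1/p)\<close> leaves the inequality
      \<open>large_initial_stepsize\<close> in \<open>x\<close>.\<close>
    define w where "w = b0 / q T"
    have w: "1 \<le> w" unfolding w_def using False q0[OF T] by simp
    define x where "x = S T / b0 powr (1/p)"
    have x: "0 \<le> x" "S T = x * b0 powr (1/p)" unfolding x_def using S0[of T] b0 by auto
    have VT: "V T = b0 * (1 + x) powr p"
    proof -
      have "E T = b0 powr (1/p) * (1 + x)" unfolding E_def x(2) by (simp add: algebra_simps)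
      then show ?thesis unfolding V using p b0 by (simp add: powr_mult powr_powr)
    qed
    have lb: "\<alpha> * (n t / V T * (2 - 1/w)) \<le> n t / b t * (2 - q t / V t)" if t: "t \<in> {1..T}" for t
    proof -
      have t1: "1 \<le> t" "t \<le> T" using t by auto
      have "q t / V t \<le> q T / b0"
        using qmono[OF t1] Vmono[of 0 t] b0 q0[OF T] V0[of t] by (intro frac_le) (auto simp: Vb)
      then have qV: "q t / V t \<le> 1/w" unfolding w_def by simp
      have "\<alpha> * (n t / V T) \<le> A t powr (-(1 - p)/3) * (n t / V t)"
        using al_le[OF t1] n[of t] V0[of t] V0[of T] Vmono[OF t1(2)] al
        by (intro mult_mono divide_left_mono) auto
      also have "\<dots> = n t * (1 / b t)" unfolding inv_b[OF t1(1)] by simp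
      also have "\<dots> = n t / b t" by simp
      finally have "\<alpha> * (n t / V T) * (2 - 1/w) \<le> n t / b t * (2 - q t / V t)"
        using qV w n[of t] V0[of T] al b[OF t1(1)] by (intro mult_mono) (auto simp: field_simps)
      then show ?thesis by (simp add: mult.assoc)
    qed
    have "\<alpha> * (S T / V T * (2 - 1/w)) = (\<Sum>t=1..T. \<alpha> * (n t / V T * (2 - 1/w)))"
      unfolding S_def by (simp add: sum_distrib_left sum_distrib_right sum_divide_distrib)
    also have "\<dots> \<le> (\<Sum>t=1..T. n t / b t * (2 - q t / V t))" by (intro sum_mono lb)
    finally have 1: "\<alpha> * (S T / V T * (2 - 1/w)) \<le> (\<Sum>t=1..T. n t / b t * (2 - q t / V t))" .
    have c1: "b0 powr (1/p) / b0 = b0 powr c" unfolding c_def using b0 by (simp add: powr_diff)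
    have 2: "S T / V T = b0 powr c * (x * (1 + x) powr (-p))"
      unfolding VT x(2) c1[symmetric] by (simp add: powr_minus_divide)
    have "S T powr (1 - p) = x powr (1 - p) * b0 powr (1/p * (1 - p))"
      unfolding x(2) by (simp add: powr_mult powr_powr)
    also have "1/p * (1 - p) = c" unfolding c_def using p by (simp add: field_simps)
    finally have 3: "S T powr (1 - p) = b0 powr c * x powr (1 - p)" by simp
    have "x powr (1 - p) \<le> (2 - 1/w) * (x * (1 + x) powr (-p)) + (1 - 2 * ln w / w)"
      by (rule large_initial_stepsize[OF p x(1) w])
    then have "\<alpha> * b0 powr c * x powr (1 - p) \<le> \<alpha> * b0 powr c * ((2 - 1/w) * (x * (1 + x) powr (-p)) + (1 - 2 * ln w / w))"
      using al bc by (intro mult_left_mono) auto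
    then have 4: "\<alpha> * S T powr (1 - p) \<le> \<alpha> * (S T / V T * (2 - 1/w)) + (\<alpha> * b0 powr c - \<alpha> * b0 powr c * (2 * ln w / w))"
      unfolding 2 3 by (simp add: algebra_simps)
    have 5: "\<alpha> * b0 powr c \<le> 1 * b0 powr c" using al bc by (intro mult_right_mono) auto
    \<comment> \<open>The logarithm equals \<open>- ln w\<close>, and \<open>K\<close> is at most
      \<open>2 * \<alpha> * b0 powr c / w\<close> because \<open>w powr c \<ge> w\<close> and
      \<open>1 - p \<ge> 1/2\<close>.\<close>
    have 6: "- (\<alpha> * b0 powr c * (2 * ln w / w)) \<le> K * ln (q T / b0)"
    proof -
      have "Q = b0 / w * A T powr (-p/3)"
        unfolding w_def q_def using b0 A0[OF T] by (simp add: powr_minus_divide[of _ "p/3"] flip: minus_divide_left)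
      then have "Q powr c = b0 powr c / w powr c * A T powr (-p/3 * c)"
        by (simp only: powr_mult powr_divide powr_powr)
      also have "-p/3 * c = -(1 - p)/3" unfolding c(2)[symmetric] by simp
      finally have Qc: "Q powr c = \<alpha> * b0 powr c / w powr c" unfolding \<alpha>_def by simp
      have "K \<le> (\<alpha> * b0 powr c / w) / (1/2)"
      proof -
        have "w powr 1 \<le> w powr c" using w c by (intro powr_mono) auto
        then have "\<alpha> * b0 powr c / w powr c \<le> \<alpha> * b0 powr c / w"
          using al bc w by (intro divide_left_mono mult_pos_pos) auto
        moreover have "K \<le> \<alpha> * b0 powr c / w powr c / (1/2)"
          unfolding K_def Qc using al bc p by (intro divide_left_mono) auto
        ultimately show ?thesis by (metis divide_right_mono order_trans zero_le_divide_1_iff zero_le_numeral)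
      qed
      then have "K * ln w \<le> (\<alpha> * b0 powr c / w) / (1/2) * ln w" using w by (intro mult_right_mono) auto
      moreover have "ln (q T / b0) = - ln w" unfolding w_def using b0 q0[OF T] by (simp add: ln_div)
      ultimately show ?thesis by simp
    qed
    show ?thesis using 1 4 5 6 by linarith
  qed
  have "K * ln (q T / b0) \<le> K * (ln (Q / b0) + 1/3 * ln (A T))"
    using lnq K0 by (intro mult_left_mono) auto
  moreover have "(\<Sum>t=1..T. 2 * n t / b t - Q * (n t * A t powr (1/3) / (b t)\<^sup>2)) = (\<Sum>t=1..T. n t / b t * (2 - q t / V t))"
    by (intro sum.cong refl summand) auto
  ultimately show ?thesis using fin unfolding K_def c_def \<alpha>_def S_def by linarith
qed

lemma (in prob_space) second_moment_decomposition:
  fixes X :: "'a \<Rightarrow> 'c::euclidean_space" and v :: 'c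
  assumes X: "integrable M X" "\<And>\<omega>. norm (X \<omega>) \<le> C"
  shows "(\<integral>\<omega>. (norm (v + (X \<omega> - (\<integral>\<omega>. X \<omega> \<partial>M))))\<^sup>2 \<partial>M) = (norm v)\<^sup>2 + (\<integral>\<omega>. (norm (X \<omega> - (\<integral>\<omega>. X \<omega> \<partial>M)))\<^sup>2 \<partial>M)"
proof -
  define m where "m = (\<integral>\<omega>. X \<omega> \<partial>M)"
  have [measurable]: "X \<in> borel_measurable M" using X by auto
  have i1: "integrable M (\<lambda>\<omega>. X \<omega> - m)" using X by auto
  have i2: "integrable M (\<lambda>\<omega>. (norm (X \<omega> - m))\<^sup>2)"
  proof (rule integrable_const_bound[where B = "(C + norm m)\<^sup>2"])
    have "norm (X \<omega> - m) \<le> C + norm m" for \<omega> using norm_triangle_ineq4[of "X \<omega>" m] X(2)[of \<omega>] by simp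
    then show "AE \<omega> in M. norm ((norm (X \<omega> - m))\<^sup>2) \<le> (C + norm m)\<^sup>2"
      by (auto intro!: power_mono)
  qed simp
  have i3: "integrable M (\<lambda>\<omega>. v \<bullet> (X \<omega> - m))" using i1 by auto
  have "(norm (v + (X \<omega> - m)))\<^sup>2 = (norm v)\<^sup>2 + (2 * (v \<bullet> (X \<omega> - m)) + (norm (X \<omega> - m))\<^sup>2)" for \<omega>
    unfolding power2_norm_eq_inner by (simp add: inner_add_left inner_add_right inner_commute)
  then have "(\<integral>\<omega>. (norm (v + (X \<omega> - m)))\<^sup>2 \<partial>M)
      = (\<integral>\<omega>. (norm v)\<^sup>2 + (2 * (v \<bullet> (X \<omega> - m)) + (norm (X \<omega> - m))\<^sup>2) \<partial>M)" by simp
  also have "\<dots> = (norm v)\<^sup>2 + (2 * (\<integral>\<omega>. v \<bullet> (X \<omega> - m) \<partial>M) + (\<integral>\<omega>. (norm (X \<omega> - m))\<^sup>2 \<partial>M))"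
    using i2 i3 by (simp add: prob_space)
  also have "(\<integral>\<omega>. v \<bullet> (X \<omega> - m) \<partial>M) = v \<bullet> (\<integral>\<omega>. X \<omega> - m \<partial>M)"
    using i1 by (rule integral_inner_right)
  also have "(\<integral>\<omega>. X \<omega> - m \<partial>M) = 0" using X(1) by (simp add: m_def prob_space)
  finally show ?thesis unfolding m_def by simp
qed

section \<open>Stochastic gradients\<close>

text \<open>\<open>G\<close> stands for a version of the stochastic gradient whose differences are
  bounded for all samples, not only on the support; \<open>expected_grad_norm_le\<close> produces it
  by a change on a null set. The quantities whose expectations are taken are then bounded functions
  of finitely many samples, which settles integrability once and for all.\<close>

locale storm_process = prob_space M for M :: "'w measure" +
  fixes D :: "'b measure" and \<xi> :: "nat \<Rightarrow> 'w \<Rightarrow> 'b"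
    and G :: "'a::euclidean_space \<Rightarrow> 'b \<Rightarrow> 'a" and gF :: "'a \<Rightarrow> 'a" and F :: "'a \<Rightarrow> real"
    and x1 :: 'a and \<sigma> sh \<beta> a0 b0 \<eta> p q Fstar :: real
  assumes D: "prob_space D"
    and indep: "indep_vars (\<lambda>_. D) \<xi> {1..}" and law: "\<And>t. 1 \<le> t \<Longrightarrow> distr M D (\<xi> t) = D"
    and G_meas: "(\<lambda>(x, y). G x y) \<in> borel_measurable (borel \<Otimes>\<^sub>M D)"
    and G_diff: "\<And>x y y'. norm (G x y - G x y') \<le> 2 * sh"
    and G_mean: "\<And>x. (\<integral>y. G x y \<partial>D) = gF x"
    and G_var: "\<And>x. (\<integral>y. (norm (G x y - gF x))\<^sup>2 \<partial>D) \<le> \<sigma>\<^sup>2"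
    and G_smooth: "\<And>x z. (\<integral>y. (norm (G x y - G z y))\<^sup>2 \<partial>D) \<le> \<beta>\<^sup>2 * (norm (x - z))\<^sup>2"
    and F_deriv: "\<And>x. GDERIV F x :> gF x" and F_lower: "\<And>x. Fstar \<le> F x"
    and a0: "0 < a0" and b0: "0 < b0" and \<eta>: "0 < \<eta>" and p: "0 < p" "p \<le> 1/2" and pq: "p + 2 * q = 1"
    and \<sigma>: "0 \<le> \<sigma>" and \<beta>: "0 \<le> \<beta>" and sh: "0 \<le> sh"
begin

sublocale D: prob_space D by (rule D)

lemma q_bounds: "1/4 \<le> q" "q \<le> 1/2" using p pq by auto

lemma G_measurable [measurable]:
  assumes [measurable]: "f \<in> borel_measurable N" "g \<in> measurable N D"
  shows "(\<lambda>\<omega>. G (f \<omega>) (g \<omega>)) \<in> borel_measurable N"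
  using measurable_compose[OF measurable_Pair[OF assms] G_meas] by simp

lemma G_D_measurable [measurable]: "G x \<in> borel_measurable D"
  using G_measurable[of "\<lambda>_. x" D "\<lambda>y. y"] by simp

lemma G_bounded: "norm (G x y) \<le> norm (G x undefined) + 2 * sh"
  using norm_triangle_sub[of "G x y" "G x undefined"] G_diff[of x y undefined] by simp

lemma G_integrable: "integrable D (G x)"
  by (rule D.integrable_const_bound[where B = "norm (G x undefined) + 2 * sh"]) (auto intro: G_bounded)

definition noise :: "'a \<Rightarrow> 'b \<Rightarrow> 'a" where
  "noise x y = G x y - gF x"

lemma noise_bound: "norm (noise x y) \<le> 2 * sh"
proof -
  have "noise x y = (\<integral>z. G x y - G x z \<partial>D)"
    unfolding noise_def G_mean[symmetric] using G_integrable[of x] by (simp add: D.prob_space)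
  also have "norm \<dots> \<le> (\<integral>z. norm (G x y - G x z) \<partial>D)" by (rule integral_norm_bound)
  also have "\<dots> \<le> (\<integral>z. 2 * sh \<partial>D)"
    using G_integrable[of x] by (intro integral_mono) (auto intro!: G_diff)
  finally show ?thesis by (simp add: D.prob_space)
qed

lemma noise_integrable: "integrable D (noise x)"
  unfolding noise_def using G_integrable by auto

lemma noise_mean: "(\<integral>y. noise x y \<partial>D) = 0"
  unfolding noise_def using G_integrable[of x] by (simp add: G_mean D.prob_space)

text \<open>The mean square of \<open>G x y - G z y\<close> splits into the square of its mean and
  its variance, so the two parts together stay within
  \<open>\<beta>\<^sup>2 * (norm (x - z))\<^sup>2\<close>.\<close>

lemma gF_lipschitz: "norm (gF x - gF z) \<le> \<beta> * norm (x - z)"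
  and noise_diff: "(\<integral>y. (norm (noise x y - noise z y))\<^sup>2 \<partial>D) \<le> \<beta>\<^sup>2 * (norm (x - z))\<^sup>2"
proof -
  define Y where "Y y = G x y - G z y" for y
  have Y: "integrable D Y" unfolding Y_def using G_integrable by auto
  have m: "(\<integral>y. Y y \<partial>D) = gF x - gF z" unfolding Y_def using G_integrable by (simp add: G_mean)
  have bd: "norm (Y y) \<le> (norm (G x undefined) + 2 * sh) + (norm (G z undefined) + 2 * sh)" for y
    unfolding Y_def using norm_triangle_ineq4[of "G x y" "G z y"] G_bounded[of x y] G_bounded[of z y] by simp
  have "(\<integral>y. (norm (Y y))\<^sup>2 \<partial>D) = (norm (gF x - gF z))\<^sup>2 + (\<integral>y. (norm (Y y - (gF x - gF z)))\<^sup>2 \<partial>D)"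
    using D.second_moment_decomposition[OF Y bd, of "gF x - gF z"] unfolding m by simp
  then have eq: "(\<integral>y. (norm (G x y - G z y))\<^sup>2 \<partial>D) = (norm (gF x - gF z))\<^sup>2 + (\<integral>y. (norm (noise x y - noise z y))\<^sup>2 \<partial>D)"
    unfolding Y_def noise_def by (simp add: algebra_simps)
  have "0 \<le> (\<integral>y. (norm (noise x y - noise z y))\<^sup>2 \<partial>D)" by simp
  then have "(norm (gF x - gF z))\<^sup>2 \<le> (\<beta> * norm (x - z))\<^sup>2"
    using eq G_smooth[of x z] unfolding power_mult_distrib by linarith
  then show "norm (gF x - gF z) \<le> \<beta> * norm (x - z)" using \<beta> by (simp add: power2_le_iff_abs_le)
  show "(\<integral>y. (norm (noise x y - noise z y))\<^sup>2 \<partial>D) \<le> \<beta>\<^sup>2 * (norm (x - z))\<^sup>2"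
    using eq G_smooth[of x z] zero_le_power2[of "norm (gF x - gF z)"] by linarith
qed

lemma gF_continuous: "continuous_on UNIV gF"
  unfolding continuous_on_iff
proof (intro ballI allI impI)
  fix x :: 'a and e :: real assume e: "0 < e"
  show "\<exists>d>0. \<forall>x'\<in>UNIV. dist x' x < d \<longrightarrow> dist (gF x') (gF x) < e"
  proof (intro exI[of _ "e / (\<beta> + 1)"] conjI ballI impI)
    fix x' assume "dist x' x < e / (\<beta> + 1)"
    then have "dist x' x * (\<beta> + 1) < e" using \<beta> by (simp add: pos_less_divide_eq)
    moreover have "dist (gF x') (gF x) \<le> dist x' x * (\<beta> + 1)"
      using gF_lipschitz[of x' x] norm_ge_zero[of "x' - x"] unfolding dist_norm
      by (simp only: distrib_left mult_1_right mult.commute[of \<beta>])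
    ultimately show "dist (gF x') (gF x) < e" by linarith
  qed (use e \<beta> in auto)
qed

lemma gF_measurable [measurable]: "gF \<in> borel_measurable borel"
  using gF_continuous by (rule borel_measurable_continuous_onI)

lemma noise_measurable [measurable]:
  assumes [measurable]: "f \<in> borel_measurable N" "g \<in> measurable N D"
  shows "(\<lambda>\<omega>. noise (f \<omega>) (g \<omega>)) \<in> borel_measurable N"
  unfolding noise_def by measurable

lemma descent: "F z \<le> F x + gF x \<bullet> (z - x) + \<beta> / 2 * (norm (z - x))\<^sup>2"
proof -
  define v where "v = z - x"
  define g where "g u = F (x + u *\<^sub>R v) - u * (gF x \<bullet> v) - \<beta> / 2 * u\<^sup>2 * (norm v)\<^sup>2" for u :: real
  have "g 1 \<le> g 0"
  proof (rule DERIV_nonpos_imp_nonincreasing[of 0 1 g])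
    fix u :: real assume u: "0 \<le> u" "u \<le> 1"
    have "(F has_derivative (\<lambda>h. h \<bullet> gF (x + u *\<^sub>R v))) (at (x + u *\<^sub>R v))"
      using F_deriv unfolding gderiv_def .
    moreover have "((\<lambda>u. x + u *\<^sub>R v) has_derivative (\<lambda>h. h *\<^sub>R v)) (at u)"
      by (auto intro!: derivative_eq_intros)
    ultimately have "((\<lambda>u. F (x + u *\<^sub>R v)) has_derivative (\<lambda>h. (h *\<^sub>R v) \<bullet> gF (x + u *\<^sub>R v))) (at u)"
      using has_derivative_compose by blast
    then have "((\<lambda>u. F (x + u *\<^sub>R v)) has_real_derivative (v \<bullet> gF (x + u *\<^sub>R v))) (at u)"
      by (simp add: has_field_derivative_def mult_commute_abs)
    then have "(g has_real_derivative (v \<bullet> gF (x + u *\<^sub>R v) - gF x \<bullet> v - \<beta> / 2 * (2 * u) * (norm v)\<^sup>2)) (at u)"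
      unfolding g_def by (auto intro!: derivative_eq_intros)
    moreover have "v \<bullet> gF (x + u *\<^sub>R v) - gF x \<bullet> v - \<beta> / 2 * (2 * u) * (norm v)\<^sup>2 \<le> 0"
    proof -
      have "v \<bullet> gF (x + u *\<^sub>R v) - gF x \<bullet> v = v \<bullet> (gF (x + u *\<^sub>R v) - gF x)"
        by (simp add: inner_diff_right inner_commute)
      also have "\<dots> \<le> norm v * norm (gF (x + u *\<^sub>R v) - gF x)" by (rule norm_cauchy_schwarz)
      also have "\<dots> \<le> norm v * (\<beta> * norm (u *\<^sub>R v))"
        using gF_lipschitz[of "x + u *\<^sub>R v" x] by (intro mult_left_mono) auto
      also have "\<dots> = \<beta> / 2 * (2 * u) * (norm v)\<^sup>2" using u by (simp add: power2_eq_square)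
      finally show ?thesis by simp
    qed
    ultimately show "\<exists>y. (g has_real_derivative y) (at u) \<and> y \<le> 0" by blast
  qed simp
  then show ?thesis unfolding g_def v_def by simp
qed

section \<open>Functionals of finitely many samples\<close>

text \<open>Encoded on sample sequences instead of on \<open>M\<close>, so that a single sample can
  be replaced, as in \<open>s(Suc t := y)\<close>. The product space contains only sequences that
  are \<open>undefined\<close> outside \<open>{1..t}\<close>; the first clause extends the
  information to all sequences. Boundedness makes every expectation finite.\<close>

definition adapted :: "nat \<Rightarrow> ((nat \<Rightarrow> 'b) \<Rightarrow> 'c::real_normed_vector) \<Rightarrow> bool" where
  "adapted t h \<longleftrightarrow> (\<forall>s s'. (\<forall>i\<in>{1..t}. s i = s' i) \<longrightarrow> h s = h s') \<and>
     h \<in> borel_measurable (PiM {1..t} (\<lambda>_. D)) \<and> bounded (range h)"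

definition Ex :: "((nat \<Rightarrow> 'b) \<Rightarrow> real) \<Rightarrow> real" where
  "Ex h = (\<integral>\<omega>. h (\<lambda>i. \<xi> i \<omega>) \<partial>M)"

lemma adapted_cong: "adapted t h \<Longrightarrow> (\<And>i. 1 \<le> i \<Longrightarrow> i \<le> t \<Longrightarrow> s i = s' i) \<Longrightarrow> h s = h s'"
  unfolding adapted_def by auto

lemma adapted_upd: "adapted t h \<Longrightarrow> h (s(Suc t := y)) = h s"
  by (rule adapted_cong[of t h]) auto

lemma adapted_bounded: "adapted t h \<Longrightarrow> \<exists>C. \<forall>s. norm (h s) \<le> C"
  unfolding adapted_def bounded_iff by auto

lemma adapted_borel: "adapted t h \<Longrightarrow> h \<in> borel_measurable (PiM {1..t} (\<lambda>_. D))"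
  unfolding adapted_def by simp

lemma adapted_mono:
  assumes h: "adapted t h" and t: "t \<le> t'"
  shows "adapted t' h"
proof -
  have "(\<lambda>s. h (restrict s {1..t})) = h"
    by (intro ext adapted_cong[OF h]) auto
  moreover have "(\<lambda>s. h (restrict s {1..t})) \<in> borel_measurable (PiM {1..t'} (\<lambda>_. D))"
    by (rule measurable_compose[OF measurable_restrict_subset adapted_borel[OF h]]) (use t in auto)
  ultimately have "h \<in> borel_measurable (PiM {1..t'} (\<lambda>_. D))" by simp
  moreover have "\<forall>s s'. (\<forall>i\<in>{1..t'}. s i = s' i) \<longrightarrow> h s = h s'"
    using t by (intro allI impI adapted_cong[OF h]) auto
  moreover have "bounded (range h)" using h unfolding adapted_def by simp
  ultimately show ?thesis unfolding adapted_def by (intro conjI)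
qed

lemma adaptedI:
  assumes "\<And>s s'. (\<And>i. 1 \<le> i \<Longrightarrow> i \<le> t \<Longrightarrow> s i = s' i) \<Longrightarrow> h s = h s'"
    and "h \<in> borel_measurable (PiM {1..t} (\<lambda>_. D))" and "\<And>s. norm (h s) \<le> C"
  shows "adapted t h"
  unfolding adapted_def bounded_iff
proof (intro conjI allI impI exI[of _ C] ballI)
  show "h s = h s'" if "\<forall>i\<in>{1..t}. s i = s' i" for s s' by (rule assms(1)) (use that in auto)
qed (use assms(2,3) in auto)

named_theorems adapted_intros

lemma adapted_const [adapted_intros]: "adapted t (\<lambda>_. c)"
  by (rule adaptedI[where C = "norm c"]) auto

lemma adapted_add [adapted_intros]:
  fixes f g :: "(nat \<Rightarrow> 'b) \<Rightarrow> 'c::euclidean_space"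
  assumes f: "adapted t f" and g: "adapted t g"
  shows "adapted t (\<lambda>s. f s + g s)"
proof -
  obtain C1 C2 where C: "\<And>s. norm (f s) \<le> C1" "\<And>s. norm (g s) \<le> C2"
    using adapted_bounded[OF f] adapted_bounded[OF g] by auto
  show ?thesis
  proof (rule adaptedI[where C = "C1 + C2"])
    show "norm (f s + g s) \<le> C1 + C2" for s using norm_triangle_mono[OF C] .
    show "f s + g s = f s' + g s'" if "\<And>i. 1 \<le> i \<Longrightarrow> i \<le> t \<Longrightarrow> s i = s' i" for s s'
      using adapted_cong[OF f that] adapted_cong[OF g that] by simp
    show "(\<lambda>s. f s + g s) \<in> borel_measurable (PiM {1..t} (\<lambda>_. D))"
      by (intro borel_measurable_add adapted_borel f g)
  qed
qed

lemma adapted_scaleR [adapted_intros]: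
  fixes g :: "(nat \<Rightarrow> 'b) \<Rightarrow> 'c::euclidean_space"
  assumes f: "adapted t f" and g: "adapted t g"
  shows "adapted t (\<lambda>s. f s *\<^sub>R g s)"
proof -
  obtain C1 C2 where C: "\<And>s. norm (f s) \<le> C1" "\<And>s. norm (g s) \<le> C2"
    using adapted_bounded[OF f] adapted_bounded[OF g] by auto
  show ?thesis
  proof (rule adaptedI[where C = "C1 * C2"])
    show "norm (f s *\<^sub>R g s) \<le> C1 * C2" for s
      using C(1)[of s] C(2)[of s] order_trans[OF norm_ge_zero C(1)] by (simp add: mult_mono)
    show "f s *\<^sub>R g s = f s' *\<^sub>R g s'" if "\<And>i. 1 \<le> i \<Longrightarrow> i \<le> t \<Longrightarrow> s i = s' i" for s s'
      using adapted_cong[OF f that] adapted_cong[OF g that] by simp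
    show "(\<lambda>s. f s *\<^sub>R g s) \<in> borel_measurable (PiM {1..t} (\<lambda>_. D))"
      by (intro borel_measurable_scaleR adapted_borel f g)
  qed
qed

lemma adapted_mult [adapted_intros]:
  "adapted t f \<Longrightarrow> adapted t g \<Longrightarrow> adapted t (\<lambda>s. f s * g s)" for f g :: "(nat \<Rightarrow> 'b) \<Rightarrow> real"
  using adapted_scaleR[of t f g] by simp

lemma adapted_divide [adapted_intros]:
  "adapted t f \<Longrightarrow> adapted t (\<lambda>s. f s / c)" for f :: "(nat \<Rightarrow> 'b) \<Rightarrow> real"
  using adapted_mult[OF _ adapted_const, of t f "1 / c"] by simp

lemma adapted_diff [adapted_intros]:
  fixes f g :: "(nat \<Rightarrow> 'b) \<Rightarrow> 'c::euclidean_space"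
  assumes f: "adapted t f" and g: "adapted t g"
  shows "adapted t (\<lambda>s. f s - g s)"
  using adapted_add[OF f adapted_scaleR[OF adapted_const[of t "-1"] g]] by simp

lemma adapted_sum [adapted_intros]:
  fixes f :: "'i \<Rightarrow> (nat \<Rightarrow> 'b) \<Rightarrow> 'c::euclidean_space"
  assumes "\<And>i. i \<in> I \<Longrightarrow> adapted t (f i)"
  shows "adapted t (\<lambda>s. \<Sum>i\<in>I. f i s)"
  using assms
proof (induction I rule: infinite_finite_induct)
  case (insert i I)
  then show ?case using adapted_add[of t "f i" "\<lambda>s. \<Sum>i\<in>I. f i s"] by simp
qed (simp_all add: adapted_const)

lemma adapted_continuous:
  fixes f :: "(nat \<Rightarrow> 'b) \<Rightarrow> 'c::euclidean_space" and g :: "'c \<Rightarrow> 'd::euclidean_space"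
  assumes f: "adapted t f" and g: "continuous_on UNIV g"
  shows "adapted t (\<lambda>s. g (f s))"
proof -
  obtain C where C: "\<And>s. norm (f s) \<le> C" using adapted_bounded[OF f] by auto
  have "compact (g ` cball 0 C)"
    by (rule compact_continuous_image[OF continuous_on_subset[OF g]]) auto
  then have "bounded (g ` cball 0 C)" by (rule compact_imp_bounded)
  then obtain B where B: "\<forall>x\<in>g ` cball 0 C. norm x \<le> B"
    unfolding bounded_iff by (elim exE)
  show ?thesis
  proof (rule adaptedI[where C = B])
    show "norm (g (f s)) \<le> B" for s by (rule B[rule_format]) (use C in simp)
    show "g (f s) = g (f s')" if "\<And>i. 1 \<le> i \<Longrightarrow> i \<le> t \<Longrightarrow> s i = s' i" for s s'
      using adapted_cong[OF f that] by simp
    show "(\<lambda>s. g (f s)) \<in> borel_measurable (PiM {1..t} (\<lambda>_. D))"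
      by (rule measurable_compose[OF adapted_borel[OF f] borel_measurable_continuous_onI[OF g]])
  qed
qed

lemma adapted_norm_power [adapted_intros]:
  fixes f :: "(nat \<Rightarrow> 'b) \<Rightarrow> 'c::euclidean_space"
  shows "adapted t f \<Longrightarrow> adapted t (\<lambda>s. (norm (f s))\<^sup>2)"
  by (rule adapted_continuous[of t f "\<lambda>x. (norm x)\<^sup>2"]) (auto intro!: continuous_intros)

lemma adapted_inner [adapted_intros]:
  fixes f g :: "(nat \<Rightarrow> 'b) \<Rightarrow> 'c::euclidean_space"
  assumes f: "adapted t f" and g: "adapted t g"
  shows "adapted t (\<lambda>s. f s \<bullet> g s)"
proof -
  have "f s \<bullet> g s = 1/4 * (norm (f s + g s))\<^sup>2 - 1/4 * (norm (f s - g s))\<^sup>2" for s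
    unfolding power2_norm_eq_inner
    by (simp add: inner_add_left inner_add_right inner_diff_left inner_diff_right inner_commute field_simps)
  then have "(\<lambda>s. f s \<bullet> g s) = (\<lambda>s. 1/4 * (norm (f s + g s))\<^sup>2 - 1/4 * (norm (f s - g s))\<^sup>2)"
    by (rule ext)
  then show ?thesis by (simp only:) (intro adapted_intros f g)
qed

lemma adapted_real_measurable:
  fixes f :: "(nat \<Rightarrow> 'b) \<Rightarrow> real" and g :: "real \<Rightarrow> real"
  assumes f: "adapted t f" and g: "g \<in> borel_measurable borel" and bd: "\<And>s. \<bar>g (f s)\<bar> \<le> B"
  shows "adapted t (\<lambda>s. g (f s))"
proof (rule adaptedI[where C = B])
  show "g (f s) = g (f s')" if "\<And>i. 1 \<le> i \<Longrightarrow> i \<le> t \<Longrightarrow> s i = s' i" for s s'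
    using adapted_cong[OF f that] by simp
  show "(\<lambda>s. g (f s)) \<in> borel_measurable (PiM {1..t} (\<lambda>_. D))"
    by (rule measurable_compose[OF adapted_borel[OF f] g])
qed (use bd in auto)

lemma adapted_powr_pos:
  fixes f :: "(nat \<Rightarrow> 'b) \<Rightarrow> real"
  assumes f: "adapted t f" and c: "0 < c" "\<And>s. c \<le> f s"
  shows "adapted t (\<lambda>s. f s powr \<theta>)"
proof -
  obtain C where C: "\<And>s. norm (f s) \<le> C" using adapted_bounded[OF f] by auto
  show ?thesis
  proof (rule adapted_real_measurable[OF f, where B = "c powr \<theta> + C powr \<theta>"])
    fix s
    have s: "c \<le> f s" "f s \<le> C" using c(2)[of s] C[of s] by auto
    have "f s powr \<theta> \<le> C powr \<theta> \<or> f s powr \<theta> \<le> c powr \<theta>"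
      using s c(1) powr_mono2[of \<theta> "f s" C] powr_mono2'[of \<theta> c "f s"] by (cases "0 \<le> \<theta>") auto
    moreover have "0 \<le> f s powr \<theta>" "0 \<le> c powr \<theta>" "0 \<le> C powr \<theta>" by auto
    ultimately show "\<bar>f s powr \<theta>\<bar> \<le> c powr \<theta> + C powr \<theta>" by linarith
  qed simp
qed

lemma adapted_powr_nonneg:
  fixes f :: "(nat \<Rightarrow> 'b) \<Rightarrow> real"
  assumes f: "adapted t f" and c: "0 \<le> \<theta>" "\<And>s. 0 \<le> f s"
  shows "adapted t (\<lambda>s. f s powr \<theta>)"
proof -
  obtain C where C: "\<And>s. norm (f s) \<le> C" using adapted_bounded[OF f] by auto
  show ?thesis
  proof (rule adapted_real_measurable[OF f, where B = "C powr \<theta>"])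
    show "\<bar>f s powr \<theta>\<bar> \<le> C powr \<theta>" for s
      using c(2)[of s] C[of s] c(1) by (simp add: powr_mono2)
  qed simp
qed

lemma adapted_ln:
  fixes f :: "(nat \<Rightarrow> 'b) \<Rightarrow> real"
  assumes f: "adapted t f" and c: "\<And>s. 1 \<le> f s"
  shows "adapted t (\<lambda>s. ln (f s))"
proof -
  obtain C where C: "\<And>s. norm (f s) \<le> C" using adapted_bounded[OF f] by auto
  show ?thesis
  proof (rule adapted_real_measurable[OF f, where B = C])
    show "\<bar>ln (f s)\<bar> \<le> C" for s
      using c[of s] C[of s] ln_le_minus_one[of "f s"] ln_ge_zero[of "f s"] by simp
  qed simp
qed

lemma adapted_max [adapted_intros]:
  fixes f :: "(nat \<Rightarrow> 'b) \<Rightarrow> real"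
  shows "adapted t f \<Longrightarrow> adapted t (\<lambda>s. max (f s) m)"
  by (rule adapted_continuous[of t f "\<lambda>x. max x m"]) (auto intro!: continuous_intros)

lemma adapted_if:
  fixes f g h :: "(nat \<Rightarrow> 'b) \<Rightarrow> real"
  assumes f: "adapted t f" and g: "adapted t g" and h: "adapted t h"
  shows "adapted t (\<lambda>s. if m \<le> f s then g s else h s)"
proof -
  have i: "adapted t (\<lambda>s. indicator {m..} (f s) :: real)"
    by (rule adapted_real_measurable[OF f, where B = 1]) (auto simp: indicator_def)
  have "(\<lambda>s. if m \<le> f s then g s else h s) = (\<lambda>s. indicator {m..} (f s) * g s + (1 - indicator {m..} (f s)) * h s)"
    by (auto simp: indicator_def)
  then show ?thesis by (simp only:) (intro adapted_intros i g h)
qed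

lemma adapted_noise [adapted_intros]:
  assumes x: "adapted t x" and i: "1 \<le> i" "i \<le> t"
  shows "adapted t (\<lambda>s. noise (x s) (s i))"
proof (rule adaptedI[where C = "2 * sh"])
  have [measurable]: "x \<in> borel_measurable (PiM {1..t} (\<lambda>_. D))" by (rule adapted_borel[OF x])
  have [measurable]: "(\<lambda>s. s i) \<in> measurable (PiM {1..t} (\<lambda>_. D)) D" using i by (intro measurable_component_singleton) auto
  show "(\<lambda>s. noise (x s) (s i)) \<in> borel_measurable (PiM {1..t} (\<lambda>_. D))" by measurable
  show "noise (x s) (s i) = noise (x s') (s' i)" if "\<And>i. 1 \<le> i \<Longrightarrow> i \<le> t \<Longrightarrow> s i = s' i" for s s'
    using adapted_cong[OF x that] that[OF i] by simp
qed (rule noise_bound)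

section \<open>Conditioning on the past\<close>

lemma \<xi>_rv: "1 \<le> i \<Longrightarrow> \<xi> i \<in> measurable M D"
  using indep unfolding indep_vars_def by auto

lemma past_rv: "(\<lambda>\<omega>. restrict (\<lambda>i. \<xi> i \<omega>) {1..t}) \<in> measurable M (PiM {1..t} (\<lambda>_. D))"
  by (intro measurable_restrict \<xi>_rv) auto

lemma adapted_past: "adapted t h \<Longrightarrow> h (\<lambda>i. \<xi> i \<omega>) = h (restrict (\<lambda>i. \<xi> i \<omega>) {1..t})"
  by (rule adapted_cong[of t h]) auto

lemma adapted_measurable:
  assumes h: "adapted t h"
  shows "(\<lambda>\<omega>. h (\<lambda>i. \<xi> i \<omega>)) \<in> borel_measurable M"
  unfolding adapted_past[OF h] by (rule measurable_compose[OF past_rv adapted_borel[OF h]])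

lemma adapted_integrable:
  fixes h :: "(nat \<Rightarrow> 'b) \<Rightarrow> real"
  assumes h: "adapted t h"
  shows "integrable M (\<lambda>\<omega>. h (\<lambda>i. \<xi> i \<omega>))"
proof -
  obtain C where C: "\<And>s. norm (h s) \<le> C" using adapted_bounded[OF h] by auto
  show ?thesis
    by (rule integrable_const_bound[where B = C]) (use C adapted_measurable[OF h] in auto)
qed

lemma Ex_add: "adapted t f \<Longrightarrow> adapted t g \<Longrightarrow> Ex (\<lambda>s. f s + g s) = Ex f + Ex g"
  unfolding Ex_def by (simp add: adapted_integrable)

lemma Ex_cmult: "Ex (\<lambda>s. c * f s) = c * Ex f"
  unfolding Ex_def by simp

lemma Ex_const: "Ex (\<lambda>s. c) = c"
  unfolding Ex_def by (simp add: prob_space)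

lemma Ex_sum: "(\<And>i. i \<in> I \<Longrightarrow> adapted t (f i)) \<Longrightarrow> Ex (\<lambda>s. \<Sum>i\<in>I. f i s) = (\<Sum>i\<in>I. Ex (f i))"
  unfolding Ex_def by (intro Bochner_Integration.integral_sum adapted_integrable)

lemma Ex_mono: "adapted t f \<Longrightarrow> adapted t g \<Longrightarrow> (\<And>s. f s \<le> g s) \<Longrightarrow> Ex f \<le> Ex g"
  unfolding Ex_def by (intro integral_mono adapted_integrable) auto

lemma Ex_nonneg: "(\<And>s. 0 \<le> f s) \<Longrightarrow> 0 \<le> Ex f"
  unfolding Ex_def by simp

text \<open>The joint law of the first \<open>t\<close> samples and the next one is the product of
  \<open>P\<close> and \<open>D\<close>, so Fubini allows the next sample to be integrated out
  first. This plays the role of conditional expectation given the past.\<close>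

lemma next_sample:
  fixes H :: "(nat \<Rightarrow> 'b) \<Rightarrow> real"
  assumes H: "adapted (Suc t) H"
  defines "P \<equiv> distr M (PiM {1..t} (\<lambda>_. D)) (\<lambda>\<omega>. restrict (\<lambda>i. \<xi> i \<omega>) {1..t})"
  shows "Ex H = (\<integral>s. (\<integral>y. H (s(Suc t := y)) \<partial>D) \<partial>P)"
    and "integrable P (\<lambda>s. \<integral>y. H (s(Suc t := y)) \<partial>D)"
proof -
  let ?R = "\<lambda>\<omega>. restrict (\<lambda>i. \<xi> i \<omega>) {1..t}" and ?Y = "\<lambda>\<omega>. restrict (\<lambda>i. \<xi> i \<omega>) {Suc t}"
  let ?A = "PiM {1..t} (\<lambda>_. D)" and ?B = "PiM {Suc t} (\<lambda>_. D)"
  interpret P: prob_space P unfolding P_def by (rule prob_space_distr[OF past_rv])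
  interpret PD: pair_prob_space P D ..
  have "indep_var ?A ?R ?B ?Y" by (rule indep_var_restrict[OF indep]) auto
  then have rv [measurable]: "?R \<in> measurable M ?A" "?Y \<in> measurable M ?B"
    and split: "P \<Otimes>\<^sub>M distr M ?B ?Y = distr M (?A \<Otimes>\<^sub>M ?B) (\<lambda>\<omega>. (?R \<omega>, ?Y \<omega>))"
    unfolding indep_var_distribution_eq P_def by auto
  have comp [measurable]: "(\<lambda>z. z (Suc t)) \<in> measurable ?B D" by (rule measurable_component_singleton) simp
  have \<xi>t [measurable]: "\<xi> (Suc t) \<in> measurable M D" by (rule \<xi>_rv) simp
  have [measurable_cong]: "sets P = sets ?A" unfolding P_def by simp
  have last: "distr (distr M ?B ?Y) D (\<lambda>z. z (Suc t)) = D"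
    using law[of "Suc t"] by (subst distr_distr) (simp_all add: o_def)
  \<comment> \<open>Independence is available for the restrictions to \<open>{1..t}\<close> and to
    the singleton \<open>{Suc t}\<close>; evaluating the latter at its only index turns its law into
    \<open>D\<close>.\<close>
  have joint: "P \<Otimes>\<^sub>M D = distr M (?A \<Otimes>\<^sub>M D) (\<lambda>\<omega>. (?R \<omega>, \<xi> (Suc t) \<omega>))"
  proof -
    have "P \<Otimes>\<^sub>M D = distr P ?A (\<lambda>s. s) \<Otimes>\<^sub>M distr (distr M ?B ?Y) D (\<lambda>z. z (Suc t))"
      unfolding last using distr_id2[of ?A P] by (simp add: P_def)
    also have "\<dots> = distr (P \<Otimes>\<^sub>M distr M ?B ?Y) (?A \<Otimes>\<^sub>M D) (\<lambda>(s, z). (s, z (Suc t)))"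
      by (rule pair_measure_distr) (simp_all add: last D.sigma_finite_measure_axioms measurable_ident_sets P_def)
    also have "\<dots> = distr M (?A \<Otimes>\<^sub>M D) (\<lambda>\<omega>. (?R \<omega>, \<xi> (Suc t) \<omega>))"
      unfolding split by (subst distr_distr[OF _ measurable_Pair[OF rv]]) (simp_all add: o_def)
    finally show ?thesis .
  qed
  have ins: "insert (Suc t) {1..t} = {1..Suc t}" by auto
  have upd: "(\<lambda>(s, y). s(Suc t := y)) \<in> measurable (?A \<Otimes>\<^sub>M D) (PiM {1..Suc t} (\<lambda>_. D))"
    using measurable_add_dim[of "Suc t" "{1..t}" "\<lambda>_. D"] unfolding ins .
  have Hm: "(\<lambda>(s, y). H (s(Suc t := y))) \<in> borel_measurable (?A \<Otimes>\<^sub>M D)"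
    using measurable_compose[OF upd adapted_borel[OF H]] by (simp add: case_prod_beta')
  have setsP: "sets (P \<Otimes>\<^sub>M D) = sets (?A \<Otimes>\<^sub>M D)" unfolding P_def by (intro sets_pair_measure_cong) auto
  obtain C where C: "\<And>s. norm (H s) \<le> C" using adapted_bounded[OF H] by auto
  have int: "integrable (P \<Otimes>\<^sub>M D) (\<lambda>z. H ((fst z)(Suc t := snd z)))"
    by (rule PD.integrable_const_bound[where B = C])
      (use C Hm in \<open>auto simp: measurable_cong_sets[OF setsP] case_prod_beta'\<close>)
  have "Ex H = (\<integral>\<omega>. H ((?R \<omega>)(Suc t := \<xi> (Suc t) \<omega>)) \<partial>M)"
    unfolding Ex_def by (intro Bochner_Integration.integral_cong refl adapted_cong[OF H]) auto
  also have "\<dots> = (\<integral>z. H ((fst z)(Suc t := snd z)) \<partial>(P \<Otimes>\<^sub>M D))"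
    unfolding joint
    by (subst integral_distr[OF measurable_Pair[OF rv(1) \<xi>t]]) (use Hm in \<open>auto simp: case_prod_beta'\<close>)
  also have "\<dots> = (\<integral>s. (\<integral>y. H (s(Suc t := y)) \<partial>D) \<partial>P)"
    using PD.integral_fst'[OF int] by simp
  finally show "Ex H = (\<integral>s. (\<integral>y. H (s(Suc t := y)) \<partial>D) \<partial>P)" .
  show "integrable P (\<lambda>s. \<integral>y. H (s(Suc t := y)) \<partial>D)"
    using PD.integrable_fst'[OF int] by simp
qed

text \<open>It suffices to compare the averages over the next sample; the noise estimates below hold
  only in this averaged sense.\<close>

lemma Ex_mono_next:
  assumes H: "adapted (Suc t) H" "adapted (Suc t) H'"
    and le: "\<And>s. (\<integral>y. H (s(Suc t := y)) \<partial>D) \<le> (\<integral>y. H' (s(Suc t := y)) \<partial>D)"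
  shows "Ex H \<le> Ex H'"
  unfolding next_sample(1)[OF H(1)] next_sample(1)[OF H(2)]
  by (intro integral_mono next_sample H le)


section \<open>The iterates as functionals of the sample sequence\<close>

abbreviation "X s t \<equiv> storm_x G x1 a0 b0 \<eta> p q s t"
abbreviation "d s t \<equiv> storm_d G x1 a0 b0 \<eta> p q s t"

text \<open>The gradient difference of the algorithm, in which \<open>gF\<close> cancels; the form
  with \<open>noise\<close> is the one used for conditional means.\<close>

definition \<Delta> :: "(nat \<Rightarrow> 'b) \<Rightarrow> nat \<Rightarrow> 'a" where
  "\<Delta> s t = noise (X s t) (s t) - noise (X s t) (s (Suc t))"

text \<open>This is \<open>a s t powr (-3/2)\<close>. Its last summand involves the sample
  \<open>s t\<close>, so it is known at time \<open>t\<close> but not before.\<close>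

definition A :: "(nat \<Rightarrow> 'b) \<Rightarrow> nat \<Rightarrow> real" where
  "A s t = 1 + (\<Sum>i=1..<t. (norm (\<Delta> s i))\<^sup>2 / a0\<^sup>2)"

definition a :: "(nat \<Rightarrow> 'b) \<Rightarrow> nat \<Rightarrow> real" where
  "a s t = A s t powr (-2/3)"

definition dsum :: "(nat \<Rightarrow> 'b) \<Rightarrow> nat \<Rightarrow> real" where
  "dsum s t = (\<Sum>i=1..t. (norm (d s i))\<^sup>2)"

text \<open>Dividing by \<open>a s t powr q\<close> is the same as multiplying by this power of
  \<open>A\<close>, since \<open>2*q/3 = (1 - p)/3\<close>.\<close>

definition b :: "(nat \<Rightarrow> 'b) \<Rightarrow> nat \<Rightarrow> real" where
  "b s t = (b0 powr (1/p) + dsum s t) powr p * A s t powr ((1 - p)/3)"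

definition err :: "(nat \<Rightarrow> 'b) \<Rightarrow> nat \<Rightarrow> 'a" where
  "err s t = d s t - gF (X s t)"

definition u :: real where "u = sh\<^sup>2 / a0\<^sup>2"

lemma u_nonneg: "0 \<le> u" unfolding u_def by simp

lemma A_0 [simp]: "A s 0 = 1" and A_1 [simp]: "A s (Suc 0) = 1"
  unfolding A_def by auto

lemma A_Suc: "1 \<le> t \<Longrightarrow> A s (Suc t) = A s t + (norm (\<Delta> s t))\<^sup>2 / a0\<^sup>2"
  unfolding A_def by (simp add: atLeastLessThanSuc)

lemma \<Delta>_bound: "(norm (\<Delta> s t))\<^sup>2 \<le> 4 * sh\<^sup>2"
proof -
  have "norm (\<Delta> s t) \<le> 2 * sh"
    unfolding \<Delta>_def noise_def using G_diff[of "X s t" "s t" "s (Suc t)"] by simp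
  then have "(norm (\<Delta> s t))\<^sup>2 \<le> (2 * sh)\<^sup>2" by (intro power_mono) auto
  then show ?thesis by simp
qed

lemma A_ge_1: "1 \<le> A s t"
  unfolding A_def by (simp add: sum_nonneg)

lemma A_mono: "A s t \<le> A s (Suc t)"
  by (cases "1 \<le> t") (auto simp: A_Suc not_less_eq_eq)

lemma A_increment: "A s (Suc t) \<le> A s t + 4 * u"
proof (cases "1 \<le> t")
  case True
  then show ?thesis using \<Delta>_bound[of s t] a0 unfolding A_Suc[OF True] u_def by (simp add: divide_right_mono)
qed (use u_nonneg in \<open>auto simp: not_less_eq_eq\<close>)

lemma a_bounds: "0 < a s t" "a s t \<le> 1"
  unfolding a_def using A_ge_1[of s t] powr_mono2'[of "-2/3" 1 "A s t"] by auto

lemma dsum_Suc: "dsum s (Suc t) = dsum s t + (norm (d s (Suc t)))\<^sup>2"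
  unfolding dsum_def by simp

lemma dsum_nonneg: "0 \<le> dsum s t" unfolding dsum_def by (intro sum_nonneg) auto

lemma storm_a_eq: "storm_a G x1 a0 b0 \<eta> p q s t = a s t"
proof (cases t)
  case (Suc t')
  then show ?thesis
    by (cases t') (simp_all add: a_def A_def \<Delta>_def noise_def atLeastLessThanSuc_atLeastAtMost)
qed (simp add: a_def)

lemma storm_b_eq: "storm_b G x1 a0 b0 \<eta> p q s t = b s t"
proof -
  have "(A s t powr (-2/3)) powr q = A s t powr (-((1 - p)/3))"
    using pq unfolding powr_powr by (intro arg_cong2[where f = "(powr)"]) auto
  then show ?thesis
    unfolding storm_b.simps storm_a_eq b_def dsum_def a_def by (simp only: powr_minus_divide) simp
qed

lemma b_pos: "b0 \<le> b s t" "0 < b s t"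
proof -
  have "b0 = (b0 powr (1/p)) powr p" using b0 p by (simp add: powr_powr)
  also have "\<dots> \<le> (b0 powr (1/p) + dsum s t) powr p"
    using dsum_nonneg p by (intro powr_mono2) auto
  also have "\<dots> = (b0 powr (1/p) + dsum s t) powr p * 1" by simp
  also have "\<dots> \<le> b s t"
    unfolding b_def using A_ge_1 p by (intro mult_left_mono ge_one_powr_ge_zero) auto
  finally show "b0 \<le> b s t" .
  then show "0 < b s t" using b0 by simp
qed

lemma X_Suc: "1 \<le> t \<Longrightarrow> X s (Suc t) = X s t - (\<eta> / b s t) *\<^sub>R d s t"
  by (cases t) (simp_all add: storm_b_eq del: storm_b.simps)

lemma d_1: "d s (Suc 0) = noise x1 (s (Suc 0)) + gF x1"
  by (simp add: noise_def)

lemma err_1: "err s (Suc 0) = noise (X s (Suc 0)) (s (Suc 0))"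
  by (simp add: err_def noise_def)

lemma d_Suc:
  assumes "1 \<le> t"
  shows "d s (Suc t) = noise (X s (Suc t)) (s (Suc t)) + gF (X s (Suc t))
    + (1 - a s (Suc t)) *\<^sub>R (d s t - (noise (X s t) (s (Suc t)) + gF (X s t)))"
  using assms by (cases t) (simp_all add: noise_def storm_a_eq del: storm_a.simps storm_x.simps)

text \<open>The noise of the new sample at the old point; \<open>Z\<close> below is its change in
  passing to the new point. Given the samples up to \<open>t\<close>, both have mean zero.\<close>

definition N :: "(nat \<Rightarrow> 'b) \<Rightarrow> nat \<Rightarrow> 'a" where
  "N s t = noise (X s t) (s (Suc t))"

definition Z :: "(nat \<Rightarrow> 'b) \<Rightarrow> nat \<Rightarrow> 'a" where
  "Z s t = noise (X s (Suc t)) (s (Suc t)) - noise (X s t) (s (Suc t))"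

lemma err_Suc:
  assumes "1 \<le> t"
  shows "err s (Suc t) = (1 - a s (Suc t)) *\<^sub>R err s t + Z s t + a s (Suc t) *\<^sub>R N s t"
  unfolding err_def d_Suc[OF assms] Z_def N_def by (simp add: algebra_simps)

lemma adapted_A_powr_aux:
  assumes "adapted t (\<lambda>s. A s i)"
  shows "adapted t (\<lambda>s. A s i powr \<theta>)"
  by (rule adapted_powr_pos[OF assms, of 1]) (auto intro: A_ge_1)

text \<open>The iterate runs one step ahead: \<open>X s (Suc t)\<close> is determined by the samples
  up to \<open>t\<close>. As the recursions refer to each other, all quantities go through one
  induction.\<close>

lemma adapted_state:
  "adapted t (\<lambda>s. X s t) \<and> adapted t (\<lambda>s. X s (Suc t)) \<and> adapted t (\<lambda>s. d s t) \<and>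
   adapted t (\<lambda>s. A s t) \<and> adapted t (\<lambda>s. dsum s t)"
proof (induction t)
  case 0
  then show ?case by (simp add: adapted_const dsum_def)
next
  case (Suc t)
  have past: "adapted (Suc t) (\<lambda>s. X s t)" "adapted (Suc t) (\<lambda>s. X s (Suc t))" "adapted (Suc t) (\<lambda>s. d s t)"
    "adapted (Suc t) (\<lambda>s. A s t)" "adapted (Suc t) (\<lambda>s. dsum s t)"
    using Suc.IH by (auto intro: adapted_mono)
  have gX: "adapted (Suc t) (\<lambda>s. gF (X s t))" "adapted (Suc t) (\<lambda>s. gF (X s (Suc t)))"
    by (rule adapted_continuous[OF past(1) gF_continuous] adapted_continuous[OF past(2) gF_continuous])+
  have A': "adapted (Suc t) (\<lambda>s. A s (Suc t))"
  proof (cases "1 \<le> t")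
    case True
    have "adapted (Suc t) (\<lambda>s. A s t + (1 / a0\<^sup>2) * (norm (\<Delta> s t))\<^sup>2)"
      unfolding \<Delta>_def using True by (intro adapted_intros past) auto
    then show ?thesis unfolding A_Suc[OF True] by simp
  qed (simp add: not_less_eq_eq adapted_const)
  have a': "adapted (Suc t) (\<lambda>s. a s (Suc t))" unfolding a_def by (rule adapted_A_powr_aux[OF A'])
  have d': "adapted (Suc t) (\<lambda>s. d s (Suc t))"
  proof (cases "1 \<le> t")
    case True
    show ?thesis unfolding d_Suc[OF True] by (intro adapted_intros past gX a') auto
  next
    case False
    then have t: "t = 0" by simp
    show ?thesis unfolding t d_1 by (intro adapted_intros) auto
  qed
  have D': "adapted (Suc t) (\<lambda>s. dsum s (Suc t))" unfolding dsum_Suc by (intro adapted_intros past d')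
  have "adapted (Suc t) (\<lambda>s. (b0 powr (1/p) + dsum s (Suc t)) powr (-p))"
    by (rule adapted_powr_pos[of _ _ "b0 powr (1/p)"]) (use b0 dsum_nonneg in \<open>auto intro!: adapted_intros D'\<close>)
  then have "adapted (Suc t) (\<lambda>s. X s (Suc t) - (\<eta> * ((b0 powr (1/p) + dsum s (Suc t)) powr (-p) *
      A s (Suc t) powr (-((1 - p)/3)))) *\<^sub>R d s (Suc t))"
    by (intro adapted_intros past d' adapted_A_powr_aux[OF A'])
  moreover have "\<eta> / b s (Suc t) = \<eta> * ((b0 powr (1/p) + dsum s (Suc t)) powr (-p) * A s (Suc t) powr (-((1 - p)/3)))" for s
    unfolding b_def powr_minus_divide by simp
  ultimately have "adapted (Suc t) (\<lambda>s. X s (Suc (Suc t)))" by (subst X_Suc) simp_all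
  then show ?case using past(2) A' d' D' by blast
qed

lemma adapted_X [adapted_intros]: "i \<le> Suc t \<Longrightarrow> adapted t (\<lambda>s. X s i)"
  using adapted_state[of t] adapted_state[of i] adapted_mono[of i "\<lambda>s. X s i" t]
  by (cases "i = Suc t") auto

lemma adapted_d [adapted_intros]: "i \<le> t \<Longrightarrow> adapted t (\<lambda>s. d s i)"
  using adapted_state[of i] adapted_mono by blast

lemma adapted_A [adapted_intros]: "i \<le> t \<Longrightarrow> adapted t (\<lambda>s. A s i)"
  using adapted_state[of i] adapted_mono by blast

lemma adapted_A_powr [adapted_intros]: "i \<le> t \<Longrightarrow> adapted t (\<lambda>s. A s i powr \<theta>)"
  by (intro adapted_A_powr_aux adapted_A)

lemma adapted_a [adapted_intros]: "i \<le> t \<Longrightarrow> adapted t (\<lambda>s. a s i)"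
  unfolding a_def by (rule adapted_A_powr)

lemma adapted_dsum [adapted_intros]: "i \<le> t \<Longrightarrow> adapted t (\<lambda>s. dsum s i)"
  using adapted_state[of i] adapted_mono by blast

lemma adapted_gX [adapted_intros]: "i \<le> Suc t \<Longrightarrow> adapted t (\<lambda>s. gF (X s i))"
  by (intro adapted_continuous[OF _ gF_continuous] adapted_X)

lemma adapted_err [adapted_intros]: "i \<le> t \<Longrightarrow> adapted t (\<lambda>s. err s i)"
  unfolding err_def by (intro adapted_intros) auto

lemma adapted_\<Delta> [adapted_intros]: "1 \<le> i \<Longrightarrow> i < t \<Longrightarrow> adapted t (\<lambda>s. \<Delta> s i)"
  unfolding \<Delta>_def by (intro adapted_intros) auto

lemma adapted_N [adapted_intros]: "i < t \<Longrightarrow> adapted t (\<lambda>s. N s i)"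
  unfolding N_def by (intro adapted_intros) auto

lemma adapted_Z [adapted_intros]: "i < t \<Longrightarrow> adapted t (\<lambda>s. Z s i)"
  unfolding Z_def by (intro adapted_intros) auto

lemma X_upd: "i \<le> Suc t \<Longrightarrow> X (s(Suc t := y)) i = X s i"
  by (rule adapted_upd[OF adapted_X])

text \<open>Given the past, \<open>c\<close>, \<open>k\<close>, \<open>v\<close> and both points are
  fixed, and the noise has mean zero. For this reason \<open>error_recursion\<close> has the known
  momentum \<open>a s t\<close> in the place of \<open>k\<close>.\<close>

lemma Ex_martingale:
  assumes t: "1 \<le> t" and c: "adapted t c" and k: "adapted t k" and v: "adapted t v"
  shows "Ex (\<lambda>s. c s * (v s \<bullet> (Z s t + k s *\<^sub>R N s t))) \<le> 0"
proof -
  have "Ex (\<lambda>s. c s * (v s \<bullet> (Z s t + k s *\<^sub>R N s t))) \<le> Ex (\<lambda>s. 0)"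
  proof (rule Ex_mono_next[of t])
    show "adapted (Suc t) (\<lambda>s. c s * (v s \<bullet> (Z s t + k s *\<^sub>R N s t)))"
      by (intro adapted_intros adapted_mono[OF c] adapted_mono[OF k] adapted_mono[OF v]) auto
    fix s
    have "(\<integral>y. c (s(Suc t := y)) * (v (s(Suc t := y)) \<bullet> (Z (s(Suc t := y)) t + k (s(Suc t := y)) *\<^sub>R N (s(Suc t := y)) t)) \<partial>D)
        = (\<integral>y. c s * (v s \<bullet> ((noise (X s (Suc t)) y - noise (X s t) y) + k s *\<^sub>R noise (X s t) y)) \<partial>D)"
      unfolding Z_def N_def by (simp add: X_upd adapted_upd[OF c] adapted_upd[OF k] adapted_upd[OF v])
    also have "\<dots> = c s * (v s \<bullet> (\<integral>y. (noise (X s (Suc t)) y - noise (X s t) y) + k s *\<^sub>R noise (X s t) y \<partial>D))"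
      using noise_integrable by simp
    also have "(\<integral>y. (noise (X s (Suc t)) y - noise (X s t) y) + k s *\<^sub>R noise (X s t) y \<partial>D) = 0"
      using noise_integrable noise_mean by simp
    finally have zero: "(\<integral>y. c (s(Suc t := y)) * (v (s(Suc t := y)) \<bullet> (Z (s(Suc t := y)) t + k (s(Suc t := y)) *\<^sub>R N (s(Suc t := y)) t)) \<partial>D)
        = c s * (v s \<bullet> 0)" .
    show "(\<integral>y. c (s(Suc t := y)) * (v (s(Suc t := y)) \<bullet> (Z (s(Suc t := y)) t + k (s(Suc t := y)) *\<^sub>R N (s(Suc t := y)) t)) \<partial>D)
        \<le> (\<integral>y. 0 \<partial>D)" unfolding zero by simp
  qed (rule adapted_const)
  then show ?thesis by (simp add: Ex_const)
qed

lemma Ex_Z: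
  assumes c: "adapted t c" "\<And>s. 0 \<le> c s"
  shows "Ex (\<lambda>s. c s * (norm (Z s t))\<^sup>2) \<le> Ex (\<lambda>s. c s * (\<beta>\<^sup>2 * (norm (X s (Suc t) - X s t))\<^sup>2))"
proof (rule Ex_mono_next[of t])
  show "adapted (Suc t) (\<lambda>s. c s * (norm (Z s t))\<^sup>2)"
    by (intro adapted_intros adapted_mono[OF c(1)]) auto
  show "adapted (Suc t) (\<lambda>s. c s * (\<beta>\<^sup>2 * (norm (X s (Suc t) - X s t))\<^sup>2))"
    by (intro adapted_intros adapted_mono[OF c(1)]) auto
  fix s
  have "(\<integral>y. c (s(Suc t := y)) * (norm (Z (s(Suc t := y)) t))\<^sup>2 \<partial>D)
     = c s * (\<integral>y. (norm (noise (X s (Suc t)) y - noise (X s t) y))\<^sup>2 \<partial>D)"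
    unfolding Z_def by (simp add: X_upd adapted_upd[OF c(1)])
  also have "\<dots> \<le> c s * (\<beta>\<^sup>2 * (norm (X s (Suc t) - X s t))\<^sup>2)"
    by (intro mult_left_mono noise_diff c)
  finally show "(\<integral>y. c (s(Suc t := y)) * (norm (Z (s(Suc t := y)) t))\<^sup>2 \<partial>D)
    \<le> (\<integral>y. c (s(Suc t := y)) * (\<beta>\<^sup>2 * (norm (X (s(Suc t := y)) (Suc t) - X (s(Suc t := y)) t))\<^sup>2) \<partial>D)"
    by (simp add: X_upd adapted_upd[OF c(1)] D.prob_space)
qed

lemma noise_second_moment:
  "(\<integral>y. (norm (v - noise x y))\<^sup>2 \<partial>D) = (norm v)\<^sup>2 + (\<integral>y. (norm (noise x y))\<^sup>2 \<partial>D)"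
proof -
  have i: "integrable D (\<lambda>y. - noise x y)" using noise_integrable[of x] by simp
  have n: "norm (- noise x y) \<le> 2 * sh" for y using noise_bound[of x y] by simp
  have "(\<integral>y. - noise x y \<partial>D) = 0" using noise_mean[of x] by simp
  with D.second_moment_decomposition[OF i n, of v] show ?thesis by simp
qed

text \<open>Given the past, \<open>\<Delta> s t\<close> is a fixed vector minus the centred noise
  \<open>N s t\<close>, so its mean square exceeds that of \<open>N\<close> by the squared length of
  the vector. The unobserved noise is thus traded for the increment of \<open>A\<close>.\<close>

lemma Ex_N:
  assumes t: "1 \<le> t" and c: "adapted t c" "\<And>s. 0 \<le> c s"
  shows "Ex (\<lambda>s. c s * (norm (N s t))\<^sup>2) \<le> Ex (\<lambda>s. c s * (norm (\<Delta> s t))\<^sup>2)"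
proof (rule Ex_mono_next[of t])
  show "adapted (Suc t) (\<lambda>s. c s * (norm (N s t))\<^sup>2)" "adapted (Suc t) (\<lambda>s. c s * (norm (\<Delta> s t))\<^sup>2)"
    using t by (auto intro!: adapted_intros adapted_mono[OF c(1)])
  fix s
  have "(\<integral>y. c (s(Suc t := y)) * (norm (N (s(Suc t := y)) t))\<^sup>2 \<partial>D) = c s * (\<integral>y. (norm (noise (X s t) y))\<^sup>2 \<partial>D)"
    unfolding N_def by (simp add: X_upd adapted_upd[OF c(1)])
  also have "\<dots> \<le> c s * (\<integral>y. (norm (noise (X s t) (s t) - noise (X s t) y))\<^sup>2 \<partial>D)"
    unfolding noise_second_moment by (intro mult_left_mono c) simp
  also have "\<dots> = (\<integral>y. c (s(Suc t := y)) * (norm (\<Delta> (s(Suc t := y)) t))\<^sup>2 \<partial>D)"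
    unfolding \<Delta>_def by (simp add: X_upd adapted_upd[OF c(1)])
  finally show "(\<integral>y. c (s(Suc t := y)) * (norm (N (s(Suc t := y)) t))\<^sup>2 \<partial>D)
    \<le> (\<integral>y. c (s(Suc t := y)) * (norm (\<Delta> (s(Suc t := y)) t))\<^sup>2 \<partial>D)" .
qed

lemma Ex_noise: "Ex (\<lambda>s. (norm (noise (X s (Suc t)) (s (Suc t))))\<^sup>2) \<le> \<sigma>\<^sup>2"
proof -
  have "Ex (\<lambda>s. (norm (noise (X s (Suc t)) (s (Suc t))))\<^sup>2) \<le> Ex (\<lambda>s. \<sigma>\<^sup>2)"
  proof (rule Ex_mono_next[of t])
    show "adapted (Suc t) (\<lambda>s. (norm (noise (X s (Suc t)) (s (Suc t))))\<^sup>2)" by (intro adapted_intros) auto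
    show "(\<integral>y. (norm (noise (X (s(Suc t := y)) (Suc t)) ((s(Suc t := y)) (Suc t))))\<^sup>2 \<partial>D) \<le> (\<integral>y. \<sigma>\<^sup>2 \<partial>D)" for s
      using G_var by (simp add: X_upd D.prob_space noise_def)
  qed (rule adapted_const)
  then show ?thesis by (simp add: Ex_const)
qed

lemma Ex_\<Delta>:
  assumes t: "1 \<le> t"
  shows "Ex (\<lambda>s. (norm (\<Delta> s t))\<^sup>2) \<le> 2 * \<sigma>\<^sup>2"
proof -
  have ad: "adapted t (\<lambda>s. (norm (noise (X s t) (s t)))\<^sup>2)" using t by (intro adapted_intros) auto
  have "Ex (\<lambda>s. (norm (\<Delta> s t))\<^sup>2) \<le> Ex (\<lambda>s. (norm (noise (X s t) (s t)))\<^sup>2 + \<sigma>\<^sup>2)"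
  proof (rule Ex_mono_next[of t])
    show "adapted (Suc t) (\<lambda>s. (norm (\<Delta> s t))\<^sup>2)" using t by (intro adapted_intros) auto
    show "adapted (Suc t) (\<lambda>s. (norm (noise (X s t) (s t)))\<^sup>2 + \<sigma>\<^sup>2)"
      by (intro adapted_intros adapted_mono[OF ad]) auto
    fix s
    have "(\<integral>y. (norm (noise (X s t) y))\<^sup>2 \<partial>D) \<le> \<sigma>\<^sup>2" using G_var by (simp add: noise_def)
    then show "(\<integral>y. (norm (\<Delta> (s(Suc t := y)) t))\<^sup>2 \<partial>D)
      \<le> (\<integral>y. (norm (noise (X (s(Suc t := y)) t) ((s(Suc t := y)) t)))\<^sup>2 + \<sigma>\<^sup>2 \<partial>D)"
      unfolding \<Delta>_def by (simp add: X_upd noise_second_moment D.prob_space)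
  qed
  also have "\<dots> = Ex (\<lambda>s. (norm (noise (X s t) (s t)))\<^sup>2) + \<sigma>\<^sup>2"
    using Ex_add[OF ad adapted_const] by (simp add: Ex_const)
  also have "\<dots> \<le> \<sigma>\<^sup>2 + \<sigma>\<^sup>2" using Ex_noise[of "t - 1"] t by simp
  finally show ?thesis by simp
qed

lemma Ex_A: "Ex (\<lambda>s. A s (Suc T)) \<le> 1 + 2 * \<sigma>\<^sup>2 * real T / a0\<^sup>2"
proof (induction T)
  case 0 then show ?case by (simp add: Ex_const)
next
  case (Suc T)
  have "Ex (\<lambda>s. A s (Suc (Suc T))) = Ex (\<lambda>s. A s (Suc T) + 1 / a0\<^sup>2 * (norm (\<Delta> s (Suc T)))\<^sup>2)"
    by (subst A_Suc) simp_all
  also have "\<dots> = Ex (\<lambda>s. A s (Suc T)) + 1 / a0\<^sup>2 * Ex (\<lambda>s. (norm (\<Delta> s (Suc T)))\<^sup>2)"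
    unfolding Ex_cmult[symmetric] by (rule Ex_add[of "Suc (Suc T)"]) (auto intro!: adapted_intros)
  also have "\<dots> \<le> (1 + 2 * \<sigma>\<^sup>2 * real T / a0\<^sup>2) + 1 / a0\<^sup>2 * (2 * \<sigma>\<^sup>2)"
    using Suc Ex_\<Delta>[of "Suc T"] by (intro add_mono mult_left_mono) auto
  also have "\<dots> = 1 + 2 * \<sigma>\<^sup>2 * real (Suc T) / a0\<^sup>2" using a0 by (simp add: field_simps)
  finally show ?case .
qed

section \<open>The weighted error sum\<close>

definition m :: real where "m = max 1 (1728 * u ^ 3)"

lemma m_ge_1: "1 \<le> m" unfolding m_def by simp

definition W :: "real \<Rightarrow> (nat \<Rightarrow> 'b) \<Rightarrow> nat \<Rightarrow> real" where
  "W l s t = max (A s t) m powr (4*l/3)"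

definition C :: "(nat \<Rightarrow> 'b) \<Rightarrow> nat \<Rightarrow> real" where
  "C s t = (if m \<le> A s t then 12/5 else 2 + 8 * (4*u) powr (2/3))"

lemma adapted_W [adapted_intros]: "i \<le> t \<Longrightarrow> adapted t (\<lambda>s. W l s i)"
  unfolding W_def by (rule adapted_powr_pos[of _ _ 1]) (auto intro!: adapted_intros simp: A_ge_1 le_max_iff_disj)

lemma adapted_C [adapted_intros]: "i \<le> t \<Longrightarrow> adapted t (\<lambda>s. C s i)"
  unfolding C_def by (intro adapted_if adapted_intros)

lemma adapted_growth [adapted_intros]:
  assumes "i \<le> t"
  shows "adapted t (\<lambda>s. growth l (A s i))"
proof (cases "l = 1/4")
  case True
  then show ?thesis unfolding growth_def using assms A_ge_1 by (auto intro!: adapted_ln adapted_intros)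
next
  case False
  then show ?thesis unfolding growth_def using assms by (simp add: adapted_intros)
qed

lemma W_nonneg: "0 \<le> W l s t" and C_nonneg: "0 \<le> C s t"
  unfolding W_def C_def using u_nonneg by auto

lemma weighted_error_step:
  assumes t: "1 \<le> t" and l: "1/4 \<le> l" "l \<le> 1/2"
  shows "1/3 * (A s (Suc t) powr (4*l/3 - 2/3) * (norm (err s t))\<^sup>2)
    \<le> (W l s (t - 1) * (norm (err s t))\<^sup>2 - W l s t * (norm (err s (Suc t)))\<^sup>2)
     + W l s t * (2 * (1 - a s t)) * (err s t \<bullet> (Z s t + a s t *\<^sub>R N s t))
     + W l s t * C s t * (norm (Z s t))\<^sup>2
     + (2 * W l s t * (a s t)\<^sup>2) * (norm (N s t))\<^sup>2
     + (if m \<le> A s t then 2/5 * (A s t powr (4*l/3) * ((a s t)\<^sup>2 * (norm (\<Delta> s t))\<^sup>2)) else 0)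
     + (if 1 < m then m powr (4*l/3) * (32 * sh\<^sup>2 * (4*u) powr (2/3) * (a s t - a s (Suc t))) else 0)"
proof -
  \<comment> \<open>At \<open>t = 1\<close> this uses the dummy value \<open>A s 0 = 1\<close>, so
    the potential starts with the weight \<open>m powr (4*l/3)\<close>.\<close>
  have A0: "A s (t - 1) \<le> A s t" "A s t \<le> A s (t - 1) + 4 * u"
    using A_mono[of s "t-1"] A_increment[of s "t-1"] t by auto
  have N2: "(norm (N s t))\<^sup>2 \<le> 4 * sh\<^sup>2"
    using power_mono[OF noise_bound, of "X s t" "s (Suc t)" 2] unfolding N_def by simp
  show ?thesis
    using potential_step[OF a0 u_def l A_ge_1 A0 A_Suc[OF t] \<Delta>_bound N2 err_Suc[OF t, unfolded a_def]]
    unfolding W_def C_def m_def[symmetric] a_def by (simp only: mult.assoc mult.left_commute[of 2])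
qed

text \<open>In expectation the cross terms drop out, \<open>Z\<close> becomes a step length and
  \<open>N\<close> becomes \<open>\<Delta>\<close>. The factor 48/5 is
  \<open>3 * 4/3 * (2 + 2/5)\<close>: 3 undoes the \<open>1/3\<close> of
  \<open>potential_step\<close>, \<open>4/3\<close> comes from \<open>sum_second_phase\<close>, 2
  from the squared noise and \<open>2/5\<close> from exchanging the momenta.\<close>

lemma weighted_error_bound:
  assumes l: "1/4 \<le> l" "l \<le> 1/2"
  shows "Ex (\<lambda>s. \<Sum>t=1..T. A s (Suc t) powr (4*l/3 - 2/3) * (norm (err s t))\<^sup>2)
    \<le> 3 * (m powr (4*l/3) * \<sigma>\<^sup>2)
      + (if 1 < m then 3 * m powr (4*l/3) * (2 * a0\<^sup>2 * (3 + 4*u) + 32 * sh\<^sup>2 * (4*u) powr (2/3)) else 0)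
      + 48/5 * a0\<^sup>2 * Ex (\<lambda>s. growth l (A s (Suc T)))
      + 3 * Ex (\<lambda>s. \<Sum>t=1..T. W l s t * C s t * (\<beta>\<^sup>2 * (norm (X s (Suc t) - X s t))\<^sup>2))"
proof -
  define L where "L s = (\<Sum>t=1..T. A s (Suc t) powr (4*l/3 - 2/3) * (norm (err s t))\<^sup>2)" for s
  define I where "I s = m powr (4*l/3) * (norm (err s (Suc 0)))\<^sup>2" for s
  define P1 where "P1 t s = W l s t * (2 * (1 - a s t)) * (err s t \<bullet> (Z s t + a s t *\<^sub>R N s t))" for t s
  define P2 where "P2 t s = W l s t * C s t * (norm (Z s t))\<^sup>2" for t s
  define P2' where "P2' t s = W l s t * C s t * (\<beta>\<^sup>2 * (norm (X s (Suc t) - X s t))\<^sup>2)" for t s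
  define P3 where "P3 t s = (2 * W l s t * (a s t)\<^sup>2) * (norm (N s t))\<^sup>2" for t s
  define P3' where "P3' t s = (2 * W l s t * (a s t)\<^sup>2) * (norm (\<Delta> s t))\<^sup>2" for t s
  define P4 where "P4 t s = (if m \<le> A s t then 2/5 * (A s t powr (4*l/3) * ((a s t)\<^sup>2 * (norm (\<Delta> s t))\<^sup>2)) else 0)" for t s
  define c5 where "c5 = (if 1 < m then m powr (4*l/3) * (32 * sh\<^sup>2 * (4*u) powr (2/3)) else 0)"
  define c6 where "c6 = (if 1 < m then m powr (4*l/3) * (2 * a0\<^sup>2 * (3 + 4*u)) else 0)"
  have adapted_sq: "adapted k (\<lambda>s. (a s t)\<^sup>2)" if "t \<le> k" for t k
    unfolding power2_eq_square using that by (intro adapted_intros)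
  have ad: "adapted (Suc T) (P1 t)" "adapted (Suc T) (P2 t)" "adapted (Suc T) (P2' t)" "adapted (Suc T) (P3 t)"
    "adapted (Suc T) (P3' t)" "adapted (Suc T) (P4 t)" if "t \<in> {1..T}" for t
    unfolding P1_def P2_def P2'_def P3_def P3'_def P4_def using that
    by (intro adapted_intros adapted_sq adapted_if; simp)+
  have adI: "adapted (Suc T) I" unfolding I_def by (intro adapted_intros) auto
  have adL: "adapted (Suc T) L" unfolding L_def by (intro adapted_intros) auto
  have c5: "0 \<le> c5" unfolding c5_def by simp
  have path: "1/3 * L s \<le> I s + ((\<Sum>t=1..T. P1 t s) + ((\<Sum>t=1..T. P2 t s) + ((\<Sum>t=1..T. P3 t s) + ((\<Sum>t=1..T. P4 t s) + c5))))" for s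
  proof -
    have "1/3 * L s = (\<Sum>t=1..T. 1/3 * (A s (Suc t) powr (4*l/3 - 2/3) * (norm (err s t))\<^sup>2))"
      unfolding L_def by (rule sum_distrib_left)
    also have "\<dots> \<le> (\<Sum>t=1..T. (W l s (t - 1) * (norm (err s t))\<^sup>2 - W l s t * (norm (err s (Suc t)))\<^sup>2)
       + P1 t s + P2 t s + P3 t s + P4 t s + c5 * (a s t - a s (Suc t)))"
    proof (rule sum_mono)
      fix t assume "t \<in> {1..T}"
      then have "1 \<le> t" by simp
      from weighted_error_step[OF this l, of s] show "1/3 * (A s (Suc t) powr (4*l/3 - 2/3) * (norm (err s t))\<^sup>2)
        \<le> (W l s (t - 1) * (norm (err s t))\<^sup>2 - W l s t * (norm (err s (Suc t)))\<^sup>2)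
         + P1 t s + P2 t s + P3 t s + P4 t s + c5 * (a s t - a s (Suc t))"
        unfolding P1_def P2_def P3_def P4_def c5_def by (auto simp: mult.assoc split: if_splits)
    qed
    also have "\<dots> = (\<Sum>t=1..T. W l s (t - 1) * (norm (err s t))\<^sup>2 - W l s t * (norm (err s (Suc t)))\<^sup>2)
       + (\<Sum>t=1..T. P1 t s) + (\<Sum>t=1..T. P2 t s) + (\<Sum>t=1..T. P3 t s) + (\<Sum>t=1..T. P4 t s) + c5 * (\<Sum>t=1..T. a s t - a s (Suc t))"
      by (simp only: sum.distrib sum_distrib_left)
    also have "(\<Sum>t=1..T. a s t - a s (Suc t)) = 1 - a s (Suc T)"
      by (induction T) (auto simp: a_def)
    also have "(\<Sum>t=1..T. W l s (t - 1) * (norm (err s t))\<^sup>2 - W l s t * (norm (err s (Suc t)))\<^sup>2)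
        = W l s 0 * (norm (err s (Suc 0)))\<^sup>2 - W l s T * (norm (err s (Suc T)))\<^sup>2"
      by (induction T) auto
    also have "W l s 0 * (norm (err s (Suc 0)))\<^sup>2 = I s" unfolding I_def W_def using m_ge_1 by (simp add: max_def)
    finally have "1/3 * L s \<le> I s - W l s T * (norm (err s (Suc T)))\<^sup>2 + (\<Sum>t=1..T. P1 t s) + (\<Sum>t=1..T. P2 t s) + (\<Sum>t=1..T. P3 t s)
       + (\<Sum>t=1..T. P4 t s) + c5 * (1 - a s (Suc T))" .
    moreover have "c5 * (1 - a s (Suc T)) \<le> c5 * 1" using c5 a_bounds[of s "Suc T"] by (intro mult_left_mono) auto
    moreover have "0 \<le> W l s T * (norm (err s (Suc T)))\<^sup>2" using W_nonneg by simp
    ultimately show ?thesis by linarith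
  qed
  have noise: "(\<Sum>t=1..T. P3' t s) + (\<Sum>t=1..T. P4 t s) \<le> 16/5 * a0\<^sup>2 * growth l (A s (Suc T)) + c6" for s
  proof -
    let ?g = "\<lambda>t. if max 1 (1728 * u ^ 3) \<le> A s t then A s t powr (4*l/3) * ((A s t powr (-2/3))\<^sup>2 * (A s (Suc t) - A s t)) else 0"
    let ?h = "\<lambda>t. A s t powr (-4/3) * (A s (Suc t) - A s t)"
    have "(\<Sum>t=1..T. P3' t s) + (\<Sum>t=1..T. P4 t s) = (\<Sum>t=1..T. P3' t s + P4 t s)" by (rule sum.distrib[symmetric])
    also have "\<dots> \<le> (\<Sum>t=1..T. 12/5 * a0\<^sup>2 * ?g t + (if 1 < m then m powr (4*l/3) * (2 * a0\<^sup>2) else 0) * ?h t)"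
    proof (rule sum_mono)
      fix t assume "t \<in> {1..T}"
      then have t: "1 \<le> t" by simp
      have dl: "(norm (\<Delta> s t))\<^sup>2 = a0\<^sup>2 * (A s (Suc t) - A s t)" using A_Suc[OF t, of s] a0 by simp
      have a2: "(a s t)\<^sup>2 = A s t powr (-4/3)" unfolding a_def power2_eq_square by (simp flip: powr_add)
      have nn: "0 \<le> A s t powr (-4/3) * (A s (Suc t) - A s t)" using A_mono[of s t] by simp
      have g: "?g t = (if m \<le> A s t then A s t powr (4*l/3) * ((a s t)\<^sup>2 * (A s (Suc t) - A s t)) else 0)"
        unfolding m_def a_def ..
      show "P3' t s + P4 t s \<le> 12/5 * a0\<^sup>2 * ?g t + (if 1 < m then m powr (4*l/3) * (2 * a0\<^sup>2) else 0) * ?h t"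
      \<comment> \<open>Above the floor the two noise terms have the same shape and add up to the
        factor \<open>12/5\<close>. Below it only the first is present, with the constant weight
        \<open>m powr (4*l/3)\<close>.\<close>
      proof (cases "m \<le> A s t")
        case True
        then have "P3' t s + P4 t s = 12/5 * a0\<^sup>2 * ?g t"
          unfolding g P3'_def P4_def W_def dl by (simp add: max_def)
        moreover have "0 \<le> (if 1 < m then m powr (4*l/3) * (2 * a0\<^sup>2) else 0) * ?h t"
          using A_mono[of s t] by simp
        ultimately show ?thesis by linarith
      next
        case False
        then have "1 < m" "P3' t s + P4 t s = m powr (4*l/3) * (2 * a0\<^sup>2) * ?h t"
          using A_ge_1[of s t] unfolding P3'_def P4_def W_def dl a2 by (simp_all add: max_def)
        then show ?thesis using False unfolding g by simp
      qed
    qed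
    also have "\<dots> = 12/5 * a0\<^sup>2 * (\<Sum>t=1..T. ?g t) + (if 1 < m then m powr (4*l/3) * (2 * a0\<^sup>2) else 0) * (\<Sum>t=1..T. ?h t)"
      by (simp only: sum.distrib sum_distrib_left)
    also have "\<dots> \<le> 12/5 * a0\<^sup>2 * (4/3 * growth l (A s (Suc T))) + (if 1 < m then m powr (4*l/3) * (2 * a0\<^sup>2) else 0) * (3 + 4 * u)"
      by (intro add_mono mult_left_mono sum_second_phase[OF _ _ _ _ u_nonneg l] sum_first_phase[OF _ _ _ _ u_nonneg])
        (auto simp: A_ge_1 A_mono A_increment)
    also have "\<dots> = 16/5 * a0\<^sup>2 * growth l (A s (Suc T)) + c6" unfolding c6_def by simp
    finally show ?thesis .
  qed
  have adg: "adapted (Suc T) (\<lambda>s. growth l (A s (Suc T)))" by (intro adapted_intros) auto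
  have sums: "adapted (Suc T) (\<lambda>s. \<Sum>t=1..T. P1 t s)" "adapted (Suc T) (\<lambda>s. \<Sum>t=1..T. P2 t s)"
    "adapted (Suc T) (\<lambda>s. \<Sum>t=1..T. P2' t s)" "adapted (Suc T) (\<lambda>s. \<Sum>t=1..T. P3 t s)"
    "adapted (Suc T) (\<lambda>s. \<Sum>t=1..T. P3' t s)" "adapted (Suc T) (\<lambda>s. \<Sum>t=1..T. P4 t s)"
    by (intro adapted_sum ad; assumption)+
  have "1/3 * Ex L \<le> Ex (\<lambda>s. I s + ((\<Sum>t=1..T. P1 t s) + ((\<Sum>t=1..T. P2 t s) + ((\<Sum>t=1..T. P3 t s) + ((\<Sum>t=1..T. P4 t s) + c5)))))"
    unfolding Ex_cmult[symmetric] by (rule Ex_mono[of "Suc T", OF _ _ path]) (intro adapted_add adapted_mult adapted_divide adapted_const adL adI sums)+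
  also have "\<dots> = Ex I + (Ex (\<lambda>s. \<Sum>t=1..T. P1 t s) + (Ex (\<lambda>s. \<Sum>t=1..T. P2 t s) + (Ex (\<lambda>s. \<Sum>t=1..T. P3 t s)
      + (Ex (\<lambda>s. \<Sum>t=1..T. P4 t s) + c5))))"
    by (simp only: Ex_add[of "Suc T"] adI sums adapted_add adapted_const Ex_const)
  finally have 1: "1/3 * Ex L \<le> \<dots>" .
  have 2: "Ex I \<le> m powr (4*l/3) * \<sigma>\<^sup>2"
    unfolding I_def Ex_cmult err_1 by (intro mult_left_mono Ex_noise) auto
  have Es: "Ex (\<lambda>s. \<Sum>t=1..T. P1 t s) = (\<Sum>t=1..T. Ex (P1 t))" "Ex (\<lambda>s. \<Sum>t=1..T. P2 t s) = (\<Sum>t=1..T. Ex (P2 t))"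
    "Ex (\<lambda>s. \<Sum>t=1..T. P2' t s) = (\<Sum>t=1..T. Ex (P2' t))" "Ex (\<lambda>s. \<Sum>t=1..T. P3 t s) = (\<Sum>t=1..T. Ex (P3 t))"
    "Ex (\<lambda>s. \<Sum>t=1..T. P3' t s) = (\<Sum>t=1..T. Ex (P3' t))"
    by (rule Ex_sum, erule ad)+
  have 3: "Ex (\<lambda>s. \<Sum>t=1..T. P1 t s) \<le> 0"
  proof -
    have "Ex (P1 t) \<le> 0" if "t \<in> {1..T}" for t
      unfolding P1_def using that by (intro Ex_martingale adapted_intros) auto
    then show ?thesis unfolding Es by (rule sum_nonpos)
  qed
  have 4: "Ex (\<lambda>s. \<Sum>t=1..T. P2 t s) \<le> Ex (\<lambda>s. \<Sum>t=1..T. P2' t s)"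
  proof -
    have "Ex (P2 t) \<le> Ex (P2' t)" for t
      unfolding P2_def P2'_def using W_nonneg C_nonneg by (intro Ex_Z adapted_intros) auto
    then show ?thesis unfolding Es by (rule sum_mono)
  qed
  have 5: "Ex (\<lambda>s. \<Sum>t=1..T. P3 t s) \<le> Ex (\<lambda>s. \<Sum>t=1..T. P3' t s)"
  proof -
    have "Ex (P3 t) \<le> Ex (P3' t)" if "t \<in> {1..T}" for t
      unfolding P3_def P3'_def using that W_nonneg by (intro Ex_N adapted_intros adapted_sq) auto
    then show ?thesis unfolding Es by (rule sum_mono)
  qed
  have 6: "Ex (\<lambda>s. \<Sum>t=1..T. P3' t s) + Ex (\<lambda>s. \<Sum>t=1..T. P4 t s) \<le> 16/5 * a0\<^sup>2 * Ex (\<lambda>s. growth l (A s (Suc T))) + c6"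
  proof -
    have "Ex (\<lambda>s. \<Sum>t=1..T. P3' t s) + Ex (\<lambda>s. \<Sum>t=1..T. P4 t s) = Ex (\<lambda>s. (\<Sum>t=1..T. P3' t s) + (\<Sum>t=1..T. P4 t s))"
      by (rule Ex_add[symmetric, OF sums(5,6)])
    also have "\<dots> \<le> Ex (\<lambda>s. 16/5 * a0\<^sup>2 * growth l (A s (Suc T)) + c6)"
      by (rule Ex_mono[of "Suc T", OF _ _ noise]) (intro adapted_add adapted_mult adapted_const adg sums)+
    also have "\<dots> = 16/5 * a0\<^sup>2 * Ex (\<lambda>s. growth l (A s (Suc T))) + c6"
      by (subst Ex_add[of "Suc T"]) (simp_all only: adapted_mult adapted_const adg Ex_const Ex_cmult)
    finally show ?thesis .
  qed
  have "Ex L \<le> 3 * (m powr (4*l/3) * \<sigma>\<^sup>2) + (3 * c6 + 3 * c5) + 48/5 * a0\<^sup>2 * Ex (\<lambda>s. growth l (A s (Suc T)))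
      + 3 * Ex (\<lambda>s. \<Sum>t=1..T. P2' t s)"
    using 1 2 3 4 5 6 by linarith
  also have "3 * c6 + 3 * c5 = (if 1 < m then 3 * m powr (4*l/3) * (2 * a0\<^sup>2 * (3 + 4*u) + 32 * sh\<^sup>2 * (4*u) powr (2/3)) else 0)"
    unfolding c5_def c6_def by (simp add: distrib_left mult.assoc)
  finally show ?thesis unfolding L_def P2'_def .
qed

end

section \<open>Matching the estimates with the constants \<open>K1\<close>, \<open>K2\<close> and
  \<open>K3\<close>\<close>

lemma K0_powr:
  fixes a0 sh l :: real
  defines "u \<equiv> sh\<^sup>2 / a0\<^sup>2"
  shows "K0 a0 sh powr (2*l - 1/2) = 1 / (max 1 (1728 * u ^ 3) + 4 * u) powr ((4*l - 1)/3)"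
proof -
  have "K0 a0 sh = (max 1 (1728 * u ^ 3) + 4 * u) powr (-2/3)"
    unfolding K0_def u_def by (simp add: power_divide flip: power_mult)
  then have "K0 a0 sh powr (2*l - 1/2) = (max 1 (1728 * u ^ 3) + 4 * u) powr (-2/3 * (2*l - 1/2))"
    by (simp only: powr_powr)
  also have "-2/3 * (2*l - 1/2) = -((4*l - 1)/3)" by (simp add: field_simps)
  finally show ?thesis by (simp only: powr_minus_divide)
qed

lemma ratio_powr:
  fixes a0 sh :: real
  assumes "0 < a0" "0 \<le> sh"
  shows "(sh\<^sup>2 / a0\<^sup>2) powr \<theta> = sh powr (2 * \<theta>) / a0 powr (2 * \<theta>)"
  using assms powr_powr[of sh 2 \<theta>] powr_powr[of a0 2 \<theta>] by (simp add: powr_divide)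

lemma K_nonneg:
  assumes a0: "0 < a0" and l: "1/4 \<le> l" "l \<le> 1/2"
  shows "0 \<le> K1 a0 \<sigma> sh l" "0 < K2 a0 l" "0 \<le> K3 a0 sh l"
proof -
  show "0 \<le> K1 a0 \<sigma> sh l" unfolding K1_def by (intro add_nonneg_nonneg mult_nonneg_nonneg divide_nonneg_nonneg) auto
  have "0 < 1 + 2 * l\<^sup>2" by (simp add: add_pos_nonneg)
  then show "0 < K2 a0 l" unfolding K2_def using a0 l by (auto intro!: divide_pos_pos mult_pos_pos)
  show "0 \<le> K3 a0 sh l" unfolding K3_def by (intro add_nonneg_nonneg mult_nonneg_nonneg divide_nonneg_nonneg) auto
qed

context storm_process
begin

text \<open>Since \<open>K0\<close> equals \<open>(m + 4*u) powr (-2/3)\<close>, this is the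
  reciprocal of \<open>K0 powr (2*l - 1/2)\<close>, by which \<open>K1\<close> and \<open>K3\<close>
  divide.\<close>

definition \<kappa> :: "real \<Rightarrow> real" where "\<kappa> l = (m + 4*u) powr ((4*l - 1)/3)"
definition v :: real where "v = sh powr (4/3) / a0 powr (4/3)"

lemma v_bounds: "0 \<le> v" "(4*u) powr (2/3) \<le> 253/100 * v"
proof -
  have e: "u powr (2/3) = v" unfolding u_def v_def using ratio_powr[OF a0 sh, of "2/3"] by simp
  have "(4*u) powr (2/3) = 4 powr (2/3) * u powr (2/3)" by (rule powr_mult)
  also have "(4::real) powr (2/3) \<le> 253/100" by (rule powr_two_thirds_le) (simp_all add: field_simps)
  finally show "(4*u) powr (2/3) \<le> 253/100 * v" unfolding e[symmetric] by (simp add: mult_right_mono)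
  show "0 \<le> v" unfolding v_def by simp
qed

lemma K1_eq: "K1 a0 \<sigma> sh l = 3 * (\<sigma>\<^sup>2 + 24 * (1 + l\<^sup>2) * sh\<^sup>2 / l\<^sup>2)
    + 72 * (u * \<kappa> l) * (\<sigma>\<^sup>2 + 8 * (1 + 6 * v) * (3 * a0\<^sup>2 + 5 * sh\<^sup>2))"
  unfolding K1_def K0_powr u_def[symmetric] m_def[symmetric] \<kappa>_def[symmetric] v_def using a0
  by (simp add: u_def)

lemma K3_eq: "K3 a0 sh l = 144 * (u * \<kappa> l) * (1 + 6 * v) + 3 * (1 + 2 * l\<^sup>2) / l\<^sup>2 * (4 * u) powr (4*l/3)"
  unfolding K3_def K0_powr u_def[symmetric] m_def[symmetric] \<kappa>_def[symmetric] v_def using a0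
  by (simp add: u_def)

text \<open>In this case \<open>m = (12 * u) ^ 3\<close>. Splitting off
  \<open>m powr (1/3) = 12 * u\<close> leaves a power that \<open>\<kappa> l\<close> bounds, and the
  floor takes the form \<open>u * \<kappa> l\<close> found in the constants.\<close>

lemma first_phase_weight:
  assumes l: "1/4 \<le> l" "l \<le> 1/2" and m1: "1 < m"
  shows "m powr (4*l/3) \<le> 12 * (u * \<kappa> l)"
proof -
  have mu: "m = (12 * u) ^ 3" using m1 unfolding m_def by (simp add: max_def power_mult_distrib split: if_splits)
  have "m powr (1/3) = 12 * u" unfolding mu using powr_powr[of "12 * u" 3 "1/3"] u_nonneg by simp
  moreover have "m powr (4*l/3) = m powr (1/3) * m powr ((4*l - 1)/3)"
    by (simp add: diff_divide_distrib flip: powr_add)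
  moreover have "m powr ((4*l - 1)/3) \<le> \<kappa> l" unfolding \<kappa>_def using m_ge_1 u_nonneg l by (intro powr_mono2) auto
  ultimately show ?thesis using u_nonneg by (simp add: mult_left_mono)
qed

lemma K1_bound:
  assumes l: "1/4 \<le> l" "l \<le> 1/2"
  shows "3 * (m powr (4*l/3) * \<sigma>\<^sup>2)
      + (if 1 < m then 3 * m powr (4*l/3) * (2 * a0\<^sup>2 * (3 + 4*u) + 32 * sh\<^sup>2 * (4*u) powr (2/3)) else 0) \<le> K1 a0 \<sigma> sh l"
proof (cases "1 < m")
  case False
  then have "m = 1" using m_ge_1 by simp
  moreover have "0 \<le> 72 * (u * \<kappa> l) * (\<sigma>\<^sup>2 + 8 * (1 + 6 * v) * (3 * a0\<^sup>2 + 5 * sh\<^sup>2))"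
    using u_nonneg v_bounds unfolding \<kappa>_def by simp
  ultimately show ?thesis unfolding K1_eq by simp
next
  case True
  define U where "U = u * \<kappa> l"
  have U: "0 \<le> U" unfolding U_def \<kappa>_def using u_nonneg by simp
  have w: "m powr (4*l/3) \<le> 12 * U" unfolding U_def by (rule first_phase_weight[OF l True])
  have ua: "a0\<^sup>2 * u = sh\<^sup>2" unfolding u_def using a0 by simp
  have "2 * a0\<^sup>2 * (3 + 4*u) + 32 * sh\<^sup>2 * (4*u) powr (2/3) \<le> 6 * a0\<^sup>2 + 8 * sh\<^sup>2 + 32 * sh\<^sup>2 * (253/100 * v)"
    using v_bounds(2) ua by (intro add_mono mult_left_mono) (auto simp: algebra_simps)
  also have "\<dots> \<le> 16 * (1 + 6 * v) * (3 * a0\<^sup>2 + 5 * sh\<^sup>2)"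
  proof -
    have "0 \<le> a0\<^sup>2" "0 \<le> sh\<^sup>2" "0 \<le> a0\<^sup>2 * v" "0 \<le> sh\<^sup>2 * v" using v_bounds(1) by auto
    then show ?thesis by (simp add: algebra_simps)
  qed
  finally have n: "2 * a0\<^sup>2 * (3 + 4*u) + 32 * sh\<^sup>2 * (4*u) powr (2/3) \<le> 16 * (1 + 6 * v) * (3 * a0\<^sup>2 + 5 * sh\<^sup>2)" .
  have "3 * m powr (4*l/3) * (2 * a0\<^sup>2 * (3 + 4*u) + 32 * sh\<^sup>2 * (4*u) powr (2/3))
      \<le> 3 * (12 * U) * (16 * (1 + 6 * v) * (3 * a0\<^sup>2 + 5 * sh\<^sup>2))"
    using w n U u_nonneg by (intro mult_mono mult_left_mono) auto
  moreover have "3 * (m powr (4*l/3) * \<sigma>\<^sup>2) \<le> 3 * (12 * U * \<sigma>\<^sup>2)"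
    using w by (intro mult_left_mono mult_right_mono) auto
  moreover have "0 \<le> U * \<sigma>\<^sup>2" using U by simp
  moreover have "0 \<le> 3 * (\<sigma>\<^sup>2 + 24 * (1 + l\<^sup>2) * sh\<^sup>2 / l\<^sup>2)" by simp
  moreover have "72 * U * (\<sigma>\<^sup>2 + 8 * (1 + 6 * v) * (3 * a0\<^sup>2 + 5 * sh\<^sup>2))
      = 3 * (12 * U * \<sigma>\<^sup>2) + 36 * (U * \<sigma>\<^sup>2) + 3 * (12 * U) * (16 * (1 + 6 * v) * (3 * a0\<^sup>2 + 5 * sh\<^sup>2))"
    by (simp add: algebra_simps)
  ultimately show ?thesis unfolding K1_eq U_def[symmetric] if_P[OF True] by linarith
qed

lemma K3_bound:
  assumes l: "1/4 \<le> l" "l \<le> 1/2"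
  shows "3 * (W l s t * C s t) \<le> (K3 a0 sh l + 3 * (1 + 2 * l\<^sup>2) / l\<^sup>2) * A s t powr (4*l/3)"
proof -
  have U: "0 \<le> u * \<kappa> l" unfolding \<kappa>_def using u_nonneg by simp
  have A1: "1 \<le> A s t powr (4*l/3)" using A_ge_1 l by (intro ge_one_powr_ge_zero) auto
  \<comment> \<open>The right side decreases in \<open>l\<close> and has the value 18 at
    \<open>l = 1/2\<close>.\<close>
  have l18: "18 \<le> 3 * (1 + 2 * l\<^sup>2) / l\<^sup>2"
  proof -
    have "l\<^sup>2 \<le> (1/2)\<^sup>2" using l by (intro power_mono) auto
    then show ?thesis using l by (simp add: pos_le_divide_eq power2_eq_square)
  qed
  have e0: "0 \<le> 3 * (1 + 2 * l\<^sup>2) / l\<^sup>2 * (4 * u) powr (4*l/3)" using l18 by (intro mult_nonneg_nonneg) auto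
  have uv: "0 \<le> 144 * (u * \<kappa> l) * (1 + 6 * v)" using U v_bounds by simp
  show ?thesis
  proof (cases "m \<le> A s t")
    case True
    then have "3 * (W l s t * C s t) = 36/5 * A s t powr (4*l/3)" unfolding W_def C_def by (simp add: max_def)
    also have "\<dots> \<le> (K3 a0 sh l + 3 * (1 + 2 * l\<^sup>2) / l\<^sup>2) * A s t powr (4*l/3)"
    proof (intro mult_right_mono)
      show "36/5 \<le> K3 a0 sh l + 3 * (1 + 2 * l\<^sup>2) / l\<^sup>2" using l18 e0 uv unfolding K3_eq by linarith
    qed simp
    finally show ?thesis .
  next
    case False
    then have m1: "1 < m" using A_ge_1[of s t] by simp
    have "3 * (W l s t * C s t) = 3 * (m powr (4*l/3) * (2 + 8 * (4*u) powr (2/3)))"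
      unfolding W_def C_def using False by (simp add: max_def)
    also have "\<dots> \<le> 3 * (12 * (u * \<kappa> l) * (2 + 8 * (253/100 * v)))"
      using first_phase_weight[OF l m1] v_bounds U by (intro mult_left_mono mult_mono) auto
    also have "\<dots> \<le> 144 * (u * \<kappa> l) * (1 + 6 * v)"
      using U mult_nonneg_nonneg[OF U v_bounds(1)] by (simp add: algebra_simps)
    also have "\<dots> \<le> K3 a0 sh l + 3 * (1 + 2 * l\<^sup>2) / l\<^sup>2" unfolding K3_eq using e0 l18 by linarith
    also have "\<dots> = (K3 a0 sh l + 3 * (1 + 2 * l\<^sup>2) / l\<^sup>2) * 1" by simp
    also have "\<dots> \<le> (K3 a0 sh l + 3 * (1 + 2 * l\<^sup>2) / l\<^sup>2) * A s t powr (4*l/3)"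
      using A1 l18 K_nonneg(3)[OF a0 l, of sh] by (intro mult_left_mono) auto
    finally show ?thesis .
  qed
qed

text \<open>\<open>growth\<close> without its factor \<open>3 / (4*l - 1)\<close>, which is part of
  \<open>K2\<close>.\<close>

definition gr :: "real \<Rightarrow> real \<Rightarrow> real" where
  "gr l x = (if l = 1/4 then ln x else x powr ((4*l - 1)/3))"

lemma K2_bound:
  assumes l: "1/4 \<le> l" "l \<le> 1/2" and x: "1 \<le> x"
  shows "48/5 * a0\<^sup>2 * growth l x \<le> K2 a0 l * gr l x"
proof -
  have l18: "18 \<le> 3 * (1 + 2 * l\<^sup>2) / l\<^sup>2"
  proof -
    have "l\<^sup>2 \<le> (1/2)\<^sup>2" using l by (intro power_mono) auto
    then show ?thesis using l by (simp add: pos_le_divide_eq power2_eq_square)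
  qed
  have "48/5 * a0\<^sup>2 * growth l x \<le> (3 * (1 + 2 * l\<^sup>2) / l\<^sup>2) * a0\<^sup>2 * growth l x"
  proof (intro mult_right_mono)
    show "48/5 \<le> 3 * (1 + 2 * l\<^sup>2) / l\<^sup>2" using l18 by linarith
  qed (use x l in \<open>auto simp: growth_def\<close>)
  also have "\<dots> = K2 a0 l * gr l x"
  proof -
    have e: "9 * (1 + 2 * l\<^sup>2) * a0\<^sup>2 / (l\<^sup>2 * (4*l - 1)) = (3 * (1 + 2 * l\<^sup>2) / l\<^sup>2) * a0\<^sup>2 * (3 / (4*l - 1))"
      by (simp only: times_divide_eq_left times_divide_eq_right divide_divide_eq_left)
    show ?thesis unfolding K2_def growth_def gr_def e by (simp add: mult.commute mult.left_commute)
  qed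
  finally show ?thesis .
qed

lemma adapted_gr [adapted_intros]:
  assumes "i \<le> t"
  shows "adapted t (\<lambda>s. gr l (A s i))"
  unfolding gr_def using assms A_ge_1 by (cases "l = 1/4") (auto intro!: adapted_ln adapted_intros)

lemma step_size: "1 \<le> t \<Longrightarrow> (norm (X s (Suc t) - X s t))\<^sup>2 = \<eta>\<^sup>2 * ((norm (d s t))\<^sup>2 / (b s t)\<^sup>2)"
  unfolding X_Suc by (simp add: power_mult_distrib power_divide)

lemma adapted_inv_b [adapted_intros]:
  assumes "i \<le> t"
  shows "adapted t (\<lambda>s. 1 / b s i)"
proof -
  have "adapted t (\<lambda>s. (b0 powr (1/p) + dsum s i) powr (-p) * A s i powr (-((1 - p)/3)))"
    by (intro adapted_intros adapted_powr_pos[of _ _ "b0 powr (1/p)"] assms) (use b0 dsum_nonneg in auto)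
  moreover have "(b0 powr (1/p) + dsum s i) powr (-p) * A s i powr (-((1 - p)/3)) = 1 / b s i" for s
    unfolding b_def powr_minus_divide by simp
  ultimately show ?thesis by simp
qed

lemma adapted_d_b [adapted_intros]: "i \<le> t \<Longrightarrow> adapted t (\<lambda>s. (norm (d s i))\<^sup>2 / b s i)"
  using adapted_mult[OF adapted_norm_power[OF adapted_d] adapted_inv_b, of i t i] by simp

lemma adapted_d_b2 [adapted_intros]: "i \<le> t \<Longrightarrow> adapted t (\<lambda>s. (norm (d s i))\<^sup>2 * A s i powr \<theta> / (b s i)\<^sup>2)"
proof -
  assume i: "i \<le> t"
  have "adapted t (\<lambda>s. (norm (d s i))\<^sup>2 * A s i powr \<theta> * ((1 / b s i) * (1 / b s i)))"
    using i by (intro adapted_mult adapted_norm_power adapted_d adapted_A_powr adapted_inv_b)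
  then show ?thesis by (simp add: power2_eq_square)
qed

text \<open>The weight is \<open>a s (Suc t) powr (1 - 2*l)\<close>. The companion \<open>V\<close>
  collects the squared step lengths, up to \<open>\<eta>\<^sup>2\<close>, with the unfloored weight
  of the potential.\<close>

definition Y :: "real \<Rightarrow> nat \<Rightarrow> (nat \<Rightarrow> 'b) \<Rightarrow> real" where
  "Y l T s = (\<Sum>t=1..T. A s (Suc t) powr (4*l/3 - 2/3) * (norm (err s t))\<^sup>2)"

definition V :: "real \<Rightarrow> nat \<Rightarrow> (nat \<Rightarrow> 'b) \<Rightarrow> real" where
  "V l T s = (\<Sum>t=1..T. (norm (d s t))\<^sup>2 * A s t powr (4*l/3) / (b s t)\<^sup>2)"

lemma adapted_Y: "adapted (Suc T) (Y l T)" unfolding Y_def by (intro adapted_intros) auto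
lemma adapted_V: "adapted (Suc T) (V l T)"
  unfolding V_def by (intro adapted_intros) simp

lemma V_nonneg: "0 \<le> V l T s" unfolding V_def by (intro sum_nonneg) auto

text \<open>The floored weight and the coefficient \<open>C\<close> are absorbed by
  \<open>K3_bound\<close>, so that only \<open>A s t powr (4*l/3)\<close> remains in front of the
  squared steps.\<close>

lemma Ex_Y:
  assumes l: "1/4 \<le> l" "l \<le> 1/2"
  shows "Ex (Y l T) \<le> K1 a0 \<sigma> sh l + K2 a0 l * Ex (\<lambda>s. gr l (A s (Suc T)))
     + (K3 a0 sh l + 3 * (1 + 2 * l\<^sup>2) / l\<^sup>2) * (\<eta>\<^sup>2 * \<beta>\<^sup>2) * Ex (V l T)"
proof -
  have "3 * Ex (\<lambda>s. \<Sum>t=1..T. W l s t * C s t * (\<beta>\<^sup>2 * (norm (X s (Suc t) - X s t))\<^sup>2))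
      = Ex (\<lambda>s. 3 * (\<Sum>t=1..T. W l s t * C s t * (\<beta>\<^sup>2 * (norm (X s (Suc t) - X s t))\<^sup>2)))" by (rule Ex_cmult[symmetric])
  also have "\<dots> \<le> Ex (\<lambda>s. ((K3 a0 sh l + 3 * (1 + 2 * l\<^sup>2) / l\<^sup>2) * (\<eta>\<^sup>2 * \<beta>\<^sup>2)) * V l T s)"
  proof (rule Ex_mono[of "Suc T"])
    show "adapted (Suc T) (\<lambda>s. 3 * (\<Sum>t=1..T. W l s t * C s t * (\<beta>\<^sup>2 * (norm (X s (Suc t) - X s t))\<^sup>2)))"
      by (intro adapted_intros) auto
    show "adapted (Suc T) (\<lambda>s. ((K3 a0 sh l + 3 * (1 + 2 * l\<^sup>2) / l\<^sup>2) * (\<eta>\<^sup>2 * \<beta>\<^sup>2)) * V l T s)"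
      by (intro adapted_mult adapted_const adapted_V)
    fix s
    show "3 * (\<Sum>t=1..T. W l s t * C s t * (\<beta>\<^sup>2 * (norm (X s (Suc t) - X s t))\<^sup>2))
      \<le> ((K3 a0 sh l + 3 * (1 + 2 * l\<^sup>2) / l\<^sup>2) * (\<eta>\<^sup>2 * \<beta>\<^sup>2)) * V l T s"
      unfolding V_def sum_distrib_left
    proof (rule sum_mono)
      fix t assume "t \<in> {1..T}"
      then have t: "1 \<le> t" by simp
      have "3 * (W l s t * C s t * (\<beta>\<^sup>2 * (norm (X s (Suc t) - X s t))\<^sup>2))
          = (3 * (W l s t * C s t)) * (\<beta>\<^sup>2 * (\<eta>\<^sup>2 * ((norm (d s t))\<^sup>2 / (b s t)\<^sup>2)))"
        unfolding step_size[OF t] by simp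
      also have "\<dots> \<le> ((K3 a0 sh l + 3 * (1 + 2 * l\<^sup>2) / l\<^sup>2) * A s t powr (4*l/3)) * (\<beta>\<^sup>2 * (\<eta>\<^sup>2 * ((norm (d s t))\<^sup>2 / (b s t)\<^sup>2)))"
        by (intro mult_right_mono K3_bound[OF l]) auto
      finally show "3 * (W l s t * C s t * (\<beta>\<^sup>2 * (norm (X s (Suc t) - X s t))\<^sup>2))
        \<le> (K3 a0 sh l + 3 * (1 + 2 * l\<^sup>2) / l\<^sup>2) * (\<eta>\<^sup>2 * \<beta>\<^sup>2) * ((norm (d s t))\<^sup>2 * A s t powr (4*l/3) / (b s t)\<^sup>2)"
        by (simp add: mult.assoc mult.left_commute mult.commute)
    qed
  qed
  also have "\<dots> = (K3 a0 sh l + 3 * (1 + 2 * l\<^sup>2) / l\<^sup>2) * (\<eta>\<^sup>2 * \<beta>\<^sup>2) * Ex (V l T)" by (rule Ex_cmult)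
  finally have 1: "3 * Ex (\<lambda>s. \<Sum>t=1..T. W l s t * C s t * (\<beta>\<^sup>2 * (norm (X s (Suc t) - X s t))\<^sup>2))
    \<le> (K3 a0 sh l + 3 * (1 + 2 * l\<^sup>2) / l\<^sup>2) * (\<eta>\<^sup>2 * \<beta>\<^sup>2) * Ex (V l T)" .
  have "48/5 * a0\<^sup>2 * Ex (\<lambda>s. growth l (A s (Suc T))) \<le> K2 a0 l * Ex (\<lambda>s. gr l (A s (Suc T)))"
    unfolding Ex_cmult[symmetric]
    by (rule Ex_mono[of "Suc T"]; intro adapted_mult adapted_const adapted_gr adapted_growth K2_bound[OF l] A_ge_1 order_refl)
  with 1 weighted_error_bound[OF l, of T] K1_bound[OF l] show ?thesis unfolding Y_def by linarith
qed

section \<open>Interpolation\<close>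

text \<open>Hoelder's inequality in terms of upper bounds: the weighted mean inequality is applied
  pointwise to \<open>f s / F'\<close> and \<open>g s / G'\<close>, followed by a single
  expectation.\<close>

lemma Ex_interpolate:
  assumes f: "adapted t f" "\<And>s. 0 \<le> f s" "Ex f \<le> F'" "0 < F'"
    and g: "adapted t g" "\<And>s. 0 \<le> g s" "Ex g \<le> G'" "0 < G'" and \<theta>: "0 \<le> \<theta>" "\<theta> \<le> 1"
    and h: "adapted t h" "\<And>s. h s \<le> f s powr \<theta> * g s powr (1 - \<theta>)"
  shows "Ex h \<le> F' powr \<theta> * G' powr (1 - \<theta>)"
proof -
  define k where "k = F' powr \<theta> * G' powr (1 - \<theta>)"
  have k: "0 \<le> k" unfolding k_def by simp
  have pt: "h s \<le> k * (\<theta> / F') * f s + k * ((1 - \<theta>) / G') * g s" for s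
  proof (cases "f s = 0 \<or> g s = 0")
    case True
    then have "h s \<le> 0" using h(2)[of s] by auto
    moreover have "0 \<le> k * (\<theta> / F') * f s + k * ((1 - \<theta>) / G') * g s"
      using k \<theta> f g by (intro add_nonneg_nonneg mult_nonneg_nonneg) auto
    ultimately show ?thesis by linarith
  next
    case False
    then have pos: "0 < f s" "0 < g s" using f(2)[of s] g(2)[of s] by auto
    have "f s powr \<theta> * g s powr (1 - \<theta>) = k * ((f s / F') powr \<theta> * (g s / G') powr (1 - \<theta>))"
      unfolding k_def using f(4) g(4) by (simp add: powr_divide)
    also have "\<dots> \<le> k * (\<theta> * (f s / F') + (1 - \<theta>) * (g s / G'))"
      using pos f(4) g(4) \<theta> k by (intro mult_left_mono Youngs_inequality_0) auto
    also have "\<dots> = k * (\<theta> / F') * f s + k * ((1 - \<theta>) / G') * g s" by (simp add: algebra_simps)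
    finally show ?thesis using h(2)[of s] by linarith
  qed
  have "Ex h \<le> Ex (\<lambda>s. k * (\<theta> / F') * f s + k * ((1 - \<theta>) / G') * g s)"
    by (rule Ex_mono[OF h(1) _ pt]) (intro adapted_add adapted_mult adapted_const f g)
  also have "\<dots> = k * (\<theta> / F') * Ex f + k * ((1 - \<theta>) / G') * Ex g"
    by (simp only: Ex_add[of t] adapted_mult adapted_const f(1) g(1) Ex_cmult)
  also have "\<dots> \<le> k * (\<theta> / F') * F' + k * ((1 - \<theta>) / G') * G'"
    using k \<theta> f g by (intro add_mono mult_left_mono) auto
  also have "\<dots> = k" using f(4) g(4) by (simp add: field_simps)
  finally show ?thesis unfolding k_def .
qed

lemma Ex_powr_le:
  assumes f: "adapted t f" "\<And>s. 0 \<le> f s" "Ex f \<le> F'" "0 < F'" and \<theta>: "0 \<le> \<theta>" "\<theta> \<le> 1"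
  shows "Ex (\<lambda>s. f s powr \<theta>) \<le> F' powr \<theta>"
  using Ex_interpolate[OF f adapted_const[of t 1] _ _ _ \<theta> adapted_powr_nonneg[OF f(1) \<theta>(1) f(2)], of 1] f(2)
  by (simp add: Ex_const)

text \<open>Jensen's inequality through the tangent of the logarithm at \<open>F'\<close>.\<close>

lemma Ex_ln_le:
  assumes f: "adapted t f" "\<And>s. 1 \<le> f s" "Ex f \<le> F'"
  shows "Ex (\<lambda>s. ln (f s)) \<le> ln F'"
proof -
  have "Ex (\<lambda>s. 1) \<le> Ex f" by (rule Ex_mono[of t]) (auto intro: f adapted_const)
  then have F': "0 < F'" using f(3) by (simp add: Ex_const)
  have "Ex (\<lambda>s. ln (f s)) \<le> Ex (\<lambda>s. (ln F' - 1) + 1 / F' * f s)"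
  proof (rule Ex_mono[of t])
    show "adapted t (\<lambda>s. ln (f s))" by (rule adapted_ln[OF f(1,2)])
    show "adapted t (\<lambda>s. (ln F' - 1) + 1 / F' * f s)" by (intro adapted_add adapted_mult adapted_const f)
    fix s
    have "ln (f s / F') \<le> f s / F' - 1" using f(2)[of s] F' by (intro ln_le_minus_one) auto
    then show "ln (f s) \<le> (ln F' - 1) + 1 / F' * f s" using f(2)[of s] F' by (simp add: ln_div)
  qed
  also have "\<dots> = (ln F' - 1) + 1 / F' * Ex f"
    by (simp only: Ex_add[of t] adapted_mult adapted_const f(1) Ex_cmult Ex_const)
  also have "\<dots> \<le> (ln F' - 1) + 1 / F' * F'" using f F' by (intro add_left_mono mult_left_mono) auto
  finally show ?thesis using F' by simp
qed

lemma Ex_A_le_S: "Ex (\<lambda>s. A s (Suc T)) \<le> S_T a0 \<sigma> T" "Ex (\<lambda>s. A s T) \<le> S_T a0 \<sigma> T"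
proof -
  show 1: "Ex (\<lambda>s. A s (Suc T)) \<le> S_T a0 \<sigma> T" unfolding S_T_def by (rule Ex_A)
  have "Ex (\<lambda>s. A s T) \<le> Ex (\<lambda>s. A s (Suc T))"
    by (rule Ex_mono[of "Suc T"]) (auto intro!: adapted_A A_mono)
  then show "Ex (\<lambda>s. A s T) \<le> S_T a0 \<sigma> T" using 1 by linarith
qed

lemma S_ge_1: "1 \<le> S_T a0 \<sigma> T"
  unfolding S_T_def by simp

section \<open>Function value decrease\<close>

text \<open>The coefficient inserted into \<open>stepsize_sum\<close>; \<open>\<mu>\<close> below is
  the weight with which errors and directions are separated in the descent inequality.\<close>

definition Q :: "real \<Rightarrow> real" where "Q lam = K8 a0 \<eta> sh \<beta> lam + K9 a0 \<eta> sh \<beta> lam"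
definition \<mu> :: "real \<Rightarrow> real" where "\<mu> lam = lam / (\<eta> * \<beta>max \<beta>)"

lemma \<beta>max: "1 \<le> \<beta>max \<beta>" "\<beta> \<le> \<beta>max \<beta>" unfolding \<beta>max_def by auto

lemma \<mu>_pos: "0 < lam \<Longrightarrow> 0 < \<mu> lam" unfolding \<mu>_def using \<eta> \<beta>max by simp

lemma Q_eq: "Q lam = \<eta> * \<beta>max \<beta> * (1 + lam * (K3 a0 sh (1/4) + 54) + 1 / lam * (1 + 2 * (sh powr (2/3) / a0 powr (2/3))))"
  unfolding Q_def K8_def K9_def by (simp add: algebra_simps)

text \<open>The summands on the left are the squared steps fed back by \<open>Ex_Y\<close> at
  \<open>l = 1/4\<close>, the curvature term of the descent inequality, and the price of separating
  error and direction. The number 54 is \<open>3 * (1 + 2*l\<^sup>2) / l\<^sup>2\<close> at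
  \<open>l = 1/4\<close>.\<close>

lemma Q_bound:
  assumes lam: "0 < lam"
  shows "\<mu> lam * ((K3 a0 sh (1/4) + 54) * (\<eta>\<^sup>2 * \<beta>\<^sup>2)) + \<eta> * \<beta> + 1 / \<mu> lam * (1 + 2 * (sh powr (2/3) / a0 powr (2/3))) \<le> Q lam"
proof -
  have B: "0 < \<beta>max \<beta>" using \<beta>max by linarith
  have K: "0 \<le> K3 a0 sh (1/4)" by (rule K_nonneg) (use a0 in auto)
  have "\<beta> * \<beta> \<le> \<beta>max \<beta> * \<beta>max \<beta>" using \<beta> \<beta>max by (intro mult_mono) auto
  then have "\<beta>\<^sup>2 / \<beta>max \<beta> \<le> \<beta>max \<beta>" using B by (simp add: power2_eq_square pos_divide_le_eq)
  then have "lam * (K3 a0 sh (1/4) + 54) * \<eta> * (\<beta>\<^sup>2 / \<beta>max \<beta>) \<le> lam * (K3 a0 sh (1/4) + 54) * \<eta> * \<beta>max \<beta>"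
    using lam K \<eta> by (intro mult_left_mono) auto
  moreover have "\<mu> lam * ((K3 a0 sh (1/4) + 54) * (\<eta>\<^sup>2 * \<beta>\<^sup>2)) = lam * (K3 a0 sh (1/4) + 54) * \<eta> * (\<beta>\<^sup>2 / \<beta>max \<beta>)"
    unfolding \<mu>_def using \<eta> B by (simp add: power2_eq_square)
  moreover have "\<eta> * \<beta> \<le> \<eta> * \<beta>max \<beta>" using \<eta> \<beta>max by simp
  moreover have "1 / \<mu> lam = \<eta> * \<beta>max \<beta> * (1 / lam)" unfolding \<mu>_def by simp
  ultimately show ?thesis unfolding Q_eq by (simp add: algebra_simps)
qed

lemma Q_pos: "0 < lam \<Longrightarrow> 0 < Q lam"
proof -
  assume lam: "0 < lam"
  have K: "0 \<le> K3 a0 sh (1/4)" by (rule K_nonneg) (use a0 in auto)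
  have "0 < 1 + lam * (K3 a0 sh (1/4) + 54) + 1 / lam * (1 + 2 * (sh powr (2/3) / a0 powr (2/3)))"
    using lam K by (intro add_pos_nonneg mult_nonneg_nonneg add_nonneg_nonneg) auto
  then show "0 < Q lam" unfolding Q_eq using \<eta> \<beta>max(1) by (intro mult_pos_pos) auto
qed

text \<open>The inner product of error and direction is split by Young's inequality with weight
  \<open>\<mu>' * A s (Suc t) powr (-1/3)\<close>, the weight of \<open>Y\<close> for
  \<open>l = 1/4\<close>. The inverse weight is brought back to time \<open>t\<close> by
  subadditivity of the cube root and \<open>4 powr (1/3) \<le> 2\<close>.\<close>

lemma descent_step:
  assumes t: "1 \<le> t" and \<mu>: "0 < \<mu>'"
  shows "2 * (norm (d s t))\<^sup>2 / b s t \<le> 2 / \<eta> * (F (X s t) - F (X s (Suc t)))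
     + \<mu>' * (A s (Suc t) powr (-1/3) * (norm (err s t))\<^sup>2)
     + (\<eta> * \<beta> + 1 / \<mu>' * (1 + 2 * (sh powr (2/3) / a0 powr (2/3)))) * ((norm (d s t))\<^sup>2 * A s t powr (1/3) / (b s t)\<^sup>2)"
proof -
  let ?b = "b s t" and ?d = "d s t" and ?e = "err s t"
  have b: "0 < ?b" by (rule b_pos)
  define n where "n = (norm ?d)\<^sup>2 / ?b\<^sup>2"
  have n: "0 \<le> n" unfolding n_def by simp
  have A1: "1 \<le> A s t powr (1/3)" using A_ge_1 by (intro ge_one_powr_ge_zero) auto
  have "F (X s (Suc t)) \<le> F (X s t) + gF (X s t) \<bullet> (X s (Suc t) - X s t) + \<beta> / 2 * (norm (X s (Suc t) - X s t))\<^sup>2"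
    by (rule descent)
  also have "(norm (X s (Suc t) - X s t))\<^sup>2 = \<eta>\<^sup>2 * n" unfolding n_def by (rule step_size[OF t])
  also have "gF (X s t) \<bullet> (X s (Suc t) - X s t) = - (\<eta> / ?b) * ((norm ?d)\<^sup>2 - ?e \<bullet> ?d)"
    unfolding X_Suc[OF t] err_def power2_norm_eq_inner by (simp add: inner_diff_left)
  finally have "2 / \<eta> * F (X s (Suc t)) \<le> 2 / \<eta> * (F (X s t) + - (\<eta> / ?b) * ((norm ?d)\<^sup>2 - ?e \<bullet> ?d) + \<beta> / 2 * (\<eta>\<^sup>2 * n))"
    using \<eta> by (intro mult_left_mono) auto
  also have "\<dots> = 2 / \<eta> * F (X s t) - 2 * (norm ?d)\<^sup>2 / ?b + 2 * (?e \<bullet> ?d) / ?b + \<eta> * \<beta> * n"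
    using \<eta> b by (simp add: power2_eq_square field_simps)
  finally have 1: "2 * (norm ?d)\<^sup>2 / ?b \<le> 2 / \<eta> * (F (X s t) - F (X s (Suc t))) + 2 * (?e \<bullet> ?d) / ?b + \<eta> * \<beta> * n"
    by (simp add: right_diff_distrib)
  define w where "w = A s (Suc t) powr (1/3)"
  have w: "0 < w" unfolding w_def using A_ge_1[of s "Suc t"] by simp
  have wm: "A s (Suc t) powr (-1/3) = 1 / w" unfolding w_def using powr_minus_divide[of "A s (Suc t)" "1/3"] by simp
  have 2: "2 * (?e \<bullet> ?d) / ?b \<le> \<mu>' * (1 / w * (norm ?e)\<^sup>2) + 1 / \<mu>' * (w * n)"
  proof -
    have "2 * (?e \<bullet> ?d) / ?b \<le> 2 * (norm ?e * norm ?d) / ?b"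
      using b norm_cauchy_schwarz[of ?e ?d] by (intro divide_right_mono) auto
    also have "\<dots> \<le> \<mu>' * (1 / w * (norm ?e)\<^sup>2) + 1 / \<mu>' * (w * n)"
    proof -
      have "0 \<le> (\<mu>' * ?b * norm ?e - w * norm ?d)\<^sup>2 / (\<mu>' * w * ?b\<^sup>2)" using \<mu> w b by simp
      also have "\<dots> = \<mu>' * (1 / w * (norm ?e)\<^sup>2) + 1 / \<mu>' * (w * n) - 2 * (norm ?e * norm ?d) / ?b"
        unfolding n_def using \<mu> w b by (simp add: power2_eq_square field_simps)
      finally show ?thesis by simp
    qed
    finally show ?thesis .
  qed
  have 3: "w \<le> A s t powr (1/3) * (1 + 2 * (sh powr (2/3) / a0 powr (2/3)))"
  proof -
    have "w \<le> (A s t + 4 * u) powr (1/3)" unfolding w_def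
      using A_increment[of s t] A_ge_1[of s "Suc t"] by (intro powr_mono2) auto
    also have "\<dots> \<le> A s t powr (1/3) + (4 * u) powr (1/3)" using A_ge_1[of s t] u_nonneg by (intro powr_add_le) auto
    also have "(4 * u) powr (1/3) = 4 powr (1/3) * u powr (1/3)" by (rule powr_mult)
    also have "u powr (1/3) = sh powr (2/3) / a0 powr (2/3)" unfolding u_def using ratio_powr[OF a0 sh, of "1/3"] by simp
    also have "(4::real) powr (1/3) * (sh powr (2/3) / a0 powr (2/3)) \<le> (2 * (sh powr (2/3) / a0 powr (2/3))) * 1"
    proof -
      have "(4::real) powr (1/3) \<le> 8 powr (1/3)" by (intro powr_mono2) auto
      also have "\<dots> = 2" using powr_powr[of 2 3 "1/3"] by simp
      finally show ?thesis unfolding mult_1_right by (intro mult_right_mono) auto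
    qed
    also have "(2 * (sh powr (2/3) / a0 powr (2/3))) * 1 \<le> (2 * (sh powr (2/3) / a0 powr (2/3))) * A s t powr (1/3)"
      using A1 by (intro mult_left_mono) auto
    finally show ?thesis by (simp add: algebra_simps)
  qed
  have "1 / \<mu>' * (w * n) \<le> 1 / \<mu>' * ((A s t powr (1/3) * (1 + 2 * (sh powr (2/3) / a0 powr (2/3)))) * n)"
    using 3 \<mu> n by (intro mult_left_mono mult_right_mono) auto
  moreover have "\<eta> * \<beta> * n \<le> \<eta> * \<beta> * (n * A s t powr (1/3))"
    using A1 n \<eta> \<beta> mult_left_mono[OF A1 n] by (intro mult_left_mono) auto
  ultimately have "2 * (norm ?d)\<^sup>2 / ?b \<le> 2 / \<eta> * (F (X s t) - F (X s (Suc t))) + \<mu>' * (1 / w * (norm ?e)\<^sup>2)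
     + (\<eta> * \<beta> + 1 / \<mu>' * (1 + 2 * (sh powr (2/3) / a0 powr (2/3)))) * (n * A s t powr (1/3))"
    using 1 2 by (simp add: algebra_simps)
  then show ?thesis unfolding wm n_def by simp
qed

text \<open>The base of the second power in \<open>storm_bound\<close>, for the gap
  \<open>F x1 - Fstar\<close>.\<close>

definition B2 :: "real \<Rightarrow> nat \<Rightarrow> real" where
  "B2 lam T = K5 a0 b0 \<eta> \<sigma> sh \<beta> p lam (F x1 - Fstar) + (K6 a0 \<eta> \<beta> lam + K7 a0 \<eta> sh \<beta> p lam / 3) * ln (S_T a0 \<sigma> T)
     + K7 a0 \<eta> sh \<beta> p lam * ln (Q lam / b0)"

text \<open>\<open>stepsize_sum\<close> leaves the sum of
  \<open>2 * (norm (d s t))\<^sup>2 / b s t\<close> reduced by \<open>Q lam\<close> times weighted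
  squared steps. The descent inequality bounds the former through errors, and \<open>Ex_Y\<close>
  turns these into squared steps again; their total coefficient is nonpositive by
  \<open>Q_bound\<close>, so only logarithms of \<open>A\<close> survive.\<close>

lemma Ex_D:
  assumes lam: "0 < lam" and T: "1 \<le> T"
  shows "Ex (\<lambda>s. A s T powr (-(1 - p)/3) * dsum s T powr (1 - p)) \<le> B2 lam T"
proof -
  let ?\<mu> = "\<mu> lam" and ?Q = "Q lam"
  have mu: "0 < ?\<mu>" using \<mu>_pos lam .
  have Q: "0 < ?Q" using Q_pos lam .
  define R where "R = \<eta> * \<beta> + 1 / ?\<mu> * (1 + 2 * (sh powr (2/3) / a0 powr (2/3)))"
  define D1 where "D1 s = (\<Sum>t=1..T. 2 * (norm (d s t))\<^sup>2 / b s t - ?Q * ((norm (d s t))\<^sup>2 * A s t powr (1/3) / (b s t)\<^sup>2))" for s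
  define k7 where "k7 = K7 a0 \<eta> sh \<beta> p lam"
  have k7: "k7 = ?Q powr (1/p - 1) / (1 - p)" unfolding k7_def K7_def Q_def ..
  have k70: "0 \<le> k7" unfolding k7 using p by simp
  have adD1: "adapted (Suc T) D1"
  proof -
    have "adapted (Suc T) (\<lambda>s. \<Sum>t=1..T. 2 * ((norm (d s t))\<^sup>2 / b s t) - ?Q * ((norm (d s t))\<^sup>2 * A s t powr (1/3) / (b s t)\<^sup>2))"
      by (intro adapted_sum adapted_diff adapted_mult[OF adapted_const] adapted_d_b adapted_d_b2) auto
    then show ?thesis unfolding D1_def by simp
  qed
  have adD: "adapted (Suc T) (\<lambda>s. A s T powr (-(1 - p)/3) * dsum s T powr (1 - p))"
    using p by (intro adapted_mult adapted_A_powr adapted_powr_nonneg adapted_dsum dsum_nonneg) auto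
  have adln: "adapted (Suc T) (\<lambda>s. ln (A s T))" by (intro adapted_ln adapted_A A_ge_1) simp
  have D1: "D1 s \<le> 2 / \<eta> * (F x1 - Fstar) + (?\<mu> * Y (1/4) T s + (R - ?Q) * V (1/4) T s)" for s
  proof -
    have tel: "(\<Sum>t=1..T. F (X s t) - F (X s (Suc t))) = F x1 - F (X s (Suc T))"
      by (induction T) auto
    have "D1 s \<le> (\<Sum>t=1..T. 2 / \<eta> * (F (X s t) - F (X s (Suc t)))
        + (?\<mu> * (A s (Suc t) powr (4*(1/4)/3 - 2/3) * (norm (err s t))\<^sup>2)
        + (R - ?Q) * ((norm (d s t))\<^sup>2 * A s t powr (4*(1/4)/3) / (b s t)\<^sup>2)))"
      unfolding D1_def
    proof (rule sum_mono)
      fix t assume "t \<in> {1..T}"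
      then have t: "1 \<le> t" by simp
      have e: "4 * (1/4) / 3 - 2/3 = (-1/3::real)" "4 * (1/4) / 3 = (1/3::real)" by auto
      show "2 * (norm (d s t))\<^sup>2 / b s t - ?Q * ((norm (d s t))\<^sup>2 * A s t powr (1/3) / (b s t)\<^sup>2)
        \<le> 2 / \<eta> * (F (X s t) - F (X s (Suc t)))
        + (?\<mu> * (A s (Suc t) powr (4*(1/4)/3 - 2/3) * (norm (err s t))\<^sup>2)
        + (R - ?Q) * ((norm (d s t))\<^sup>2 * A s t powr (4*(1/4)/3) / (b s t)\<^sup>2))"
        using descent_step[OF t mu, of s] unfolding e(1) unfolding e(2) R_def left_diff_distrib by linarith
    qed
    also have "\<dots> = 2 / \<eta> * (\<Sum>t=1..T. F (X s t) - F (X s (Suc t))) + (?\<mu> * Y (1/4) T s + (R - ?Q) * V (1/4) T s)"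
      unfolding Y_def V_def by (simp only: sum.distrib sum_distrib_left)
    also have "\<dots> \<le> 2 / \<eta> * (F x1 - Fstar) + (?\<mu> * Y (1/4) T s + (R - ?Q) * V (1/4) T s)"
      unfolding tel using \<eta> F_lower[of "X s (Suc T)"] by (intro add_right_mono mult_left_mono) auto
    finally show ?thesis .
  qed
  have gr14: "gr (1/4) x = ln x" for x unfolding gr_def by simp
  have "Ex D1 \<le> Ex (\<lambda>s. 2 / \<eta> * (F x1 - Fstar) + (?\<mu> * Y (1/4) T s + (R - ?Q) * V (1/4) T s))"
    by (rule Ex_mono[of "Suc T", OF adD1 _ D1]) (intro adapted_add adapted_mult adapted_const adapted_Y adapted_V)
  also have "\<dots> = 2 / \<eta> * (F x1 - Fstar) + (?\<mu> * Ex (Y (1/4) T) + (R - ?Q) * Ex (V (1/4) T))"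
    by (simp only: Ex_add[of "Suc T"] adapted_add adapted_mult adapted_const adapted_Y adapted_V Ex_cmult Ex_const)
  also have "?\<mu> * Ex (Y (1/4) T) \<le> ?\<mu> * (K1 a0 \<sigma> sh (1/4) + K2 a0 (1/4) * Ex (\<lambda>s. ln (A s (Suc T)))
      + (K3 a0 sh (1/4) + 54) * (\<eta>\<^sup>2 * \<beta>\<^sup>2) * Ex (V (1/4) T))"
    using mu Ex_Y[of "1/4" T] unfolding gr14 by (intro mult_left_mono) (auto simp: power2_eq_square)
  also have "2 / \<eta> * (F x1 - Fstar) + (?\<mu> * (K1 a0 \<sigma> sh (1/4) + K2 a0 (1/4) * Ex (\<lambda>s. ln (A s (Suc T)))
      + (K3 a0 sh (1/4) + 54) * (\<eta>\<^sup>2 * \<beta>\<^sup>2) * Ex (V (1/4) T)) + (R - ?Q) * Ex (V (1/4) T))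
      = 2 / \<eta> * (F x1 - Fstar) + ?\<mu> * K1 a0 \<sigma> sh (1/4) + ?\<mu> * K2 a0 (1/4) * Ex (\<lambda>s. ln (A s (Suc T)))
      + (?\<mu> * ((K3 a0 sh (1/4) + 54) * (\<eta>\<^sup>2 * \<beta>\<^sup>2)) + R - ?Q) * Ex (V (1/4) T)"
    by (simp add: algebra_simps)
  also have "\<dots> \<le> 2 / \<eta> * (F x1 - Fstar) + ?\<mu> * K1 a0 \<sigma> sh (1/4) + ?\<mu> * K2 a0 (1/4) * ln (S_T a0 \<sigma> T) + 0"
  proof (intro add_mono order_refl mult_left_mono mult_nonpos_nonneg)
    show "Ex (\<lambda>s. ln (A s (Suc T))) \<le> ln (S_T a0 \<sigma> T)"
      by (rule Ex_ln_le[of "Suc T"]) (auto intro: adapted_A A_ge_1 Ex_A_le_S)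
    show "0 \<le> ?\<mu> * K2 a0 (1/4)" using mu K_nonneg(2)[OF a0, of "1/4"] by simp
    show "?\<mu> * ((K3 a0 sh (1/4) + 54) * (\<eta>\<^sup>2 * \<beta>\<^sup>2)) + R - ?Q \<le> 0" using Q_bound[OF lam] unfolding R_def by linarith
    show "0 \<le> Ex (V (1/4) T)" by (intro Ex_nonneg V_nonneg)
  qed
  finally have ED1: "Ex D1 \<le> 2 / \<eta> * (F x1 - Fstar) + ?\<mu> * K1 a0 \<sigma> sh (1/4) + ?\<mu> * K2 a0 (1/4) * ln (S_T a0 \<sigma> T)" by simp
  have path: "A s T powr (-(1 - p)/3) * dsum s T powr (1 - p)
      \<le> D1 s + ((b0 powr (1/p - 1) + k7 * ln (?Q / b0)) + k7 * (1/3) * ln (A s T))" for s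
    using stepsize_sum[of b0 p ?Q "\<lambda>t. (norm (d s t))\<^sup>2" "A s" T, OF b0 p Q _ A_ge_1 A_mono T]
    unfolding D1_def b_def dsum_def k7 by (simp add: distrib_left)
  have "Ex (\<lambda>s. A s T powr (-(1 - p)/3) * dsum s T powr (1 - p))
      \<le> Ex (\<lambda>s. D1 s + ((b0 powr (1/p - 1) + k7 * ln (?Q / b0)) + k7 * (1/3) * ln (A s T)))"
    by (rule Ex_mono[OF adD _ path]) (intro adapted_add adapted_mult adapted_const adD1 adln)
  also have "\<dots> = Ex D1 + ((b0 powr (1/p - 1) + k7 * ln (?Q / b0)) + k7 * (1/3) * Ex (\<lambda>s. ln (A s T)))"
    by (simp only: Ex_add[of "Suc T"] adapted_add adapted_mult adapted_const adD1 adln Ex_cmult Ex_const)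
  also have "\<dots> \<le> Ex D1 + ((b0 powr (1/p - 1) + k7 * ln (?Q / b0)) + k7 * (1/3) * ln (S_T a0 \<sigma> T))"
    using k70 by (intro add_left_mono mult_left_mono Ex_ln_le[of "Suc T"]) (auto intro: adapted_A A_ge_1 Ex_A_le_S)
  also have "\<dots> \<le> B2 lam T"
    using ED1 unfolding B2_def K5_def K6_def k7_def[symmetric] \<mu>_def by (simp add: algebra_simps)
  finally show ?thesis .
qed

end

lemma phat_bounds:
  fixes p :: real
  assumes p: "0 < p" "p \<le> 1/2"
  shows "0 < phat p" "phat p < 1" "1 - phat p = (1 + 2*p) / (4 - p)" "phat p / (1 - p) = 3 / (4 - p)"
    "1 - phat p / (1 - p) = phat p / 3"
proof -
  show "0 < phat p" "phat p < 1" "1 - phat p = (1 + 2*p) / (4 - p)" using p by (auto simp: phat_def field_simps)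
  show e: "phat p / (1 - p) = 3 / (4 - p)" using p by (simp add: phat_def divide_simps)
  show "1 - phat p / (1 - p) = phat p / 3" unfolding e using p by (simp add: phat_def field_simps)
qed

text \<open>The lower limit on \<open>p\<close> gives \<open>(3 - 2*p)\<^sup>2 \<le> 7\<close>,
  which rearranges to the second claim.\<close>

lemma phat_ge:
  fixes p :: real
  assumes p: "(3 - sqrt 7) / 2 \<le> p" "p \<le> 1/2"
  shows "0 < p" "1 - 2 * p \<le> phat p"
proof -
  have s: "sqrt 7 < 3" by (rule real_less_lsqrt) auto
  show p0: "0 < p" using p s by simp
  have "(3 - 2 * p)\<^sup>2 \<le> (sqrt 7)\<^sup>2" using p by (intro power_mono) auto
  then have "(1 - 2 * p) * (4 - p) \<le> 3 * (1 - p)" by (simp add: power2_eq_square algebra_simps)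
  then show "1 - 2 * p \<le> phat p" using p p0 unfolding phat_def by (simp add: pos_le_divide_eq)
qed

section \<open>The error and direction sums\<close>

text \<open>If the term with \<open>X\<close> dominates the base, the outer exponent turns it into
  \<open>X powr (1 - 2*p)\<close>, which is divided out, leaving \<open>X powr (2*p)\<close>.
  Otherwise the dominance of the other two terms itself bounds a power of \<open>X\<close>; dividing
  by \<open>k4\<close> there produces the quotients in \<open>A_T\<close>.\<close>

lemma self_bound:
  fixes k1 k2 k4 S p r X :: real
  assumes k: "0 \<le> k1" "0 \<le> k2" "0 < k4" and S: "1 \<le> S" and p: "0 < p" "p < 1/2" and r: "0 < r" and X: "0 < X"
    and le: "X \<le> (k1 + k2 * S powr ((1 - 2*p)/3) + k4 * X powr ((1 - 2*p)/r)) powr r * S powr (2*p*r/3)"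
  shows "X \<le> (2 * k1 / k4) powr (r / (1 - 2*p)) +
     ((2 * k2 / k4) powr (r / (1 - 2*p)) + (2 * k4) powr (r / (2*p))) * S powr (r/3)"
proof -
  define \<theta> where "\<theta> = (1 - 2*p) / r"
  have th: "0 < \<theta>" "1 / \<theta> = r / (1 - 2*p)" "\<theta> * r = 1 - 2*p" unfolding \<theta>_def using p r by auto
  have root: "(X powr \<theta>) powr (1 / \<theta>) = X" unfolding powr_powr using th(1) X by simp
  define c where "c = k1 + k2 * S powr ((1 - 2*p)/3)"
  have c0: "0 \<le> c" unfolding c_def using k by simp
  show ?thesis
  proof (cases "c \<le> k4 * X powr \<theta>")
    case True
    have "(c + k4 * X powr \<theta>) powr r \<le> (2 * k4 * X powr \<theta>) powr r"
      using True c0 k r by (intro powr_mono2) auto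
    also have "\<dots> = (2 * k4) powr r * X powr (1 - 2*p)" by (simp only: powr_mult powr_powr th(3))
    finally have "X \<le> ((2 * k4) powr r * X powr (1 - 2*p)) * S powr (2*p*r/3)"
      using le S unfolding c_def \<theta>_def by (meson mult_right_mono order_trans powr_ge_zero)
    then have "X * X powr (-(1 - 2*p)) \<le> ((2 * k4) powr r * X powr (1 - 2*p)) * S powr (2*p*r/3) * X powr (-(1 - 2*p))"
      by (intro mult_right_mono) auto
    also have "\<dots> = (2 * k4) powr r * S powr (2*p*r/3) * (X powr (1 - 2*p) * X powr (-(1 - 2*p)))" by simp
    also have "X powr (1 - 2*p) * X powr (-(1 - 2*p)) = 1" unfolding powr_minus using X by simp
    also have "X * X powr (-(1 - 2*p)) = X powr (2*p)" using X powr_add[of X 1 "-(1 - 2*p)"] by simp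
    finally have "(X powr (2*p)) powr (1/(2*p)) \<le> ((2 * k4) powr r * S powr (2*p*r/3)) powr (1/(2*p))"
      using p by (intro powr_mono2) auto
    also have "\<dots> = (2 * k4) powr (r / (2*p)) * S powr (r/3)" using p by (simp add: powr_mult powr_powr)
    finally have "X \<le> (2 * k4) powr (r / (2*p)) * S powr (r/3)" using p X by (simp add: powr_powr)
    moreover have "0 \<le> (2 * k1 / k4) powr (r / (1 - 2*p))" "0 \<le> (2 * k2 / k4) powr (r / (1 - 2*p)) * S powr (r/3)" by auto
    ultimately show ?thesis unfolding distrib_right by linarith
  next
    case False
    define x where "x = 2 * k1 / k4"
    define y where "y = 2 * k2 / k4 * S powr ((1 - 2*p)/3)"
    have xy: "0 \<le> x" "0 \<le> y" unfolding x_def y_def using k by auto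
    have "X powr \<theta> \<le> c / k4" using False k by (simp add: field_simps)
    also have "\<dots> = (x + y) / 2" unfolding c_def x_def y_def using k by (simp add: field_simps)
    also have "\<dots> \<le> max x y" by simp
    finally have "(X powr \<theta>) powr (1 / \<theta>) \<le> max x y powr (1 / \<theta>)" by (intro powr_mono2) (use th(1) in auto)
    also have "\<dots> \<le> x powr (1 / \<theta>) + y powr (1 / \<theta>)" by (simp add: max_def)
    finally have "X \<le> x powr (1 / \<theta>) + y powr (1 / \<theta>)" unfolding root .
    moreover have "y powr (1 / \<theta>) = (2 * k2 / k4) powr (r / (1 - 2*p)) * S powr (r/3)"
    proof -
      have e: "(1 - 2*p)/3 * (r / (1 - 2*p)) = r/3" using p by (simp add: field_simps)
      show ?thesis unfolding y_def th(2) powr_mult powr_powr e ..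
    qed
    moreover have "0 \<le> (2 * k4) powr (r / (2*p)) * S powr (r/3)" by simp
    ultimately show ?thesis unfolding distrib_right x_def th(2) by linarith
  qed
qed

text \<open>The minimum of \<open>1/w + 2 * ln w\<close>, taken at \<open>w = 1/2\<close>, is
  \<open>2 - 2 * ln 2 > 3/5\<close>, so \<open>B\<close> dominates \<open>3/5 * Q\<close> even when
  the logarithm is negative, together with \<open>\<mu> * P\<close> and
  \<open>2 * Q * (L/3)\<close>. The three parts of the left side are then at most
  \<open>5/12\<close>, \<open>5/24\<close> and \<open>5/4\<close> times
  \<open>B\<^sup>2\<close>.\<close>

lemma half_bound:
  fixes P k \<mu> b Q L B :: real
  assumes P: "0 \<le> P" and L: "0 \<le> L" and \<mu>: "0 < \<mu>" and b: "0 < b" and Q: "1 / \<mu> \<le> Q"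
    and k: "0 \<le> k" "k \<le> Q\<^sup>2 / 4"
    and B: "\<mu> * P + b + 2 * Q * (L/3) + 2 * Q * ln (Q / b) \<le> B"
  shows "P + k * (2 * ln (1 + B / b) + L/3) \<le> 3 * B\<^sup>2"
proof -
  have Q0: "0 < Q" using Q \<mu> by (meson less_le_trans zero_less_divide_1_iff)
  define w where "w = Q / b"
  have w: "0 < w" unfolding w_def using Q0 b by simp
  have "ln (1 / (2*w)) \<le> 1 / (2*w) - 1" using w by (intro ln_le_minus_one) auto
  then have "2 - 2 * ln 2 \<le> 1 / w + 2 * ln w" using w by (simp add: ln_div ln_mult field_simps)
  moreover have "ln 2 \<le> (25/36::real)" by (rule ln2_le_25_over_36)
  ultimately have "3/5 \<le> 1 / w + 2 * ln w" by simp
  then have "Q * (3/5) \<le> Q * (1 / w + 2 * ln w)" using Q0 by (intro mult_left_mono) auto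
  also have "\<dots> = b + 2 * Q * ln (Q / b)" unfolding w_def using Q0 b by (simp add: field_simps)
  finally have z: "3/5 * Q \<le> b + 2 * Q * ln (Q / b)" by simp
  have nn: "0 \<le> \<mu> * P" "0 \<le> 2 * Q * (L/3)" using P L \<mu> Q0 by auto
  have B1: "3/5 * Q + \<mu> * P + 2 * Q * (L/3) \<le> B" using B z by linarith
  then have B0: "0 < B" using nn Q0 by linarith
  have QB: "3/5 * Q \<le> B" using B1 nn by linarith
  have p1: "P \<le> 5/12 * B\<^sup>2"
  proof -
    have "1 \<le> Q * \<mu>" using Q \<mu> by (simp add: field_simps)
    then have "12/5 * (1 * P) \<le> 12/5 * (Q * \<mu> * P)" using P by (intro mult_left_mono mult_right_mono) auto
    also have "\<dots> \<le> (3/5 * Q + \<mu> * P)\<^sup>2"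
      using zero_le_power2[of "3/5 * Q - \<mu> * P"] by (simp add: power2_eq_square algebra_simps)
    also have "\<dots> \<le> B\<^sup>2"
    proof (rule power_mono)
      show "3/5 * Q + \<mu> * P \<le> B" using B1 nn by linarith
    qed (use nn Q0 in auto)
    finally show ?thesis by simp
  qed
  have QQ: "Q * B \<le> 5/3 * B\<^sup>2" using QB B0 by (simp add: power2_eq_square)
  have p2: "k * (L/3) \<le> 5/24 * B\<^sup>2"
  proof -
    have "k * (L/3) \<le> Q\<^sup>2 / 4 * (L/3)" using k L by (intro mult_right_mono) auto
    also have "\<dots> = Q / 8 * (2 * Q * (L/3))" by (simp add: power2_eq_square)
    also have "\<dots> \<le> Q / 8 * B" using B1 nn Q0 by (intro mult_left_mono) auto
    also have "\<dots> \<le> 5/24 * B\<^sup>2" using QQ by linarith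
    finally show ?thesis .
  qed
  \<comment> \<open>With \<open>g = B / Q\<close> the hypothesis bounds \<open>ln (Q / b)\<close> by
    \<open>g / 2\<close>, so \<open>ln (1 + B / b)\<close> has a bound linear in \<open>g\<close>
    and free of \<open>b\<close>.\<close>
  have p3: "k * (2 * ln (1 + B / b)) \<le> 5/4 * B\<^sup>2"
  proof -
    define g where "g = B / Q"
    have g: "0 < g" unfolding g_def using B0 Q0 by simp
    have "2 * Q * ln (Q / b) \<le> B" using B nn b by linarith
    then have "ln w \<le> g / 2" unfolding w_def g_def using Q0 by (simp add: field_simps)
    then have "w \<le> exp (g / 2)" using w by (metis exp_le_cancel_iff exp_ln)
    then have "g * w \<le> g * exp (g / 2)" using g by (intro mult_left_mono) auto
    moreover have "1 \<le> exp (g / 2)" using g by simp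
    ultimately have "1 + g * w \<le> (1 + g) * exp (g / 2)" unfolding distrib_right by linarith
    moreover have "B / b = g * w" unfolding g_def w_def using Q0 by simp
    ultimately have "ln (1 + B / b) \<le> ln ((1 + g) * exp (g / 2))" using g w by (simp add: add_pos_pos)
    also have "\<dots> = ln (1 + g) + g / 2" using g by (simp add: ln_mult)
    also have "\<dots> \<le> 3/2 * g" using ln_add_one_self_le_self[of g] g by simp
    finally have "k * (2 * ln (1 + B / b)) \<le> Q\<^sup>2 / 4 * (2 * (3/2 * g))"
      using k g B0 b by (intro mult_mono mult_left_mono) auto
    also have "\<dots> = 3/4 * (Q * B)" unfolding g_def using Q0 by (simp add: power2_eq_square)
    also have "\<dots> \<le> 5/4 * B\<^sup>2" using QQ by linarith
    finally show ?thesis .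
  qed
  have "0 \<le> B\<^sup>2" by simp
  then show "P + k * (2 * ln (1 + B / b) + L/3) \<le> 3 * B\<^sup>2"
    unfolding distrib_left using p1 p2 p3 by linarith
qed

context storm_process
begin

abbreviation "r \<equiv> phat p"

lemmas r_bounds = phat_bounds[OF p]

definition etot :: "nat \<Rightarrow> (nat \<Rightarrow> 'b) \<Rightarrow> real" where
  "etot T s = (\<Sum>t=1..T. (norm (err s t))\<^sup>2)"

lemma etot_nonneg: "0 \<le> etot T s" unfolding etot_def by (intro sum_nonneg) auto

lemma adapted_etot: "adapted (Suc T) (\<lambda>s. etot T s powr r)"
  using r_bounds(1) unfolding etot_def by (intro adapted_powr_nonneg adapted_intros sum_nonneg) auto

lemma adapted_dsum_powr: "0 \<le> \<theta> \<Longrightarrow> adapted (Suc T) (\<lambda>s. dsum s T powr \<theta>)"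
  by (intro adapted_powr_nonneg adapted_dsum dsum_nonneg) auto

lemma K5_ge: "0 < lam \<Longrightarrow> b0 powr (1/p - 1) + \<mu> lam * K1 a0 \<sigma> sh (1/4) \<le> K5 a0 b0 \<eta> \<sigma> sh \<beta> p lam (F x1 - Fstar)"
  unfolding K5_def \<mu>_def using F_lower[of x1] \<eta> by simp

lemma K6_eq: "K6 a0 \<eta> \<beta> lam = \<mu> lam * K2 a0 (1/4)"
  unfolding K6_def \<mu>_def by simp

lemma K7_eq: "K7 a0 \<eta> sh \<beta> p lam = Q lam powr (1/p - 1) / (1 - p)"
  unfolding K7_def Q_def ..

lemma lnS: "0 \<le> ln (S_T a0 \<sigma> T)" using S_ge_1 by simp

text \<open>Only \<open>ln (Q lam / b0)\<close> can be negative. With \<open>w = b0 / Q lam\<close>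
  its contribution is then at most \<open>2 * ln w / w\<close> times
  \<open>b0 powr (1/p - 1)\<close> in size, and this factor is below 1 by
  \<open>ln_div_self_le\<close>. \<open>Ex_interpolate\<close> requires the positivity.\<close>

lemma B2_pos:
  assumes lam: "0 < lam"
  shows "0 < B2 lam T"
proof -
  define c where "c = 1/p - 1"
  have c: "1 \<le> c" unfolding c_def using p by (simp add: field_simps)
  have Q: "0 < Q lam" using Q_pos lam .
  have K: "0 \<le> K1 a0 \<sigma> sh (1/4)" "0 < K2 a0 (1/4)" using K_nonneg[OF a0, of "1/4"] by auto
  have k7: "0 < K7 a0 \<eta> sh \<beta> p lam" unfolding K7_eq using Q p by simp
  have pos: "0 < b0 powr c + K7 a0 \<eta> sh \<beta> p lam * ln (Q lam / b0)"
  proof (cases "b0 \<le> Q lam")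
    case True
    then have "0 \<le> ln (Q lam / b0)" using b0 by simp
    then have "0 \<le> K7 a0 \<eta> sh \<beta> p lam * ln (Q lam / b0)" using k7 by simp
    then show ?thesis using b0 by (simp add: add_pos_nonneg)
  next
    case False
    define w where "w = b0 / Q lam"
    have w: "1 \<le> w" unfolding w_def using False Q by simp
    have "Q lam = b0 / w" unfolding w_def using b0 Q by simp
    then have Qc: "Q lam powr c = b0 powr c / w powr c" by (simp only: powr_divide)
    have "w powr 1 \<le> w powr c" using w c by (intro powr_mono) auto
    then have "b0 powr c / w powr c \<le> b0 powr c / w" using w b0 by (intro divide_left_mono) auto
    then have "b0 powr c / w powr c / (1/2) \<le> b0 powr c / w / (1/2)" by (rule divide_right_mono) simp
    moreover have "b0 powr c / w powr c / (1 - p) \<le> b0 powr c / w powr c / (1/2)"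
      using p w b0 by (intro divide_left_mono) auto
    ultimately have "Q lam powr c / (1 - p) \<le> b0 powr c / w / (1/2)" unfolding Qc by (rule order_trans[rotated])
    then have "K7 a0 \<eta> sh \<beta> p lam * ln w \<le> b0 powr c / w / (1/2) * ln w"
      unfolding K7_eq c_def[symmetric] using w by (intro mult_right_mono) auto
    also have "\<dots> = b0 powr c * (2 * ln w / w)" by simp
    also have "\<dots> < b0 powr c * 1"
    proof (intro mult_strict_left_mono)
      show "2 * ln w / w < 1" using ln_div_self_le[of w] w by linarith
    qed (use b0 in simp)
    finally show ?thesis unfolding w_def using b0 Q by (simp add: ln_div algebra_simps)
  qed
  have "0 \<le> \<mu> lam * K1 a0 \<sigma> sh (1/4)" using \<mu>_pos[OF lam] K by simp
  moreover have "0 \<le> (K6 a0 \<eta> \<beta> lam + K7 a0 \<eta> sh \<beta> p lam / 3) * ln (S_T a0 \<sigma> T)"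
    unfolding K6_eq using \<mu>_pos[OF lam] K k7 lnS by simp
  ultimately show ?thesis using pos K5_ge[OF lam] unfolding B2_def c_def by linarith
qed

text \<open>Interpolation between \<open>Ex_D\<close> and the mean of \<open>A\<close>. The powers
  of \<open>A\<close> cancel precisely when \<open>1 - r / (1 - p) = r / 3\<close>, an equation
  whose solution is \<open>phat p\<close>.\<close>

lemma Ex_dsum:
  assumes lam: "0 < lam" and T: "1 \<le> T"
  shows "Ex (\<lambda>s. dsum s T powr r) \<le> B2 lam T powr (r / (1 - p)) * S_T a0 \<sigma> T powr (r / 3)"
proof -
  have "Ex (\<lambda>s. dsum s T powr r) \<le> B2 lam T powr (r / (1 - p)) * S_T a0 \<sigma> T powr (1 - r / (1 - p))"
  proof (rule Ex_interpolate[of "Suc T" "\<lambda>s. A s T powr (-(1 - p)/3) * dsum s T powr (1 - p)" _ "\<lambda>s. A s T"])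
    show "adapted (Suc T) (\<lambda>s. A s T powr (-(1 - p)/3) * dsum s T powr (1 - p))"
      using p by (intro adapted_mult adapted_A_powr adapted_dsum_powr) auto
    show "Ex (\<lambda>s. A s T powr (-(1 - p)/3) * dsum s T powr (1 - p)) \<le> B2 lam T" by (rule Ex_D[OF lam T])
    show "0 < B2 lam T" by (rule B2_pos[OF lam])
    show "adapted (Suc T) (\<lambda>s. A s T)" by (intro adapted_A) simp
    show "0 \<le> A s T" for s using A_ge_1[of s T] by simp
    show "0 < S_T a0 \<sigma> T" using S_ge_1[of T] by simp
    show "0 \<le> r / (1 - p)" "r / (1 - p) \<le> 1" unfolding r_bounds(4) using p by auto
    show "adapted (Suc T) (\<lambda>s. dsum s T powr r)" using r_bounds(1) by (intro adapted_dsum_powr) auto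
    fix s
    have "(A s T powr (-(1 - p)/3) * dsum s T powr (1 - p)) powr (r / (1 - p)) * A s T powr (1 - r / (1 - p))
        = A s T powr (-(1 - p)/3 * (r / (1 - p)) + r / 3) * dsum s T powr ((1 - p) * (r / (1 - p)))"
      unfolding r_bounds(5) powr_add powr_mult powr_powr by simp
    also have "-(1 - p)/3 * (r / (1 - p)) + r / 3 = 0" using p by (simp add: field_simps)
    also have "(1 - p) * (r / (1 - p)) = r" using p by simp
    finally show "dsum s T powr r \<le> (A s T powr (-(1 - p)/3) * dsum s T powr (1 - p)) powr (r / (1 - p)) * A s T powr (1 - r / (1 - p))"
      using A_ge_1[of s T] by simp
  qed (use Ex_A_le_S in auto)
  then show ?thesis unfolding r_bounds(5) .
qed

text \<open>Monotonicity of \<open>A\<close> gives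
  \<open>etot T s \<le> A s (Suc T) powr (2*p/3) * Y q T s\<close>. The exponent
  \<open>\<rho>\<close> is chosen so that interpolation restores the power \<open>2*p*r/3\<close>;
  as \<open>\<rho> \<le> 1\<close>, Jensen bounds the mean of
  \<open>A s (Suc T) powr \<rho>\<close>.\<close>

lemma Ex_etot:
  assumes Y: "Ex (Y q T) \<le> Y'" "0 < Y'"
  shows "Ex (\<lambda>s. etot T s powr r) \<le> Y' powr r * S_T a0 \<sigma> T powr (2*p*r/3)"
proof -
  define \<rho> where "\<rho> = 2*p*r/3 / (1 - r)"
  have rho: "0 \<le> \<rho>" "\<rho> \<le> 1" "\<rho> * (1 - r) = 2*p*r/3"
  proof -
    show "0 \<le> \<rho>" unfolding \<rho>_def using p r_bounds(1,2) by auto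
    show "\<rho> * (1 - r) = 2*p*r/3" proof -
      have c: "x / c * c = x" if "c \<noteq> 0" for x c :: real using that by simp
      show ?thesis unfolding \<rho>_def by (rule c) (use r_bounds(2) in simp)
    qed
    have "\<rho> = 2*p*(1 - p)/(1 + 2*p)"
      unfolding \<rho>_def r_bounds(3) unfolding phat_def using p by (simp add: divide_simps) (simp add: algebra_simps)
    also have "\<dots> \<le> 1"
    proof -
      have "2*p*(1 - p) \<le> 2*p*1" using p by (intro mult_left_mono) auto
      then have "2*p*(1 - p) \<le> 1 + 2*p" by linarith
      then show ?thesis using p by (simp add: divide_le_eq)
    qed
    finally show "\<rho> \<le> 1" .
  qed
  have S: "0 < S_T a0 \<sigma> T" using S_ge_1[of T] by simp
  have q4: "4*q/3 - 2/3 = - (2*p/3)" using pq by simp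
  have Ag: "adapted (Suc T) (\<lambda>s. A s (Suc T) powr \<rho>)" by (intro adapted_A_powr) simp
  have "Ex (\<lambda>s. etot T s powr r) \<le> Y' powr r * (S_T a0 \<sigma> T powr \<rho>) powr (1 - r)"
  proof (rule Ex_interpolate[of "Suc T" "Y q T" _ "\<lambda>s. A s (Suc T) powr \<rho>"])
    show "adapted (Suc T) (Y q T)" by (rule adapted_Y)
    show "0 \<le> Y q T s" for s unfolding Y_def by (intro sum_nonneg) auto
    show "Ex (\<lambda>s. A s (Suc T) powr \<rho>) \<le> S_T a0 \<sigma> T powr \<rho>"
      by (rule Ex_powr_le[of "Suc T"]) (use S rho Ex_A_le_S order_trans[OF zero_le_one A_ge_1] in \<open>auto intro: adapted_A\<close>)
    show "adapted (Suc T) (\<lambda>s. etot T s powr r)" by (rule adapted_etot)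
    fix s
    have "etot T s \<le> A s (Suc T) powr (2*p/3) * Y q T s"
      unfolding etot_def Y_def sum_distrib_left
    proof (rule sum_mono)
      fix t assume t: "t \<in> {1..T}"
      have "A s (Suc t) \<le> A s (Suc T)"
        by (rule lift_Suc_mono_le[of "A s"]) (use t A_mono in auto)
      then have "A s (Suc t) powr (2*p/3) \<le> A s (Suc T) powr (2*p/3)"
        using A_ge_1[of s "Suc t"] p by (intro powr_mono2) auto
      then have "A s (Suc t) powr (2*p/3) * A s (Suc t) powr (-(2*p/3)) \<le> A s (Suc T) powr (2*p/3) * A s (Suc t) powr (-(2*p/3))"
        by (intro mult_right_mono) auto
      moreover have "A s (Suc t) powr (2*p/3) * A s (Suc t) powr (-(2*p/3)) = 1"
        unfolding powr_minus using A_ge_1[of s "Suc t"] by simp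
      ultimately have "1 * (norm (err s t))\<^sup>2 \<le> A s (Suc T) powr (2*p/3) * A s (Suc t) powr (-(2*p/3)) * (norm (err s t))\<^sup>2"
        by (intro mult_right_mono) auto
      then show "(norm (err s t))\<^sup>2 \<le> A s (Suc T) powr (2*p/3) * (A s (Suc t) powr (4*q/3 - 2/3) * (norm (err s t))\<^sup>2)"
        unfolding q4 by (simp add: mult.assoc)
    qed
    then have "etot T s powr r \<le> (A s (Suc T) powr (2*p/3) * Y q T s) powr r"
      using etot_nonneg r_bounds(1) by (intro powr_mono2) auto
    also have "\<dots> = Y q T s powr r * (A s (Suc T) powr \<rho>) powr (1 - r)"
      unfolding powr_mult powr_powr rho(3) by (simp add: mult.commute)
    finally show "etot T s powr r \<le> Y q T s powr r * (A s (Suc T) powr \<rho>) powr (1 - r)" .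
  qed (use Y S Ag r_bounds in auto)
  then show ?thesis unfolding powr_powr rho(3) .
qed

text \<open>For \<open>l = q\<close> the weight cancels against the power of \<open>A\<close> in the
  squared \<open>b s t\<close>, since \<open>2 * (1 - p)/3 = 4*q/3\<close>; what remains is
  comparable with an integral in \<open>dsum\<close>.\<close>

lemma V_q: "V q T s = (\<Sum>t=1..T. (norm (d s t))\<^sup>2 / (b0 powr (1/p) + dsum s t) powr (2*p))"
  unfolding V_def
proof (rule sum.cong[OF refl])
  fix t
  have "(b s t)\<^sup>2 = (b0 powr (1/p) + dsum s t) powr (p + p) * A s t powr ((1 - p)/3 + (1 - p)/3)"
    unfolding b_def power2_eq_square powr_add by simp
  also have "(1 - p)/3 + (1 - p)/3 = 4*q/3" using pq by simp
  finally have "(b s t)\<^sup>2 = (b0 powr (1/p) + dsum s t) powr (2*p) * A s t powr (4*q/3)" by simp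
  then show "(norm (d s t))\<^sup>2 * A s t powr (4*q/3) / (b s t)\<^sup>2 = (norm (d s t))\<^sup>2 / (b0 powr (1/p) + dsum s t) powr (2*p)"
    using A_ge_1[of s t] by simp
qed

lemma V_q_less:
  assumes p2: "p < 1/2"
  shows "V q T s \<le> dsum s T powr (1 - 2*p) / (1 - 2*p)"
proof -
  have step: "(norm (d s (Suc t)))\<^sup>2 / (b0 powr (1/p) + dsum s (Suc t)) powr (2*p)
      \<le> 1/(1 - 2*p) * (dsum s (Suc t) powr (1 - 2*p) - dsum s t powr (1 - 2*p))" for t
  proof (cases "dsum s (Suc t) = 0")
    case True
    then have "dsum s t = 0" "(norm (d s (Suc t)))\<^sup>2 = 0"
      using dsum_nonneg[of s t] dsum_Suc[of s t] by (auto simp: add_nonneg_eq_0_iff)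
    then show ?thesis using True by simp
  next
    case False
    then have y: "0 < dsum s (Suc t)" using dsum_nonneg[of s "Suc t"] by simp
    have "(1 - 2*p) * (dsum s (Suc t) powr ((1 - 2*p) - 1) * (dsum s (Suc t) - dsum s t))
       \<le> dsum s (Suc t) powr (1 - 2*p) - dsum s t powr (1 - 2*p)"
      using p p2 y dsum_nonneg by (intro powr_diff_ge) (auto simp: dsum_Suc)
    then have 1: "dsum s (Suc t) powr (-(2*p)) * (norm (d s (Suc t)))\<^sup>2
      \<le> 1/(1 - 2*p) * (dsum s (Suc t) powr (1 - 2*p) - dsum s t powr (1 - 2*p))"
      using p2 by (simp add: dsum_Suc field_simps)
    have "(b0 powr (1/p) + dsum s (Suc t)) powr (-(2*p)) \<le> dsum s (Suc t) powr (-(2*p))"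
      using y p b0 by (intro powr_mono2') auto
    then have "(b0 powr (1/p) + dsum s (Suc t)) powr (-(2*p)) * (norm (d s (Suc t)))\<^sup>2 \<le> dsum s (Suc t) powr (-(2*p)) * (norm (d s (Suc t)))\<^sup>2"
      by (intro mult_right_mono) auto
    then show ?thesis using 1 by (simp add: powr_minus_divide)
  qed
  have "V q T s \<le> 1/(1 - 2*p) * dsum s T powr (1 - 2*p)"
    unfolding V_q
  proof (induction T)
    case 0
    show ?case using p2 by simp
  next
    case (Suc T)
    then show ?case using step[of T] by (simp add: algebra_simps)
  qed
  then show ?thesis by simp
qed

lemma V_q_half:
  assumes p2: "p = 1/2"
  shows "V q T s \<le> ln (1 + dsum s T / b0\<^sup>2)"
proof -
  have E: "(b0 powr (1/p) + dsum s t) powr (2*p) = b0\<^sup>2 + dsum s t" for t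
  proof -
    have e: "1/p = 2" "2*p = 1" unfolding p2 by auto
    show ?thesis unfolding e using b0 dsum_nonneg[of s t] by simp
  qed
  have "(\<Sum>t=1..T. (norm (d s t))\<^sup>2 / (b0\<^sup>2 + dsum s t)) \<le> ln (b0\<^sup>2 + dsum s T) - ln (b0\<^sup>2)"
  proof (induction T)
    case 0
    show ?case by (simp add: dsum_def)
  next
    case (Suc T)
    have "(norm (d s (Suc T)))\<^sup>2 / (b0\<^sup>2 + dsum s (Suc T)) \<le> ln (b0\<^sup>2 + dsum s (Suc T)) - ln (b0\<^sup>2 + dsum s T)"
      using ln_diff_ge[of "b0\<^sup>2 + dsum s T" "b0\<^sup>2 + dsum s (Suc T)"] b0 dsum_nonneg[of s T] by (simp add: dsum_Suc add_pos_nonneg)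
    then show ?case using Suc by simp
  qed
  also have "\<dots> = ln ((b0\<^sup>2 + dsum s T) / b0\<^sup>2)"
    using b0 dsum_nonneg[of s T] by (intro ln_divide_pos[symmetric] add_pos_nonneg) auto
  also have "(b0\<^sup>2 + dsum s T) / b0\<^sup>2 = 1 + dsum s T / b0\<^sup>2" using b0 by (simp add: add_divide_distrib)
  finally show ?thesis unfolding V_q E .
qed

text \<open>By \<open>dom\<close> and Jensen with exponent \<open>(1 - 2*p)/r \<le> 1\<close>, the
  direction term in the error bound is at most a power of the quantity being estimated.
  \<open>self_bound\<close> resolves the resulting implicit inequality; \<open>\<beta> > 0\<close>
  makes \<open>K4\<close> positive.\<close>

lemma Ex_error_less:
  assumes p1: "(3 - sqrt 7) / 2 \<le> p" and p2: "p < 1/2" and \<beta>0: "0 < \<beta>"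
    and dom: "Ex (\<lambda>s. dsum s T powr r) \<le> Ex (\<lambda>s. etot T s powr r)"
  shows "Ex (\<lambda>s. etot T s powr r) \<le> A_T a0 b0 \<eta> \<sigma> sh \<beta> p q T"
proof -
  define x where "x = Ex (\<lambda>s. etot T s powr r)"
  define S where "S = S_T a0 \<sigma> T"
  define k1 where "k1 = K1 a0 \<sigma> sh q"
  define k2 where "k2 = K2 a0 q"
  define k4 where "k4 = K4 a0 \<eta> sh \<beta> q"
  have S1: "1 \<le> S" unfolding S_def by (rule S_ge_1)
  have q2: "1/4 < q" "4*q - 1 = 1 - 2*p" using pq p2 by auto
  have k: "0 \<le> k1" "0 < k2" unfolding k1_def k2_def using K_nonneg[OF a0 q_bounds] by auto
  have K3: "0 \<le> K3 a0 sh q" using K_nonneg(3)[OF a0 q_bounds] .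
  have k4: "k4 = (K3 a0 sh q + 3 * (1 + 2 * q\<^sup>2) / q\<^sup>2) * (\<eta>\<^sup>2 * \<beta>\<^sup>2) / (1 - 2*p)"
    unfolding k4_def K4_def using q2 by simp
  have w: "0 < 3 * (1 + 2 * q\<^sup>2) / q\<^sup>2" using q_bounds by (intro divide_pos_pos mult_pos_pos add_pos_nonneg) auto
  have k40: "0 < k4" unfolding k4 using K3 w \<eta> \<beta>0 p2 by (intro divide_pos_pos mult_pos_pos add_nonneg_pos) auto
  have AT: "A_T a0 b0 \<eta> \<sigma> sh \<beta> p q T = (2 * k1 / k4) powr (r / (1 - 2*p)) +
     ((2 * k2 / k4) powr (r / (1 - 2*p)) + (2 * k4) powr (r / (2*p))) * S powr (r/3)"
    unfolding A_T_def Let_def k1_def k2_def k4_def S_def using p2 by simp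
  have EY: "Ex (Y q T) \<le> k1 + k2 * S powr ((1 - 2*p)/3) + k4 * Ex (\<lambda>s. dsum s T powr (1 - 2*p))"
  proof -
    have "Ex (\<lambda>s. gr q (A s (Suc T))) \<le> S powr ((1 - 2*p)/3)"
    proof -
      have "gr q x = x powr ((1 - 2*p)/3)" for x unfolding gr_def using q2 by simp
      moreover have "Ex (\<lambda>s. A s (Suc T) powr ((1 - 2*p)/3)) \<le> S powr ((1 - 2*p)/3)"
        unfolding S_def by (rule Ex_powr_le[of "Suc T"])
          (use p p2 S1 Ex_A_le_S order_trans[OF zero_le_one A_ge_1] in \<open>auto intro: adapted_A simp: S_def\<close>)
      ultimately show ?thesis by simp
    qed
    then have "k2 * Ex (\<lambda>s. gr q (A s (Suc T))) \<le> k2 * S powr ((1 - 2*p)/3)" using k by (intro mult_left_mono) auto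
    moreover have "Ex (V q T) \<le> 1/(1 - 2*p) * Ex (\<lambda>s. dsum s T powr (1 - 2*p))"
      unfolding Ex_cmult[symmetric]
    proof (rule Ex_mono[of "Suc T"])
      show "V q T s \<le> 1/(1 - 2*p) * dsum s T powr (1 - 2*p)" for s using V_q_less[OF p2, of T s] by simp
      show "adapted (Suc T) (\<lambda>s. 1/(1 - 2*p) * dsum s T powr (1 - 2*p))"
        using p2 by (intro adapted_mult adapted_const adapted_dsum_powr) auto
    qed (rule adapted_V)
    then have "(K3 a0 sh q + 3 * (1 + 2 * q\<^sup>2) / q\<^sup>2) * (\<eta>\<^sup>2 * \<beta>\<^sup>2) * Ex (V q T)
        \<le> (K3 a0 sh q + 3 * (1 + 2 * q\<^sup>2) / q\<^sup>2) * (\<eta>\<^sup>2 * \<beta>\<^sup>2) * (1/(1 - 2*p) * Ex (\<lambda>s. dsum s T powr (1 - 2*p)))"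
      using K3 w by (intro mult_left_mono) auto
    ultimately show ?thesis using Ex_Y[OF q_bounds, of T] unfolding k4 k1_def[symmetric] k2_def[symmetric] by simp
  qed
  show ?thesis
  proof (cases "x \<le> 0")
    case True
    have "0 \<le> A_T a0 b0 \<eta> \<sigma> sh \<beta> p q T" unfolding AT by (intro add_nonneg_nonneg mult_nonneg_nonneg) auto
    then show ?thesis using True unfolding x_def by linarith
  next
    case False
    then have x: "0 < x" by simp
    have th: "0 \<le> (1 - 2*p)/r" "(1 - 2*p)/r \<le> 1" using phat_ge[OF p1 p(2)] p2 r_bounds(1) by auto
    have "Ex (\<lambda>s. (dsum s T powr r) powr ((1 - 2*p)/r)) \<le> x powr ((1 - 2*p)/r)"
      by (rule Ex_powr_le[of "Suc T"]) (use dom x th r_bounds(1) in \<open>auto intro: adapted_dsum_powr simp: x_def\<close>)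
    then have D: "Ex (\<lambda>s. dsum s T powr (1 - 2*p)) \<le> x powr ((1 - 2*p)/r)" unfolding powr_powr using r_bounds(1) by simp
    define Y' where "Y' = k1 + k2 * S powr ((1 - 2*p)/3) + k4 * x powr ((1 - 2*p)/r)"
    have "Ex (Y q T) \<le> Y'"
      using EY mult_left_mono[OF D less_imp_le[OF k40]] unfolding Y'_def by linarith
    moreover have "0 < Y'" unfolding Y'_def using k k40 S1 by (intro add_pos_nonneg add_nonneg_pos mult_pos_pos) auto
    ultimately have "x \<le> Y' powr r * S powr (2*p*r/3)" unfolding x_def S_def by (rule Ex_etot)
    then show ?thesis unfolding AT x_def[symmetric] Y'_def
      by (intro self_bound) (use k k40 S1 p p2 r_bounds(1) x in auto)
  qed
qed

text \<open>For \<open>p = 1/2\<close> the base of the second summand of the bound controls the error by itself;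
  the logarithmic form of \<open>A\<^sub>T\<close> is not needed.\<close>

lemma Ex_error_half:
  assumes p2: "p = 1/2" and lam: "0 < lam" and T: "1 \<le> T"
  shows "Ex (\<lambda>s. etot T s powr r) \<le> (3 * (B2 lam T)\<^sup>2) powr r * S_T a0 \<sigma> T powr (r/3)"
proof -
  have q14: "q = 1/4" using pq p2 by simp
  define S where "S = S_T a0 \<sigma> T"
  define k1 where "k1 = K1 a0 \<sigma> sh (1/4)"
  define k2 where "k2 = K2 a0 (1/4)"
  define k where "k = (K3 a0 sh (1/4) + 54) * (\<eta>\<^sup>2 * \<beta>\<^sup>2)"
  define B where "B = B2 lam T"
  have B0: "0 < B" unfolding B_def by (rule B2_pos[OF lam])
  have kk: "0 \<le> k1" "0 < k2" unfolding k1_def k2_def using K_nonneg[OF a0, of "1/4"] by auto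
  have K3: "0 \<le> K3 a0 sh (1/4)" by (rule K_nonneg(3)) (use a0 in auto)
  have k0: "0 \<le> k" unfolding k_def using K3 by simp
  have Q: "0 < Q lam" using Q_pos lam .
  have mu: "0 < \<mu> lam" using \<mu>_pos lam .
  have Qb: "\<mu> lam * k + 1 / \<mu> lam \<le> Q lam"
  proof -
    have "0 \<le> \<eta> * \<beta>" using \<eta> \<beta> by simp
    moreover have "1 / \<mu> lam * 1 \<le> 1 / \<mu> lam * (1 + 2 * (sh powr (2/3) / a0 powr (2/3)))"
      using mu by (intro mult_left_mono) auto
    ultimately show ?thesis using Q_bound[OF lam] unfolding k_def by linarith
  qed
  \<comment> \<open>Arithmetic-geometric mean inequality for the factors
    \<open>\<mu> lam * k\<close> and \<open>1 / \<mu> lam\<close>, whose product is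
    \<open>k\<close>.\<close>
  have k4: "k \<le> (Q lam)\<^sup>2 / 4"
  proof -
    have "4 * k \<le> (\<mu> lam * k + 1 / \<mu> lam)\<^sup>2"
      using zero_le_power2[of "\<mu> lam * k - 1 / \<mu> lam"] mu by (simp add: power2_eq_square algebra_simps)
    also have "\<dots> \<le> (Q lam)\<^sup>2" using Qb mu k0 by (intro power_mono) auto
    finally show ?thesis by simp
  qed
  have Q\<mu>: "1 / \<mu> lam \<le> Q lam" using Qb mu k0 mult_nonneg_nonneg[of "\<mu> lam" k] by linarith
  have Bge: "\<mu> lam * (k1 + k2 * ln S) + b0 + 2 * Q lam * (ln S / 3) + 2 * Q lam * ln (Q lam / b0) \<le> B"
  proof -
    have e: "1/p - 1 = 1" "1 - p = 1/2" unfolding p2 by auto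
    have "K7 a0 \<eta> sh \<beta> p lam = 2 * Q lam" unfolding K7_eq e using Q by simp
    moreover have "b0 powr (1/p - 1) = b0" unfolding e using b0 by simp
    ultimately show ?thesis
      using K5_ge[OF lam] unfolding B_def B2_def K6_eq k1_def k2_def S_def by (simp add: algebra_simps)
  qed
  have hb: "(k1 + k2 * ln S) + k * (2 * ln (1 + B / b0) + ln S / 3) \<le> 3 * B\<^sup>2"
    by (rule half_bound[OF _ _ mu b0 Q\<mu> k0 k4 Bge]) (use kk lnS in \<open>auto simp: S_def\<close>)
  define g where "g s = A s T powr (-(1 - p)/3) * dsum s T powr (1 - p)" for s
  have adg: "adapted (Suc T) g" unfolding g_def using p by (intro adapted_mult adapted_A_powr adapted_dsum_powr) auto
  have g0: "0 \<le> g s" for s unfolding g_def by simp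
  have Eg: "Ex g \<le> B" unfolding g_def B_def by (rule Ex_D[OF lam T])
  \<comment> \<open>Using \<open>1 + y\<^sup>2 \<le> (1 + y)\<^sup>2\<close> replaces
    \<open>dsum\<close> by its square root, which is \<open>g s * A s T powr (1/6)\<close>. The mean
    of \<open>g\<close> is at most \<open>B\<close> by \<open>Ex_D\<close>, and the power of
    \<open>A\<close> costs only a logarithm.\<close>
  have path: "V q T s \<le> 2 * ln (1 + 1 / b0 * g s) + 1/3 * ln (A s T)" for s
  proof -
    define y where "y = sqrt (dsum s T) / b0"
    have y: "0 \<le> y" "dsum s T / b0\<^sup>2 = y\<^sup>2" unfolding y_def using b0 dsum_nonneg by (auto simp: power_divide)
    define a6 where "a6 = A s T powr (1/6)"
    have a6: "1 \<le> a6" unfolding a6_def using A_ge_1 by (intro ge_one_powr_ge_zero) auto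
    have "A s T powr (-(1 - p)/3) = 1 / a6"
    proof -
      have "-(1 - p)/3 = -(1/6)" unfolding p2 by simp
      then show ?thesis unfolding a6_def by (simp only: powr_minus_divide)
    qed
    moreover have "dsum s T powr (1 - p) = sqrt (dsum s T)"
    proof -
      have "1 - p = 1/2" unfolding p2 by simp
      then show ?thesis using dsum_nonneg by (simp only: powr_half_sqrt)
    qed
    ultimately have yg: "y = 1 / b0 * g s * a6" unfolding y_def g_def using a6 by simp
    have "V q T s \<le> ln (1 + y\<^sup>2)" using V_q_half[OF p2, of T s] unfolding y(2) .
    also have "\<dots> \<le> ln ((1 + y)\<^sup>2)"
    proof -
      have "1 + y\<^sup>2 \<le> (1 + y)\<^sup>2" using y by (simp add: power2_eq_square algebra_simps)
      moreover have "0 < 1 + y\<^sup>2" by (simp add: add_pos_nonneg)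
      ultimately show ?thesis using ln_le_cancel_iff[of "1 + y\<^sup>2" "(1 + y)\<^sup>2"] by linarith
    qed
    also have "\<dots> = 2 * ln (1 + y)" using y by (simp add: ln_realpow)
    also have "ln (1 + y) \<le> ln ((1 + 1 / b0 * g s) * a6)"
    proof -
      have "1 + y \<le> (1 + 1 / b0 * g s) * a6" unfolding yg distrib_right using a6 by simp
      then show ?thesis using y by simp
    qed
    also have "\<dots> = ln (1 + 1 / b0 * g s) + 1/6 * ln (A s T)"
    proof -
      have "0 < 1 + 1 / b0 * g s" using b0 g0[of s] by (intro add_pos_nonneg) auto
      then show ?thesis unfolding a6_def using A_ge_1[of s T] by (subst ln_mult) auto
    qed
    finally show ?thesis by simp
  qed
  have adl: "adapted (Suc T) (\<lambda>s. 1 + 1 / b0 * g s)" by (intro adapted_add adapted_mult adapted_const adg)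
  have gl: "1 \<le> 1 + 1 / b0 * g s" for s using g0[of s] b0 by simp
  have EV: "Ex (V q T) \<le> 2 * ln (1 + B / b0) + ln S / 3"
  proof -
    have "Ex (V q T) \<le> Ex (\<lambda>s. 2 * ln (1 + 1 / b0 * g s) + 1/3 * ln (A s T))"
      by (rule Ex_mono[OF adapted_V _ path])
        (intro adapted_add adapted_mult adapted_const adapted_ln adapted_A A_ge_1 adl gl, simp)
    also have "\<dots> = 2 * Ex (\<lambda>s. ln (1 + 1 / b0 * g s)) + 1/3 * Ex (\<lambda>s. ln (A s T))"
    proof -
      have "adapted (Suc T) (\<lambda>s. ln (1 + 1 / b0 * g s))" "adapted (Suc T) (\<lambda>s. ln (A s T))"
        by (intro adapted_ln adl gl adapted_A A_ge_1; simp)+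
      then show ?thesis by (simp only: Ex_add[of "Suc T"] adapted_mult adapted_const Ex_cmult)
    qed
    also have "Ex (\<lambda>s. ln (A s T)) \<le> ln S" unfolding S_def
      by (rule Ex_ln_le[of "Suc T"]) (auto intro: adapted_A A_ge_1 Ex_A_le_S)
    also have "Ex (\<lambda>s. ln (1 + 1 / b0 * g s)) \<le> ln (1 + B / b0)"
    proof (rule Ex_ln_le[OF adl gl])
      have "Ex (\<lambda>s. 1 + 1 / b0 * g s) = 1 + 1 / b0 * Ex g"
        by (simp only: Ex_add[of "Suc T"] adapted_mult adapted_const adg Ex_cmult Ex_const)
      also have "\<dots> \<le> 1 + 1 / b0 * B" using Eg b0 by (intro add_left_mono mult_left_mono) auto
      finally show "Ex (\<lambda>s. 1 + 1 / b0 * g s) \<le> 1 + B / b0" by simp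
    qed
    finally show ?thesis by simp
  qed
  have "Ex (Y q T) \<le> k1 + k2 * ln S + k * (2 * ln (1 + B / b0) + ln S / 3)"
  proof -
    have "Ex (\<lambda>s. gr (1/4) (A s (Suc T))) \<le> ln S"
      unfolding gr_def S_def by simp (rule Ex_ln_le[of "Suc T"], auto intro: adapted_A A_ge_1 Ex_A_le_S)
    then have "k2 * Ex (\<lambda>s. gr (1/4) (A s (Suc T))) \<le> k2 * ln S" using kk by (intro mult_left_mono) auto
    moreover have "k * Ex (V (1/4) T) \<le> k * (2 * ln (1 + B / b0) + ln S / 3)"
      using EV k0 unfolding q14 by (intro mult_left_mono) auto
    moreover have "3 * (1 + 2 * (1/4)\<^sup>2) / (1/4)\<^sup>2 = (54::real)" by (simp add: power2_eq_square)
    ultimately show ?thesis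
      using Ex_Y[of "1/4" T] unfolding q14 k1_def[symmetric] k2_def[symmetric] k_def by simp
  qed
  then have "Ex (Y q T) \<le> 3 * B\<^sup>2" using hb by linarith
  from Ex_etot[OF this] show ?thesis using B0 unfolding B_def p2 by simp
qed

section \<open>From error and direction sums to the gradient sum\<close>

lemma gradient_sum_le:
  "(\<Sum>t=1..T. (norm (gF (X s t)))\<^sup>2) powr r \<le> 2 powr r * etot T s powr r + 2 powr r * dsum s T powr r"
proof -
  have "(\<Sum>t=1..T. (norm (gF (X s t)))\<^sup>2) \<le> (\<Sum>t=1..T. 2 * (norm (err s t))\<^sup>2 + 2 * (norm (d s t))\<^sup>2)"
  proof (rule sum_mono)
    fix t
    have "norm (gF (X s t)) \<le> norm (err s t) + norm (d s t)"
      unfolding err_def using norm_triangle_ineq4[of "d s t" "d s t - gF (X s t)"] by (simp add: add.commute)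
    then have "(norm (gF (X s t)))\<^sup>2 \<le> (norm (err s t) + norm (d s t))\<^sup>2" by (intro power_mono) auto
    also have "\<dots> \<le> 2 * (norm (err s t))\<^sup>2 + 2 * (norm (d s t))\<^sup>2"
      using zero_le_power2[of "norm (err s t) - norm (d s t)"] by (simp add: power2_eq_square algebra_simps)
    finally show "(norm (gF (X s t)))\<^sup>2 \<le> 2 * (norm (err s t))\<^sup>2 + 2 * (norm (d s t))\<^sup>2" .
  qed
  also have "\<dots> = 2 * etot T s + 2 * dsum s T"
    unfolding etot_def dsum_def by (simp only: sum.distrib sum_distrib_left)
  finally have "(\<Sum>t=1..T. (norm (gF (X s t)))\<^sup>2) powr r \<le> (2 * etot T s + 2 * dsum s T) powr r"
    using r_bounds(1) by (intro powr_mono2 sum_nonneg) auto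
  also have "\<dots> \<le> (2 * etot T s) powr r + (2 * dsum s T) powr r"
    using r_bounds(1,2) etot_nonneg dsum_nonneg by (intro powr_add_le) auto
  finally show ?thesis unfolding powr_mult .
qed

lemma adapted_gradient_sum: "adapted (Suc T) (\<lambda>s. (\<Sum>t=1..T. (norm (gF (X s t)))\<^sup>2) powr r)"
  using r_bounds(1) by (intro adapted_powr_nonneg adapted_intros sum_nonneg) auto

lemma A_T_nonneg: "0 \<le> A_T a0 b0 \<eta> \<sigma> sh \<beta> p q T"
  unfolding A_T_def Let_def by simp

text \<open>For \<open>p < 1/2\<close> the larger of the two means is bounded, by \<open>A_T\<close>
  if it is the error and by \<open>B\<close> if it is the direction sum; doubling for the smaller
  one and \<open>2 powr r \<le> 2\<close> give the factor 4. For \<open>p = 1/2\<close> both means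
  are bounded by multiples of \<open>B\<close>, and \<open>6 powr r \<le> 5/2\<close> and
  \<open>2 powr r \<le> 3/2\<close> add up to 4.\<close>

lemma Ex_gradient_sum:
  assumes p1: "(3 - sqrt 7) / 2 \<le> p" and lam: "0 < lam" and \<beta>0: "p \<noteq> 1/2 \<Longrightarrow> 0 < \<beta>"
  shows "Ex (\<lambda>s. (\<Sum>t=1..T. (norm (gF (X s t)))\<^sup>2) powr r)
    \<le> storm_bound a0 b0 \<eta> \<sigma> sh \<beta> p q lam (F x1 - Fstar) T"
proof -
  define B where "B = B2 lam T powr (r / (1 - p)) * S_T a0 \<sigma> T powr (r / 3)"
  have bound: "storm_bound a0 b0 \<eta> \<sigma> sh \<beta> p q lam (F x1 - Fstar) T = 4 * A_T a0 b0 \<eta> \<sigma> sh \<beta> p q T + 4 * B"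
    unfolding storm_bound_def Let_def B_def B2_def Q_def by simp
  have B0: "0 \<le> B" unfolding B_def by simp
  note A0 = A_T_nonneg[of T]
  show ?thesis
  proof (cases "1 \<le> T")
    case False
    then have "Ex (\<lambda>s. (\<Sum>t=1..T. (norm (gF (X s t)))\<^sup>2) powr r) = 0" by (simp add: Ex_const)
    then show ?thesis unfolding bound using A0 B0 by simp
  next
    case T: True
    define x where "x = Ex (\<lambda>s. etot T s powr r)"
    define y where "y = Ex (\<lambda>s. dsum s T powr r)"
    have adds: "adapted (Suc T) (\<lambda>s. dsum s T powr r)" using r_bounds(1) by (intro adapted_dsum_powr) auto
    have "Ex (\<lambda>s. (\<Sum>t=1..T. (norm (gF (X s t)))\<^sup>2) powr r) \<le> Ex (\<lambda>s. 2 powr r * etot T s powr r + 2 powr r * dsum s T powr r)"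
      by (rule Ex_mono[OF adapted_gradient_sum _ gradient_sum_le]) (intro adapted_add adapted_mult adapted_const adapted_etot adds)
    also have "\<dots> = 2 powr r * x + 2 powr r * y"
      unfolding x_def y_def by (simp only: Ex_add[of "Suc T"] adapted_mult adapted_const adapted_etot adds Ex_cmult)
    finally have H: "Ex (\<lambda>s. (\<Sum>t=1..T. (norm (gF (X s t)))\<^sup>2) powr r) \<le> 2 powr r * x + 2 powr r * y" .
    have y: "y \<le> B" unfolding y_def B_def by (rule Ex_dsum[OF lam T])
    have y0: "0 \<le> y" unfolding y_def by (intro Ex_nonneg) auto
    show ?thesis
    proof (cases "p = 1/2")
      case True
      have r37: "r = 3/7" unfolding phat_def True by simp
      have h: "1 - p = 1/2" unfolding True by simp
      have BB: "B = B2 lam T powr (2*r) * S_T a0 \<sigma> T powr (r/3)" unfolding B_def h by (simp add: mult.commute)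
      have "(3 * (B2 lam T)\<^sup>2) powr r = 3 powr r * ((B2 lam T) powr 2) powr r"
        using B2_pos[OF lam, of T] by (simp add: powr_mult)
      also have "\<dots> = 3 powr r * B2 lam T powr (2*r)" by (simp only: powr_powr)
      finally have x3: "x \<le> 3 powr r * B"
        using Ex_error_half[OF True lam T] unfolding x_def BB by simp
      have "2 powr r * x \<le> 2 powr r * (3 powr r * B)" using x3 by (intro mult_left_mono) auto
      also have "\<dots> = 6 powr r * B" using powr_mult[of 2 3 r] by simp
      also have "\<dots> \<le> 5/2 * B"
      proof (intro mult_right_mono B0)
        have "6 powr r \<le> (6::real) powr (1/2)" unfolding r37 by (intro powr_mono) auto
        also have "\<dots> = sqrt 6" by (simp add: powr_half_sqrt)
        also have "\<dots> \<le> 5/2" by (rule real_le_lsqrt) (auto simp: power2_eq_square)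
        finally show "6 powr r \<le> (5/2::real)" .
      qed
      finally have 1: "2 powr r * x \<le> 5/2 * B" .
      have "2 powr r \<le> (2::real) powr (1/2)" unfolding r37 by (intro powr_mono) auto
      also have "\<dots> = sqrt 2" by (simp add: powr_half_sqrt)
      also have "\<dots> \<le> 3/2" by (rule real_le_lsqrt) (auto simp: power2_eq_square)
      finally have "2 powr r * y \<le> 3/2 * B" using y y0 by (intro mult_mono) auto
      then show ?thesis using H 1 A0 unfolding bound by linarith
    next
      case False
      then have p2: "p < 1/2" using p by simp
      have two: "2 powr r \<le> (2::real)"
      proof -
        have "2 powr r \<le> (2::real) powr 1" using r_bounds(2) by (intro powr_mono) auto
        then show ?thesis by simp
      qed
      have "2 powr r * x + 2 powr r * y \<le> 2 * (x + y)"
      proof -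
        have "2 powr r * (x + y) \<le> 2 * (x + y)"
          using two y0 Ex_nonneg[of "\<lambda>s. etot T s powr r"] unfolding x_def by (intro mult_right_mono) auto
        then show ?thesis by (simp add: distrib_left)
      qed
      then have "Ex (\<lambda>s. (\<Sum>t=1..T. (norm (gF (X s t)))\<^sup>2) powr r) \<le> 2 * (x + y)" by (rule order_trans[OF H])
      moreover have "x + y \<le> 2 * A_T a0 b0 \<eta> \<sigma> sh \<beta> p q T + 2 * B"
      proof (cases "y \<le> x")
        case True
        then have "x \<le> A_T a0 b0 \<eta> \<sigma> sh \<beta> p q T"
          using Ex_error_less[OF p1 p2 \<beta>0[OF False], of T] unfolding x_def y_def by simp
        then show ?thesis using True B0 by linarith
      next
        case False
        then show ?thesis using y A0 by linarith
      qed
      then have "2 * (x + y) \<le> 4 * A_T a0 b0 \<eta> \<sigma> sh \<beta> p q T + 4 * B" by simp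
      ultimately show ?thesis unfolding bound by (rule order_trans)
    qed
  qed
qed

end

section \<open>Joint measurability of gradients\<close>

lemma GDERIV_unique:
  assumes "GDERIV h x :> g" "GDERIV h x :> g'"
  shows "g = g'"
proof -
  have "(\<lambda>y. y \<bullet> g) = (\<lambda>y. y \<bullet> g')"
    using assms unfolding gderiv_def by (rule has_derivative_unique)
  then have "(g - g') \<bullet> g = (g - g') \<bullet> g'" by (rule fun_cong)
  then have "(g - g') \<bullet> (g - g') = 0" by (simp only: inner_diff_right)
  then show ?thesis by simp
qed

lemma grad_eq: "GDERIV h x :> g \<Longrightarrow> grad h x = g"
  unfolding grad_def by (rule the_equality) (auto intro: GDERIV_unique)

lemma GDERIV_grad:
  fixes h :: "'a::euclidean_space \<Rightarrow> real"
  assumes "h differentiable (at x)"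
  shows "GDERIV h x :> grad h x"
proof -
  obtain h' where h': "(h has_derivative h') (at x)" using assms unfolding differentiable_def by auto
  define g where "g = (\<Sum>b\<in>Basis. h' b *\<^sub>R b)"
  interpret bounded_linear h' using h' by (rule has_derivative_bounded_linear)
  have "h' y = y \<bullet> g" for y
  proof -
    have "h' y = h' (\<Sum>b\<in>Basis. (y \<bullet> b) *\<^sub>R b)" by (simp add: euclidean_representation)
    also have "\<dots> = (\<Sum>b\<in>Basis. (y \<bullet> b) * h' b)" by (simp add: sum scaleR)
    also have "\<dots> = y \<bullet> g" unfolding g_def by (simp add: inner_sum_right mult.commute)
    finally show ?thesis .
  qed
  then have "h' = (\<lambda>y. y \<bullet> g)" by (rule ext)
  then have "GDERIV h x :> g" using h' unfolding gderiv_def by simp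
  then show ?thesis using grad_eq by metis
qed

text \<open>The first argument is approximated by simple functions, for which joint measurability
  reduces to finitely many sections; continuity passes it to the limit.\<close>

lemma caratheodory_measurable:
  fixes g :: "'a::euclidean_space \<Rightarrow> 'b \<Rightarrow> real"
  assumes cont: "\<And>y. y \<in> space D \<Longrightarrow> continuous_on UNIV (\<lambda>x. g x y)" and meas: "\<And>x. g x \<in> borel_measurable D"
  shows "(\<lambda>(x, y). g x y) \<in> borel_measurable (borel \<Otimes>\<^sub>M D)"
proof -
  have "(\<lambda>x::'a. x) \<in> borel_measurable borel" by simp
  from borel_measurable_implies_sequence_metric[OF this, of 0]
  obtain S where S: "\<And>i. simple_function borel (S i)" "\<And>x. (\<lambda>i. S i x) \<longlonglongrightarrow> (x::'a)"
    by auto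
  show ?thesis
  proof (rule borel_measurable_LIMSEQ_metric)
    fix i
    have fin: "finite (range (S i))" using simple_functionD(1)[OF S(1)[of i]] by simp
    have "(\<lambda>z. S i (fst z)) \<in> measurable (borel \<Otimes>\<^sub>M D) (count_space (range (S i)))"
    proof (rule measurable_compose[OF measurable_fst])
      show "S i \<in> measurable borel (count_space (range (S i)))"
        unfolding measurable_count_space_eq2[OF fin] using simple_functionD(2)[OF S(1)[of i]] by auto
    qed
    then have "(\<lambda>z. g (S i (fst z)) (snd z)) \<in> borel_measurable (borel \<Otimes>\<^sub>M D)"
      by (rule measurable_compose_countable'[where f = "\<lambda>x z. g x (snd z)", rotated])
        (use fin meas in \<open>auto intro: countable_finite measurable_compose[OF measurable_snd]\<close>)
    then show "(\<lambda>(x, y). g (S i x) y) \<in> borel_measurable (borel \<Otimes>\<^sub>M D)"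
      by (simp add: case_prod_beta')
  next
    fix z :: "'a \<times> 'b" assume "z \<in> space (borel \<Otimes>\<^sub>M D)"
    then have y: "snd z \<in> space D" by (auto simp: space_pair_measure)
    have "isCont (\<lambda>x. g x (snd z)) (fst z)" using cont[OF y] by (simp add: continuous_on_eq_continuous_at)
    then have "(\<lambda>i. g (S i (fst z)) (snd z)) \<longlonglongrightarrow> g (fst z) (snd z)"
      using S(2) by (rule isCont_tendsto_compose)
    then show "(\<lambda>i. case z of (x, y) \<Rightarrow> g (S i x) y) \<longlonglongrightarrow> (case z of (x, y) \<Rightarrow> g x y)"
      by (simp add: case_prod_beta')
  qed
qed

text \<open>Each component is a limit of difference quotients with increments
  \<open>1/(n + 1)\<close>, jointly measurable by \<open>caratheodory_measurable\<close>. The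
  iterates insert a random point into the gradient, so measurability in the sample alone would not
  do.\<close>

lemma gradient_jointly_measurable:
  fixes g :: "'a::euclidean_space \<Rightarrow> 'b \<Rightarrow> real"
  assumes diff: "\<And>x y. y \<in> space D \<Longrightarrow> (\<lambda>x. g x y) differentiable (at x)" and meas: "\<And>x. g x \<in> borel_measurable D"
  shows "(\<lambda>(x, y). sgrad g x y) \<in> borel_measurable (borel \<Otimes>\<^sub>M D)"
proof -
  have cont: "continuous_on UNIV (\<lambda>x. g x y)" if "y \<in> space D" for y
    using diff[OF that] by (auto simp: continuous_on_eq_continuous_at intro: differentiable_imp_continuous_within)
  note joint = caratheodory_measurable[OF cont meas]
  have shift: "(\<lambda>z. g (fst z + c) (snd z)) \<in> borel_measurable (borel \<Otimes>\<^sub>M D)" for c :: 'a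
  proof -
    have "(\<lambda>z. (fst z + c, snd z)) \<in> measurable (borel \<Otimes>\<^sub>M D) (borel \<Otimes>\<^sub>M D)" by measurable
    from measurable_compose[OF this joint] show ?thesis by simp
  qed
  have comp: "(\<lambda>z. sgrad g (fst z) (snd z) \<bullet> b) \<in> borel_measurable (borel \<Otimes>\<^sub>M D)" for b :: 'a
  proof (rule borel_measurable_LIMSEQ_real)
    show "(\<lambda>z. (g (fst z + inverse (real (Suc n)) *\<^sub>R b) (snd z) - g (fst z + 0) (snd z)) / inverse (real (Suc n)))
       \<in> borel_measurable (borel \<Otimes>\<^sub>M D)" for n
      by (intro borel_measurable_divide borel_measurable_diff shift borel_measurable_const)
    fix z :: "'a \<times> 'b" assume "z \<in> space (borel \<Otimes>\<^sub>M D)"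
    then have y: "snd z \<in> space D" by (auto simp: space_pair_measure)
    let ?x = "fst z" and ?y = "snd z"
    have "((\<lambda>x. g x ?y) has_derivative (\<lambda>h. h \<bullet> sgrad g ?x ?y)) (at (?x + 0 *\<^sub>R b))"
      using GDERIV_grad[OF diff[OF y]] unfolding gderiv_def sgrad_def by simp
    moreover have "((\<lambda>u. ?x + u *\<^sub>R b) has_derivative (\<lambda>h. h *\<^sub>R b)) (at (0::real))"
      by (auto intro!: derivative_eq_intros)
    ultimately have "((\<lambda>u. g (?x + u *\<^sub>R b) ?y) has_derivative (\<lambda>h. (h *\<^sub>R b) \<bullet> sgrad g ?x ?y)) (at 0)"
      using has_derivative_compose by blast
    then have "((\<lambda>u. g (?x + u *\<^sub>R b) ?y) has_real_derivative (b \<bullet> sgrad g ?x ?y)) (at 0)"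
      by (simp add: has_field_derivative_def mult_commute_abs)
    then have "((\<lambda>u. (g (?x + u *\<^sub>R b) ?y - g (?x + 0) ?y) / u) \<longlongrightarrow> b \<bullet> sgrad g ?x ?y) (at 0)"
      by (simp add: DERIV_def)
    moreover have "filterlim (\<lambda>n. inverse (real (Suc n))) (at 0) sequentially"
      unfolding filterlim_at using LIMSEQ_inverse_real_of_nat by auto
    ultimately show "(\<lambda>n. (g (?x + inverse (real (Suc n)) *\<^sub>R b) ?y - g (?x + 0) ?y) / inverse (real (Suc n)))
        \<longlonglongrightarrow> sgrad g ?x ?y \<bullet> b"
      unfolding inner_commute[of "sgrad g ?x ?y"] by (rule filterlim_compose)
  qed
  show ?thesis
    unfolding case_prod_beta' by (subst borel_measurable_euclidean_space) (auto intro: comp)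
qed

text \<open>The algorithm sees \<open>G\<close> only through its values at samples with positive
  index, so a gradient altered on a null set yields the same trajectory almost surely.\<close>

lemma storm_cong:
  assumes G: "\<And>x i. 1 \<le> i \<Longrightarrow> G x (s i) = G' x (s' i)"
  shows "storm_x G x1 a0 b0 \<eta> p q s t = storm_x G' x1 a0 b0 \<eta> p q s' t \<and>
    storm_d G x1 a0 b0 \<eta> p q s t = storm_d G' x1 a0 b0 \<eta> p q s' t \<and>
    storm_a G x1 a0 b0 \<eta> p q s t = storm_a G' x1 a0 b0 \<eta> p q s' t \<and>
    storm_b G x1 a0 b0 \<eta> p q s t = storm_b G' x1 a0 b0 \<eta> p q s' t"
proof (induction t rule: less_induct)
  case (less t)
  have IH: "storm_x G x1 a0 b0 \<eta> p q s i = storm_x G' x1 a0 b0 \<eta> p q s' i"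
    "storm_d G x1 a0 b0 \<eta> p q s i = storm_d G' x1 a0 b0 \<eta> p q s' i"
    "storm_b G x1 a0 b0 \<eta> p q s i = storm_b G' x1 a0 b0 \<eta> p q s' i" if "i < t" for i
    using less that by auto
  have a: "storm_a G x1 a0 b0 \<eta> p q s t = storm_a G' x1 a0 b0 \<eta> p q s' t"
  proof (cases "2 \<le> t")
    case True
    then obtain n where n: "t = Suc (Suc n)" by (metis add_2_eq_Suc le_Suc_ex)
    have "(norm (G (storm_x G x1 a0 b0 \<eta> p q s i) (s i) - G (storm_x G x1 a0 b0 \<eta> p q s i) (s (Suc i))))\<^sup>2
      = (norm (G' (storm_x G' x1 a0 b0 \<eta> p q s' i) (s' i) - G' (storm_x G' x1 a0 b0 \<eta> p q s' i) (s' (Suc i))))\<^sup>2"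
      if "i \<in> {1..Suc n}" for i
      using IH(1)[of i] that n G by simp
    then show ?thesis unfolding n storm_a.simps by simp
  next
    case False
    then have "t = 0 \<or> t = Suc 0" by auto
    then show ?thesis by auto
  qed
  have x: "storm_x G x1 a0 b0 \<eta> p q s t = storm_x G' x1 a0 b0 \<eta> p q s' t"
  proof (cases "2 \<le> t")
    case True
    then obtain n where n: "t = Suc (Suc n)" by (metis add_2_eq_Suc le_Suc_ex)
    show ?thesis unfolding n storm_x.simps using IH[of "Suc n"] n by simp
  next
    case False
    then have "t = 0 \<or> t = Suc 0" by auto
    then show ?thesis by auto
  qed
  have d: "storm_d G x1 a0 b0 \<eta> p q s t = storm_d G' x1 a0 b0 \<eta> p q s' t"
  proof (cases "2 \<le> t")
    case True
    then obtain n where n: "t = Suc (Suc n)" by (metis add_2_eq_Suc le_Suc_ex)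
    show ?thesis unfolding n storm_d.simps using IH[of "Suc n"] a x n G by simp
  next
    case False
    then have "t = 0 \<or> t = Suc 0" by auto
    then show ?thesis using G by auto
  qed
  have "storm_d G x1 a0 b0 \<eta> p q s i = storm_d G' x1 a0 b0 \<eta> p q s' i" if "i \<in> {1..t}" for i
    using that IH(2)[of i] d by (cases "i = t") auto
  then have "storm_b G x1 a0 b0 \<eta> p q s t = storm_b G' x1 a0 b0 \<eta> p q s' t"
    unfolding storm_b.simps a by simp
  then show ?case using x d a by simp
qed

text \<open>The locale is instantiated with the gradients of \<open>g x y = f x (h y)\<close>, which
  agree with those of \<open>f\<close> almost everywhere. The functional estimated there is bounded
  and nonnegative, so its Bochner and nonnegative integrals coincide.\<close>

lemma expected_grad_norm_le:
  fixes M :: "'w measure" and D :: "'b measure" and f :: "'a::euclidean_space \<Rightarrow> 'b \<Rightarrow> real"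
  assumes pos: "a0 > 0" "b0 > 0" "\<eta> > 0" "lam > 0"
    and p: "(3 - sqrt 7) / 2 \<le> p" "p \<le> 1/2" and pq: "p + 2 * q = 1"
    and st: "storm_assumptions M \<xi> D \<Xi> f \<sigma> \<sigma>h \<beta>" and \<beta>: "p \<noteq> 1/2 \<longrightarrow> \<beta> > 0"
  shows "expected_grad_norm M \<xi> D f x1 a0 b0 \<eta> p q T
     \<le> ennreal (storm_bound a0 b0 \<eta> \<sigma> \<sigma>h \<beta> p q lam (objective D f x1 - opt_value D f) T)"
proof -
  have D: "prob_space D" and \<Xi>: "\<Xi> \<in> sets D" "AE y in D. y \<in> \<Xi>"
    and fd: "\<And>y x. y \<in> \<Xi> \<Longrightarrow> (\<lambda>z. f z y) differentiable (at x)" and fi: "\<And>x. integrable D (f x)"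
    and Fd: "\<And>x. objective D f differentiable (at x)"
    using st unfolding storm_assumptions_def stochastic_objective_def supported_on_def by auto
  have ub: "\<And>x. integrable D (sgrad f x)" "\<And>x. (\<integral>y. sgrad f x y \<partial>D) = grad (objective D f) x"
    "\<And>x. (\<integral>y. (norm (sgrad f x y - grad (objective D f) x))\<^sup>2 \<partial>D) \<le> \<sigma>\<^sup>2"
    using st unfolding storm_assumptions_def unbiased_bounded_variance_def by auto
  have sm: "\<And>x z. (\<integral>y. (norm (sgrad f x y - sgrad f z y))\<^sup>2 \<partial>D) \<le> \<beta>\<^sup>2 * (norm (x - z))\<^sup>2"
    using st unfolding storm_assumptions_def mean_square_smooth_def by auto
  have bd: "\<And>x y y'. y \<in> \<Xi> \<Longrightarrow> y' \<in> \<Xi> \<Longrightarrow> norm (sgrad f x y - sgrad f x y') \<le> 2 * \<sigma>h"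
    using st unfolding storm_assumptions_def bounded_gradient_differences_def by auto
  have nn: "0 \<le> \<sigma>" "0 \<le> \<beta>" "0 \<le> \<sigma>h" and bb: "bdd_below (range (objective D f))"
    using st unfolding storm_assumptions_def bounded_below_def by auto
  have M: "prob_space M" and ind: "prob_space.indep_vars M (\<lambda>_. D) \<xi> {1..}" and law: "\<And>t. 1 \<le> t \<Longrightarrow> distr M D (\<xi> t) = D"
    using st unfolding storm_assumptions_def iid_samples_def by auto
  interpret M: prob_space M by (rule M)
  interpret D: prob_space D by (rule D)
  have "\<Xi> \<noteq> {}"
  proof
    assume "\<Xi> = {}"
    then have "AE y in D. False" using \<Xi>(2) by simp
    then show False by (rule D.AE_False[THEN iffD1])
  qed
  then obtain y0 where y0: "y0 \<in> \<Xi>" by auto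
  \<comment> \<open>nothing is known outside \<open>\<Xi>\<close>, so those samples are replaced by a fixed point of \<open>\<Xi>\<close>\<close>
  define h where "h y = (if y \<in> \<Xi> then y else y0)" for y
  have h\<Xi>: "h y \<in> \<Xi>" for y unfolding h_def using y0 by simp
  have hm: "h \<in> measurable D D"
    unfolding h_def using \<Xi>(1) y0 sets.sets_into_space[OF \<Xi>(1)] by (intro measurable_If_set measurable_ident_sets measurable_const) auto
  define g where "g x y = f x (h y)" for x y
  have gG: "sgrad g x y = sgrad f x (h y)" for x y unfolding sgrad_def g_def ..
  have Gm: "(\<lambda>(x, y). sgrad g x y) \<in> borel_measurable (borel \<Otimes>\<^sub>M D)"
  proof (rule gradient_jointly_measurable)
    show "(\<lambda>x. g x y) differentiable (at x)" for x y unfolding g_def by (rule fd[OF h\<Xi>])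
    show "g x \<in> borel_measurable D" for x
      unfolding g_def using measurable_compose[OF hm borel_measurable_integrable[OF fi]] .
  qed
  have Gx: "sgrad g x \<in> borel_measurable D" for x
    using measurable_compose[OF measurable_Pair1' Gm, of x] by simp
  have fx [measurable]: "sgrad f x \<in> borel_measurable D" for x using ub(1) by (rule borel_measurable_integrable)
  note Gx [measurable]
  have AEg: "AE y in D. sgrad g x y = sgrad f x y" for x
    using \<Xi>(2) by eventually_elim (simp add: gG h_def)
  interpret S: storm_process M D \<xi> "sgrad g" "grad (objective D f)" "objective D f" x1 \<sigma> \<sigma>h \<beta> a0 b0 \<eta> p q "opt_value D f"
  proof
    show "norm (sgrad g x y - sgrad g x y') \<le> 2 * \<sigma>h" for x y y' unfolding gG by (intro bd h\<Xi>)
    show "(\<integral>y. sgrad g x y \<partial>D) = grad (objective D f) x" for x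
      unfolding ub(2)[symmetric] by (intro integral_cong_AE AEg) measurable
    have "(\<integral>y. (norm (sgrad g x y - grad (objective D f) x))\<^sup>2 \<partial>D) = (\<integral>y. (norm (sgrad f x y - grad (objective D f) x))\<^sup>2 \<partial>D)" for x
    proof (rule integral_cong_AE)
      show "AE y in D. (norm (sgrad g x y - grad (objective D f) x))\<^sup>2 = (norm (sgrad f x y - grad (objective D f) x))\<^sup>2"
        using AEg[of x] by eventually_elim simp
    qed measurable
    then show "(\<integral>y. (norm (sgrad g x y - grad (objective D f) x))\<^sup>2 \<partial>D) \<le> \<sigma>\<^sup>2" for x using ub(3) by simp
    have "(\<integral>y. (norm (sgrad g x y - sgrad g z y))\<^sup>2 \<partial>D) = (\<integral>y. (norm (sgrad f x y - sgrad f z y))\<^sup>2 \<partial>D)" for x z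
    proof (rule integral_cong_AE)
      show "AE y in D. (norm (sgrad g x y - sgrad g z y))\<^sup>2 = (norm (sgrad f x y - sgrad f z y))\<^sup>2"
        using AEg[of x] AEg[of z] by eventually_elim simp
    qed measurable
    then show "(\<integral>y. (norm (sgrad g x y - sgrad g z y))\<^sup>2 \<partial>D) \<le> \<beta>\<^sup>2 * (norm (x - z))\<^sup>2" for x z using sm by simp
    show "GDERIV (objective D f) x :> grad (objective D f) x" for x by (rule GDERIV_grad[OF Fd])
    show "opt_value D f \<le> objective D f x" for x unfolding opt_value_def by (rule cINF_lower[OF bb]) simp
    show "0 < p" by (rule phat_ge(1)[OF p])
  qed (use ind law Gm pos p pq nn in auto)
  let ?H = "\<lambda>s. (\<Sum>t=1..T. (norm (grad (objective D f) (storm_x (sgrad g) x1 a0 b0 \<eta> p q s t)))\<^sup>2) powr phat p"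
  have "AE \<omega> in M. \<xi> (Suc t) \<omega> \<in> \<Xi>" for t
  proof -
    have l: "distr M D (\<xi> (Suc t)) = D" by (rule law) simp
    have "AE y in distr M D (\<xi> (Suc t)). y \<in> \<Xi>" unfolding l by (rule \<Xi>(2))
    then show ?thesis using S.\<xi>_rv[of "Suc t"] \<Xi>(1) by (subst (asm) AE_distr_iff) auto
  qed
  then have "AE \<omega> in M. \<forall>t. \<xi> (Suc t) \<omega> \<in> \<Xi>" by (simp add: AE_all_countable)
  then have AEx: "AE \<omega> in M. grad_norm_sum D f x1 a0 b0 \<eta> p q (\<lambda>t. \<xi> t \<omega>) T powr phat p = ?H (\<lambda>i. \<xi> i \<omega>)"
  proof eventually_elim
    case (elim \<omega>)
    have "sgrad f x (\<xi> i \<omega>) = sgrad g x (\<xi> i \<omega>)" if "1 \<le> i" for x i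
      using elim[rule_format, of "i - 1"] that by (simp add: gG h_def)
    from storm_cong[of "sgrad f" "\<lambda>i. \<xi> i \<omega>" "sgrad g" "\<lambda>i. \<xi> i \<omega>", OF this]
    show ?case unfolding grad_norm_sum_def by simp
  qed
  have "expected_grad_norm M \<xi> D f x1 a0 b0 \<eta> p q T = (\<integral>\<^sup>+\<omega>. ennreal (?H (\<lambda>i. \<xi> i \<omega>)) \<partial>M)"
    unfolding expected_grad_norm_def by (rule nn_integral_cong_AE) (use AEx in eventually_elim, simp)
  also have "\<dots> = ennreal (S.Ex ?H)"
    unfolding S.Ex_def by (intro nn_integral_eq_integral S.adapted_integrable[OF S.adapted_gradient_sum]) simp
  also have "\<dots> \<le> ennreal (storm_bound a0 b0 \<eta> \<sigma> \<sigma>h \<beta> p q lam (objective D f x1 - opt_value D f) T)"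
    by (intro ennreal_leI S.Ex_gradient_sum p pos) (use \<beta> in auto)
  finally show ?thesis .
qed

section \<open>The asymptotic rate\<close>

text \<open>\<open>powr\<close> takes the power of the absolute value of a negative base. The bases
  in the bounds contain logarithms of either sign, so it is their absolute values that get
  estimated.\<close>

lemma powr_le_of_abs_le:
  fixes x y e :: real
  assumes "\<bar>x\<bar> \<le> y" "0 \<le> e"
  shows "x powr e \<le> y powr e"
proof -
  have "x powr e = \<bar>x\<bar> powr e" using uminus_powr_eq[of x e] by (simp add: abs_if)
  then show ?thesis using assms by (simp add: powr_mono2)
qed

text \<open>Constants and multiples of \<open>P\<close> are absorbed into \<open>P * l\<close> at
  the price of a factor \<open>1 / l0\<close>; for this the logarithm of \<open>\<beta>\<close> must
  stay away from 0.\<close>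

lemma linear_in_logs:
  fixes c1 c3 c4 c5 cs c0 P l l0 v :: real
  assumes c: "0 \<le> c1" "0 \<le> c3" "0 \<le> c4" "0 \<le> c5" "0 \<le> cs" "0 \<le> c0" and P: "1 \<le> P" and l: "0 < l0" "l0 \<le> l" and v: "0 \<le> v"
  shows "c1 + (c3 + c4 * P) * (cs + v) + c5 * P * (c0 + l)
    \<le> (c1 / l0 + (c3 + c4) * cs / l0 + c5 * c0 / l0 + c5 + (c3 + c4)) * (P * l + P * v)"
proof -
  have one: "1 \<le> l / l0" using l by simp
  have k: "k * P \<le> k / l0 * (P * l)" if "0 \<le> k" for k
  proof -
    have "k * P * 1 \<le> k * P * (l / l0)" using that P one by (intro mult_left_mono) auto
    then show ?thesis by (simp add: mult.commute mult.left_commute)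
  qed
  have Pv: "0 \<le> P * v" "0 \<le> P * l" using P v l by auto
  have "(c3 + c4 * P) * (cs + v) \<le> (c3 * P + c4 * P) * (cs + v)"
    using c P v mult_left_mono[of 1 P c3] by (intro mult_right_mono) auto
  also have "\<dots> = ((c3 + c4) * cs) * P + (c3 + c4) * (P * v)" by (simp add: algebra_simps)
  also have "\<dots> \<le> ((c3 + c4) * cs) / l0 * (P * l) + (c3 + c4) * (P * v)" using k[of "(c3 + c4) * cs"] c by simp
  finally have 1: "(c3 + c4 * P) * (cs + v) \<le> ((c3 + c4) * cs) / l0 * (P * l) + (c3 + c4) * (P * v)" .
  have "c1 \<le> c1 * P" using c P mult_left_mono[of 1 P c1] by simp
  then have 2: "c1 \<le> c1 / l0 * (P * l)" using k[of c1] c by linarith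
  have 3: "c5 * P * (c0 + l) \<le> c5 * c0 / l0 * (P * l) + c5 * (P * l)"
    using k[of "c5 * c0"] c by (simp add: algebra_simps)
  define x1 where "x1 = c1 / l0 + (c3 + c4) * cs / l0 + c5 * c0 / l0 + c5"
  have "0 \<le> x1" unfolding x1_def using c l by simp
  then have "0 \<le> x1 * (P * v)" "0 \<le> (c3 + c4) * (P * l)" using c Pv by auto
  moreover have "(x1 + (c3 + c4)) * (P * l + P * v) = x1 * (P * l) + x1 * (P * v) + (c3 + c4) * (P * l) + (c3 + c4) * (P * v)"
    by (simp add: algebra_simps)
  moreover have "x1 * (P * l) = c1 / l0 * (P * l) + ((c3 + c4) * cs) / l0 * (P * l) + c5 * c0 / l0 * (P * l) + c5 * (P * l)"
    unfolding x1_def by (simp add: distrib_right)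
  ultimately show ?thesis using 1 2 3 unfolding x1_def[symmetric] by linarith
qed

text \<open>The rate suppresses the growth of \<open>K1\<close> with \<open>\<sigma>\<close>; it
  enters the constant through an upper bound \<open>\<sigma>m\<close>.\<close>

lemma K1_mono:
  assumes "0 \<le> \<sigma>" "\<sigma> \<le> \<sigma>m"
  shows "K1 a0 \<sigma> \<sigma>h l \<le> K1 a0 \<sigma>m \<sigma>h l"
  unfolding K1_def using assms
  by (intro add_mono mult_left_mono divide_right_mono power_mono order_refl) auto

lemma S_T_le:
  assumes a0: "0 < a0"
  shows "S_T a0 \<sigma> T \<le> (1 + 2 / a0\<^sup>2) * (1 + \<sigma>\<^sup>2 * real T)"
    and "ln (S_T a0 \<sigma> T) \<le> ln (1 + 2 / a0\<^sup>2) + ln (1 + \<sigma>\<^sup>2 * real T)"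
    and "0 \<le> e \<Longrightarrow> S_T a0 \<sigma> T powr e \<le> (1 + 2 / a0\<^sup>2) powr e * (1 + \<sigma>\<^sup>2 * real T) powr e"
    and "1 \<le> S_T a0 \<sigma> T"
proof -
  have nn: "0 \<le> \<sigma>\<^sup>2 * real T" "0 \<le> 2 / a0\<^sup>2" using a0 by auto
  show 1: "S_T a0 \<sigma> T \<le> (1 + 2 / a0\<^sup>2) * (1 + \<sigma>\<^sup>2 * real T)"
    unfolding S_T_def using nn by (simp add: algebra_simps)
  show S: "1 \<le> S_T a0 \<sigma> T" unfolding S_T_def by simp
  have pos: "0 < 1 + 2 / a0\<^sup>2" "0 < 1 + \<sigma>\<^sup>2 * real T" using nn by linarith+
  have "ln (S_T a0 \<sigma> T) \<le> ln ((1 + 2 / a0\<^sup>2) * (1 + \<sigma>\<^sup>2 * real T))"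
    using 1 S by (intro ln_mono) auto
  also have "\<dots> = ln (1 + 2 / a0\<^sup>2) + ln (1 + \<sigma>\<^sup>2 * real T)" using pos by (intro ln_mult_pos)
  finally show "ln (S_T a0 \<sigma> T) \<le> ln (1 + 2 / a0\<^sup>2) + ln (1 + \<sigma>\<^sup>2 * real T)" .
  show "S_T a0 \<sigma> T powr e \<le> (1 + 2 / a0\<^sup>2) powr e * (1 + \<sigma>\<^sup>2 * real T) powr e" if "0 \<le> e"
    unfolding powr_mult[symmetric] using 1 S that by (intro powr_mono2) auto
qed

context
  fixes a0 b0 \<eta> p q lam \<sigma>h \<beta>0 \<sigma>m :: real
  assumes a0: "0 < a0" and b0: "0 < b0" and \<eta>: "0 < \<eta>" and lam: "0 < lam" and p: "0 < p" "p \<le> 1/2" and pq: "p + 2 * q = 1"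
    and \<beta>0: "1 < \<beta>0"
begin

definition rate :: "real \<Rightarrow> real \<Rightarrow> real \<Rightarrow> real" where
  "rate \<beta> \<Delta> V = \<Delta> powr (phat p / (1 - p)) + \<beta> powr (phat p / p) * ln \<beta> powr (phat p / (1 - p)) +
     \<beta> powr (phat p / p) * ln V powr (phat p / (1 - p))"

lemma storm_rate_eq: "storm_rate \<sigma> \<beta> p \<Delta> T = rate \<beta> \<Delta> (1 + \<sigma>\<^sup>2 * real T) * (1 + \<sigma>\<^sup>2 * real T) powr (phat p / 3)"
  unfolding storm_rate_def rate_def Let_def ..

text \<open>Since \<open>ln \<beta> \<ge> ln \<beta>0 > 0\<close>, the middle term of the rate
  dominates a positive multiple of \<open>\<beta> powr (phat p / p)\<close>; lower order terms are
  absorbed this way.\<close>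

lemma rate_ge_const:
  assumes \<beta>: "\<beta>0 \<le> \<beta>" and c: "0 \<le> c"
  shows "c * \<beta> powr (phat p / p) \<le> c / ln \<beta>0 powr (phat p / (1 - p)) * rate \<beta> \<Delta> V"
    and "c \<le> c / ln \<beta>0 powr (phat p / (1 - p)) * rate \<beta> \<Delta> V"
proof -
  define e where "e = phat p / (1 - p)"
  have e: "0 < e" unfolding e_def using phat_bounds[OF p] p by simp
  have l0: "0 < ln \<beta>0" "ln \<beta>0 \<le> ln \<beta>" using \<beta> \<beta>0 by auto
  have L: "0 < ln \<beta>0 powr e" using l0 by simp
  have Le: "ln \<beta>0 powr e \<le> ln \<beta> powr e" using l0 e by (intro powr_mono2) auto
  have B1: "1 \<le> \<beta> powr (phat p / p)" using \<beta> \<beta>0 phat_bounds[OF p] p by (intro ge_one_powr_ge_zero) auto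
  have "c * \<beta> powr (phat p / p) = c / ln \<beta>0 powr e * (\<beta> powr (phat p / p) * ln \<beta>0 powr e)"
    using L by simp
  also have "\<dots> \<le> c / ln \<beta>0 powr e * (\<beta> powr (phat p / p) * ln \<beta> powr e)"
    using Le c L by (intro mult_left_mono) auto
  also have "\<dots> \<le> c / ln \<beta>0 powr e * rate \<beta> \<Delta> V"
    unfolding rate_def e_def[symmetric] using c L by (intro mult_left_mono) auto
  finally show "c * \<beta> powr (phat p / p) \<le> c / ln \<beta>0 powr (phat p / (1 - p)) * rate \<beta> \<Delta> V" unfolding e_def .
  moreover have "c * 1 \<le> c * \<beta> powr (phat p / p)" using B1 c by (intro mult_left_mono) auto
  ultimately show "c \<le> c / ln \<beta>0 powr (phat p / (1 - p)) * rate \<beta> \<Delta> V" by simp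
qed

lemma rate_nonneg: "0 \<le> rate \<beta> \<Delta> V" unfolding rate_def by simp

text \<open>As \<open>\<beta>max \<beta> = \<beta>\<close> here, \<open>K8 + K9\<close> is a
  multiple of \<open>\<beta>\<close> and \<open>K7\<close> one of
  \<open>\<beta> powr (1/p - 1)\<close>, which the outer exponent turns into
  \<open>\<beta> powr (phat p / p)\<close>. That exponent is at most 1, so the power is subadditive
  over the three terms of the rate.\<close>

lemma potential_rate:
  "\<exists>C\<ge>0. \<forall>\<sigma> \<beta> \<Delta> T. 0 \<le> \<sigma> \<and> \<sigma> \<le> \<sigma>m \<and> \<beta>0 \<le> \<beta> \<and> 0 \<le> \<Delta> \<longrightarrow>
     (K5 a0 b0 \<eta> \<sigma> \<sigma>h \<beta> p lam \<Delta> + (K6 a0 \<eta> \<beta> lam + K7 a0 \<eta> \<sigma>h \<beta> p lam / 3) * ln (S_T a0 \<sigma> T)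
       + K7 a0 \<eta> \<sigma>h \<beta> p lam * ln ((K8 a0 \<eta> \<sigma>h \<beta> lam + K9 a0 \<eta> \<sigma>h \<beta> lam) / b0)) powr (phat p / (1 - p))
     \<le> C * rate \<beta> \<Delta> (1 + \<sigma>\<^sup>2 * real T)"
proof -
  define e where "e = phat p / (1 - p)"
  have e: "0 < e" "e \<le> 1" unfolding e_def phat_bounds(4)[OF p] using p by auto
  define c where "c = 1/p - 1"
  have c: "1 \<le> c" unfolding c_def using p by (simp add: field_simps)
  have ce: "c * e = phat p / p" unfolding c_def e_def using p by (simp add: field_simps)
  define qc where "qc = (1 + lam * K3 a0 \<sigma>h (1/4)) * \<eta> + (1 / lam + 2 * \<sigma>h powr (2/3) / (a0 powr (2/3) * lam) + 54 * lam) * \<eta>"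
  have K: "0 \<le> K1 a0 \<sigma>m \<sigma>h (1/4)" "0 < K2 a0 (1/4)" "0 \<le> K3 a0 \<sigma>h (1/4)" using K_nonneg[OF a0, of "1/4"] by auto
  have qc: "0 < qc" unfolding qc_def using K lam \<eta> by (intro add_pos_nonneg mult_pos_pos mult_nonneg_nonneg add_nonneg_nonneg) auto
  define k7 where "k7 = qc powr c / (1 - p)"
  have k7: "0 \<le> k7" unfolding k7_def using p by simp
  define cs where "cs = ln (1 + 2 / a0\<^sup>2)"
  have cs: "0 \<le> cs" unfolding cs_def by simp
  define c1 where "c1 = b0 powr c + lam * K1 a0 \<sigma>m \<sigma>h (1/4) / \<eta>"
  define c3 where "c3 = lam * K2 a0 (1/4) / \<eta>"
  define c0 where "c0 = \<bar>ln (qc / b0)\<bar>"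
  have nn: "0 \<le> c1" "0 \<le> c3" "0 \<le> c0" unfolding c1_def c3_def c0_def using lam K \<eta> by auto
  define l0 where "l0 = ln \<beta>0"
  have l0: "0 < l0" unfolding l0_def using \<beta>0 by simp
  define CC where "CC = c1 / l0 + (c3 + k7 / 3) * cs / l0 + k7 * c0 / l0 + k7 + (c3 + k7 / 3)"
  have CC: "0 \<le> CC" unfolding CC_def using nn k7 cs l0 by (intro add_nonneg_nonneg divide_nonneg_nonneg mult_nonneg_nonneg) auto
  show ?thesis
  proof (intro exI[of _ "(2 / \<eta> + CC) powr e"] conjI allI impI)
    fix \<sigma> \<beta> \<Delta> :: real and T :: nat
    assume H: "0 \<le> \<sigma> \<and> \<sigma> \<le> \<sigma>m \<and> \<beta>0 \<le> \<beta> \<and> 0 \<le> \<Delta>"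
    then have \<beta>1: "1 < \<beta>" and \<Delta>: "0 \<le> \<Delta>" using \<beta>0 by auto
    have \<beta>m: "\<beta>max \<beta> = \<beta>" unfolding \<beta>max_def using \<beta>1 by simp
    define V where "V = 1 + \<sigma>\<^sup>2 * real T"
    have V: "1 \<le> V" unfolding V_def by simp
    define P where "P = \<beta> powr c"
    have P: "1 \<le> P" unfolding P_def using \<beta>1 c by (intro ge_one_powr_ge_zero) auto
    have ll: "l0 \<le> ln \<beta>" unfolding l0_def using H \<beta>0 by simp
    have Q: "K8 a0 \<eta> \<sigma>h \<beta> lam + K9 a0 \<eta> \<sigma>h \<beta> lam = qc * \<beta>"
      unfolding K8_def K9_def qc_def \<beta>m by (simp add: algebra_simps)
    have K7: "K7 a0 \<eta> \<sigma>h \<beta> p lam = k7 * P"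
      unfolding K7_def Q k7_def P_def c_def by (simp add: powr_mult)
    have K6: "0 \<le> K6 a0 \<eta> \<beta> lam" "K6 a0 \<eta> \<beta> lam \<le> c3"
      unfolding K6_def c3_def \<beta>m using lam K \<eta> \<beta>1 by (auto intro!: divide_left_mono)
    have K1: "0 \<le> K1 a0 \<sigma> \<sigma>h (1/4)" "K1 a0 \<sigma> \<sigma>h (1/4) \<le> K1 a0 \<sigma>m \<sigma>h (1/4)"
      using K_nonneg(1)[OF a0, of "1/4"] K1_mono H by auto
    have "lam * K1 a0 \<sigma> \<sigma>h (1/4) / (\<eta> * \<beta>) \<le> lam * K1 a0 \<sigma>m \<sigma>h (1/4) / \<eta>"
      using lam K1 \<eta> \<beta>1 by (intro frac_le mult_left_mono) auto
    then have K5: "0 \<le> K5 a0 b0 \<eta> \<sigma> \<sigma>h \<beta> p lam \<Delta>" "K5 a0 b0 \<eta> \<sigma> \<sigma>h \<beta> p lam \<Delta> \<le> c1 + 2 / \<eta> * \<Delta>"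
      unfolding K5_def c1_def c_def \<beta>m using K1 lam \<eta> \<beta>1 \<Delta> by auto
    have lnS: "0 \<le> ln (S_T a0 \<sigma> T)" "ln (S_T a0 \<sigma> T) \<le> cs + ln V"
      using S_T_le(2,4)[OF a0, of \<sigma> T] unfolding cs_def V_def by auto
    have lnQ: "\<bar>ln (qc * \<beta> / b0)\<bar> \<le> c0 + ln \<beta>"
    proof -
      have "ln (qc * \<beta> / b0) = ln (qc / b0) + ln \<beta>"
        using qc \<beta>1 b0 ln_mult_pos[of "qc / b0" \<beta>] by simp
      moreover have "0 \<le> ln \<beta>" using \<beta>1 by simp
      ultimately show ?thesis unfolding c0_def by linarith
    qed
    let ?base = "K5 a0 b0 \<eta> \<sigma> \<sigma>h \<beta> p lam \<Delta> + (K6 a0 \<eta> \<beta> lam + K7 a0 \<eta> \<sigma>h \<beta> p lam / 3) * ln (S_T a0 \<sigma> T)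
       + K7 a0 \<eta> \<sigma>h \<beta> p lam * ln ((K8 a0 \<eta> \<sigma>h \<beta> lam + K9 a0 \<eta> \<sigma>h \<beta> lam) / b0)"
    have "\<bar>?base\<bar> \<le> (c1 + 2 / \<eta> * \<Delta>) + (c3 + k7 / 3 * P) * (cs + ln V) + k7 * P * (c0 + ln \<beta>)"
    proof -
      have 1: "(K6 a0 \<eta> \<beta> lam + k7 * P / 3) * ln (S_T a0 \<sigma> T) \<le> (c3 + k7 / 3 * P) * (cs + ln V)"
        using K6 lnS k7 P by (intro mult_mono) auto
      have 2: "\<bar>k7 * P * ln (qc * \<beta> / b0)\<bar> \<le> k7 * P * (c0 + ln \<beta>)"
        unfolding abs_mult using lnQ k7 P by (intro mult_mono) auto
      have 3: "0 \<le> (K6 a0 \<eta> \<beta> lam + k7 * P / 3) * ln (S_T a0 \<sigma> T)" using K6 k7 P lnS by simp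
      show ?thesis unfolding K7 Q using 1 2 3 K5 by linarith
    qed
    also have "\<dots> \<le> 2 / \<eta> * \<Delta> + CC * (P * ln \<beta> + P * ln V)"
      using linear_in_logs[OF nn(1,2) _ k7 cs nn(3) P l0 ll, of "k7/3" "ln V"] k7 V unfolding CC_def by simp
    also have "\<dots> \<le> (2 / \<eta> + CC) * (\<Delta> + P * ln \<beta> + P * ln V)"
    proof -
      have "0 \<le> CC * \<Delta>" "0 \<le> 2 / \<eta> * (P * ln \<beta> + P * ln V)" using CC \<Delta> \<eta> P \<beta>1 V by auto
      then show ?thesis by (simp add: algebra_simps)
    qed
    finally have "?base powr e \<le> ((2 / \<eta> + CC) * (\<Delta> + P * ln \<beta> + P * ln V)) powr e"
      using e by (intro powr_le_of_abs_le) auto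
    also have "\<dots> = (2 / \<eta> + CC) powr e * (\<Delta> + P * ln \<beta> + P * ln V) powr e" by (rule powr_mult)
    also have "\<dots> \<le> (2 / \<eta> + CC) powr e * rate \<beta> \<Delta> V"
    proof (intro mult_left_mono)
      have "(\<Delta> + P * ln \<beta> + P * ln V) powr e \<le> (\<Delta> + P * ln \<beta>) powr e + (P * ln V) powr e"
        using \<Delta> P \<beta>1 V e by (intro powr_add_le) auto
      also have "(\<Delta> + P * ln \<beta>) powr e \<le> \<Delta> powr e + (P * ln \<beta>) powr e"
        using \<Delta> P \<beta>1 e by (intro powr_add_le) auto
      finally have "(\<Delta> + P * ln \<beta> + P * ln V) powr e \<le> \<Delta> powr e + (P * ln \<beta>) powr e + (P * ln V) powr e" by simp
      moreover have "P powr e = \<beta> powr (phat p / p)" unfolding P_def powr_powr ce ..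
      ultimately show "(\<Delta> + P * ln \<beta> + P * ln V) powr e \<le> rate \<beta> \<Delta> V"
        unfolding rate_def e_def[symmetric] by (simp add: powr_mult)
    qed simp
    finally show "?base powr (phat p / (1 - p)) \<le> (2 / \<eta> + CC) powr e * rate \<beta> \<Delta> (1 + \<sigma>\<^sup>2 * real T)"
      unfolding e_def V_def .
  qed simp
qed

text \<open>\<open>K4\<close> is a multiple of \<open>\<beta>\<^sup>2\<close>, so
  \<open>(2 * K4) powr (r / (2*p))\<close> has the order \<open>\<beta> powr (r / p)\<close> and the
  quotients by \<open>K4\<close> stay bounded. For \<open>p = 1/2\<close> the logarithms of
  \<open>A_T\<close> carry the exponent \<open>r\<close>, those of the rate the larger
  \<open>2 * r\<close>.\<close>

lemma error_rate:
  "\<exists>C\<ge>0. \<forall>\<sigma> \<beta> \<Delta> T. 0 \<le> \<sigma> \<and> \<sigma> \<le> \<sigma>m \<and> \<beta>0 \<le> \<beta> \<and> 0 \<le> \<Delta> \<longrightarrow>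
     A_T a0 b0 \<eta> \<sigma> \<sigma>h \<beta> p q T \<le> C * storm_rate \<sigma> \<beta> p \<Delta> T"
proof -
  define r where "r = phat p"
  have r: "0 < r" "r < 1" unfolding r_def using phat_bounds[OF p] by auto
  have q: "1/4 \<le> q" "q \<le> 1/2" using p pq by auto
  define k4 where "k4 = (if q > 1/4 then (K3 a0 \<sigma>h q + 3 * (1 + 2 * q\<^sup>2) / q\<^sup>2) * (\<eta>\<^sup>2 / (4 * q - 1))
      else (K3 a0 \<sigma>h q + 3 * (1 + 2 * q\<^sup>2) / q\<^sup>2) * \<eta>\<^sup>2)"
  have K4: "K4 a0 \<eta> \<sigma>h \<beta> q = k4 * \<beta>\<^sup>2" for \<beta> unfolding K4_def k4_def by simp
  have K: "0 \<le> K1 a0 \<sigma> \<sigma>h q" "0 < K2 a0 q" "0 \<le> K3 a0 \<sigma>h q" for \<sigma> using K_nonneg[OF a0 q] by auto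
  have "0 < 3 * (1 + 2 * q\<^sup>2) / q\<^sup>2" using q by (intro divide_pos_pos mult_pos_pos add_pos_nonneg) auto
  then have k4: "0 < k4" unfolding k4_def using K(3) \<eta> q by (auto intro!: mult_pos_pos add_nonneg_pos divide_pos_pos)
  define s where "s = (1 + 2 / a0\<^sup>2) powr (r / 3)"
  have s0: "0 \<le> s" unfolding s_def by simp
  define L where "L = ln \<beta>0 powr (phat p / (1 - p))"
  have L: "0 < L" unfolding L_def using \<beta>0 by simp
  show ?thesis
  proof (cases "p = 1/2")
    case False
    then have p2: "p < 1/2" using p by simp
    define g where "g = r / (1 - 2*p)"
    have g: "0 \<le> g" unfolding g_def using r p2 by simp
    define c1 where "c1 = (2 * K1 a0 \<sigma>m \<sigma>h q / k4) powr g"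
    define c2 where "c2 = (2 * K2 a0 q / k4) powr g"
    define c3 where "c3 = (2 * k4) powr (r / (2*p))"
    have cc: "0 \<le> c1" "0 \<le> c2" "0 \<le> c3" unfolding c1_def c2_def c3_def by auto
    show ?thesis
    proof (intro exI[of _ "c1 / L + (c2 / L + c3 / L) * s"] conjI allI impI)
      show "0 \<le> c1 / L + (c2 / L + c3 / L) * s" using cc L s0 by simp
      fix \<sigma> \<beta> \<Delta> :: real and T :: nat
      assume H: "0 \<le> \<sigma> \<and> \<sigma> \<le> \<sigma>m \<and> \<beta>0 \<le> \<beta> \<and> 0 \<le> \<Delta>"
      then have \<beta>1: "1 < \<beta>" using \<beta>0 by auto
      define V where "V = 1 + \<sigma>\<^sup>2 * real T"
      have V: "1 \<le> V" unfolding V_def by simp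
      have V3: "1 \<le> V powr (r/3)" using V r by (intro ge_one_powr_ge_zero) auto
      define R where "R = rate \<beta> \<Delta> V"
      have R0: "0 \<le> R" unfolding R_def by (rule rate_nonneg)
      have b2: "1 \<le> \<beta>\<^sup>2" using \<beta>1 by simp
      have k4\<beta>: "k4 \<le> k4 * \<beta>\<^sup>2" using k4 b2 by simp
      have "(2 * K1 a0 \<sigma> \<sigma>h q / (k4 * \<beta>\<^sup>2)) powr g \<le> c1" unfolding c1_def
        using K1_mono[of \<sigma> \<sigma>m a0 \<sigma>h q] H K(1) k4 k4\<beta> g by (intro powr_mono2 frac_le) auto
      also have "c1 \<le> c1 / L * R" unfolding L_def R_def using rate_ge_const(2)[of \<beta> c1] H cc by blast
      also have "\<dots> = c1 / L * R * 1" by simp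
      also have "\<dots> \<le> c1 / L * R * V powr (r/3)" using V3 cc L R0 by (intro mult_left_mono) auto
      finally have 1: "(2 * K1 a0 \<sigma> \<sigma>h q / (k4 * \<beta>\<^sup>2)) powr g \<le> c1 / L * R * V powr (r/3)" .
      have "(2 * K2 a0 q / (k4 * \<beta>\<^sup>2)) powr g \<le> c2" unfolding c2_def
        using K(2) k4 k4\<beta> g by (intro powr_mono2 frac_le) auto
      also have "c2 \<le> c2 / L * R" unfolding L_def R_def using rate_ge_const(2)[of \<beta> c2] H cc by blast
      finally have 2: "(2 * K2 a0 q / (k4 * \<beta>\<^sup>2)) powr g \<le> c2 / L * R" .
      have "(2 * (k4 * \<beta>\<^sup>2)) powr (r / (2*p)) = c3 * \<beta> powr (r / p)"
      proof -
        have "(\<beta>\<^sup>2) powr (r / (2*p)) = \<beta> powr (r / p)" using powr_powr[of \<beta> 2 "r / (2*p)"] \<beta>1 p by simp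
        then show ?thesis unfolding c3_def mult.assoc[symmetric] by (simp only: powr_mult)
      qed
      also have "\<dots> \<le> c3 / L * R" unfolding L_def R_def r_def using rate_ge_const(1)[of \<beta> c3] H cc by blast
      finally have 3: "(2 * (k4 * \<beta>\<^sup>2)) powr (r / (2*p)) \<le> c3 / L * R" .
      have S: "S_T a0 \<sigma> T powr (r/3) \<le> s * V powr (r/3)"
        unfolding s_def V_def using r by (intro S_T_le(3)[OF a0]) auto
      have "((2 * K2 a0 q / (k4 * \<beta>\<^sup>2)) powr g + (2 * (k4 * \<beta>\<^sup>2)) powr (r / (2*p))) * S_T a0 \<sigma> T powr (r/3)
         \<le> (c2 / L * R + c3 / L * R) * (s * V powr (r/3))"
        using 2 3 S cc L R0 by (intro mult_mono add_mono) auto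
      then have "A_T a0 b0 \<eta> \<sigma> \<sigma>h \<beta> p q T \<le> c1 / L * R * V powr (r/3) + (c2 / L * R + c3 / L * R) * (s * V powr (r/3))"
        unfolding A_T_def Let_def K4 r_def[symmetric] g_def[symmetric] using 1 False by simp
      also have "\<dots> = (c1 / L + (c2 / L + c3 / L) * s) * storm_rate \<sigma> \<beta> p \<Delta> T"
        unfolding storm_rate_eq R_def V_def r_def by (simp add: algebra_simps)
      finally show "A_T a0 b0 \<eta> \<sigma> \<sigma>h \<beta> p q T \<le> (c1 / L + (c2 / L + c3 / L) * s) * storm_rate \<sigma> \<beta> p \<Delta> T" .
    qed
  next
    case True
    define e where "e = phat p / (1 - p)"
    have h: "1 - p = 1/2" unfolding True by simp
    have e: "e = 2 * r" "r \<le> e" unfolding e_def h r_def[symmetric] using r by auto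
    have rp: "phat p / p = 2 * r" unfolding r_def True by simp
    define cs where "cs = ln (1 + 2 / a0\<^sup>2)"
    have cs: "0 \<le> cs" unfolding cs_def by simp
    define c1 where "c1 = 2 * K1 a0 \<sigma>m \<sigma>h q"
    define c3 where "c3 = 2 * K2 a0 q"
    define c4 where "c4 = 2 * k4 / 3"
    define c5 where "c5 = 4 * k4 / r"
    define c0 where "c0 = \<bar>ln (4 * k4 / b0 powr (2 * r))\<bar> / 2"
    have nn: "0 \<le> c1" "0 \<le> c3" "0 \<le> c4" "0 \<le> c5" "0 \<le> c0"
      unfolding c1_def c3_def c4_def c5_def c0_def using K(1)[of \<sigma>m] K(2) k4 r by auto
    define l0 where "l0 = ln \<beta>0"
    have l0: "0 < l0" unfolding l0_def using \<beta>0 by simp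
    define CC where "CC = c1 / l0 + (c3 + c4) * cs / l0 + c5 * c0 / l0 + c5 + (c3 + c4)"
    have CC: "0 \<le> CC" unfolding CC_def using nn cs l0 by (intro add_nonneg_nonneg divide_nonneg_nonneg mult_nonneg_nonneg) auto
    define C' where "C' = l0 powr (r - e) + 1 / L + 1"
    have C': "0 \<le> C'" unfolding C'_def using L by simp
    show ?thesis
    proof (intro exI[of _ "CC powr r * C' * s + b0 powr (2 * r) / L"] conjI allI impI)
      show "0 \<le> CC powr r * C' * s + b0 powr (2 * r) / L" using C' s0 L by simp
      fix \<sigma> \<beta> \<Delta> :: real and T :: nat
      assume H: "0 \<le> \<sigma> \<and> \<sigma> \<le> \<sigma>m \<and> \<beta>0 \<le> \<beta> \<and> 0 \<le> \<Delta>"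
      then have \<beta>1: "1 < \<beta>" using \<beta>0 by auto
      define V where "V = 1 + \<sigma>\<^sup>2 * real T"
      have V: "1 \<le> V" unfolding V_def by simp
      have V3: "1 \<le> V powr (r/3)" using V r by (intro ge_one_powr_ge_zero) auto
      define R where "R = rate \<beta> \<Delta> V"
      have R0: "0 \<le> R" unfolding R_def by (rule rate_nonneg)
      define P where "P = \<beta>\<^sup>2"
      have P: "1 \<le> P" unfolding P_def using \<beta>1 by simp
      have ll: "l0 \<le> ln \<beta>" unfolding l0_def using H \<beta>0 by simp
      have K1: "0 \<le> 2 * K1 a0 \<sigma> \<sigma>h q" "2 * K1 a0 \<sigma> \<sigma>h q \<le> c1"
        using K(1) K1_mono[of \<sigma> \<sigma>m] H unfolding c1_def by auto
      have lnS: "0 \<le> ln (S_T a0 \<sigma> T)" "ln (S_T a0 \<sigma> T) \<le> cs + ln V"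
        using S_T_le(2,4)[OF a0, of \<sigma> T] unfolding cs_def V_def by auto
      have lnQ: "\<bar>ln (4 * (k4 * P) / b0 powr (2 * r))\<bar> \<le> 2 * (c0 + ln \<beta>)"
      proof -
        have "ln (4 * (k4 * P) / b0 powr (2 * r)) = ln (4 * k4 / b0 powr (2 * r)) + ln P"
          using k4 P b0 ln_mult_pos[of "4 * k4 / b0 powr (2 * r)" P] by (simp add: mult.assoc)
        moreover have "ln P = 2 * ln \<beta>" unfolding P_def using \<beta>1 by (simp add: ln_realpow)
        moreover have "0 \<le> ln \<beta>" using \<beta>1 by simp
        moreover have "\<bar>x + 2 * y\<bar> \<le> 2 * (\<bar>x\<bar> / 2 + y)" if "0 \<le> y" for x y :: real
          using that by simp
        ultimately show ?thesis unfolding c0_def by presburger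
      qed
      let ?base = "2 * K1 a0 \<sigma> \<sigma>h q + 2 * (K2 a0 q + k4 * P / 3) * ln (S_T a0 \<sigma> T)
         + 2 * (k4 * P) / r * ln (4 * (k4 * P) / b0 powr (2 * r))"
      have "\<bar>?base\<bar> \<le> c1 + (c3 + c4 * P) * (cs + ln V) + c5 * P * (c0 + ln \<beta>)"
      proof -
        have "2 * (K2 a0 q + k4 * P / 3) * ln (S_T a0 \<sigma> T) = (c3 + c4 * P) * ln (S_T a0 \<sigma> T)"
          unfolding c3_def c4_def by (simp add: algebra_simps)
        moreover have "(c3 + c4 * P) * ln (S_T a0 \<sigma> T) \<le> (c3 + c4 * P) * (cs + ln V)"
          using nn P lnS by (intro mult_left_mono) auto
        moreover have "0 \<le> (c3 + c4 * P) * ln (S_T a0 \<sigma> T)" using nn P lnS by simp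
        moreover have "\<bar>2 * (k4 * P) / r * ln (4 * (k4 * P) / b0 powr (2 * r))\<bar> \<le> 2 * (k4 * P) / r * (2 * (c0 + ln \<beta>))"
          unfolding abs_mult using lnQ k4 P r by (intro mult_mono) auto
        moreover have "2 * (k4 * P) / r * (2 * (c0 + ln \<beta>)) = c5 * P * (c0 + ln \<beta>)"
          unfolding c5_def by simp
        ultimately show ?thesis using K1 by linarith
      qed
      also have "\<dots> \<le> CC * (P * ln \<beta> + P * ln V)"
        unfolding CC_def using V by (intro linear_in_logs nn cs P l0 ll) simp
      finally have "?base powr r \<le> (CC * (P * ln \<beta> + P * ln V)) powr r"
        using r by (intro powr_le_of_abs_le) auto
      also have "\<dots> = CC powr r * (P * ln \<beta> + P * ln V) powr r" by (rule powr_mult)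
      also have "(P * ln \<beta> + P * ln V) powr r \<le> (P * ln \<beta>) powr r + (P * ln V) powr r"
        using P \<beta>1 V r by (intro powr_add_le) auto
      also have "\<dots> = P powr r * ln \<beta> powr r + P powr r * ln V powr r" by (simp only: powr_mult)
      also have "\<dots> \<le> C' * R"
      proof -
        have Pr: "P powr r = \<beta> powr (phat p / p)" unfolding P_def rp using powr_powr[of \<beta> 2 r] \<beta>1 by simp
        \<comment> \<open>Raising the exponent from \<open>r\<close> to \<open>e\<close> is
          harmless: \<open>ln \<beta>\<close> is at least \<open>l0\<close>, and for
          \<open>ln V\<close>, which may be near 0, a summand 1 is added in
          \<open>lv\<close>.\<close>
        have "ln \<beta> powr r = ln \<beta> powr (r - e) * ln \<beta> powr e" by (simp flip: powr_add)
        also have "\<dots> \<le> l0 powr (r - e) * ln \<beta> powr e"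
          using l0 ll e by (intro mult_right_mono powr_mono2') auto
        finally have "P powr r * ln \<beta> powr r \<le> P powr r * (l0 powr (r - e) * ln \<beta> powr e)"
          by (intro mult_left_mono) auto
        also have "\<dots> = l0 powr (r - e) * (P powr r * ln \<beta> powr e)" by simp
        also have "\<dots> \<le> l0 powr (r - e) * R"
          unfolding R_def rate_def e_def[symmetric] Pr by (intro mult_left_mono) auto
        finally have 1: "P powr r * ln \<beta> powr r \<le> l0 powr (r - e) * R" .
        have lv: "ln V powr r \<le> 1 + ln V powr e"
        proof (cases "ln V \<le> 1")
          case True
          then have "ln V powr r \<le> 1" using V r by (intro powr_le1) auto
          then show ?thesis by (simp add: add_increasing2)
        next
          case False
          then have "ln V powr r \<le> ln V powr e" using e by (intro powr_mono) auto
          then show ?thesis by simp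
        qed
        then have "P powr r * ln V powr r \<le> P powr r * (1 + ln V powr e)" by (intro mult_left_mono) auto
        also have "\<dots> = 1 * P powr r + P powr r * ln V powr e" by (simp add: distrib_left)
        also have "\<dots> \<le> 1 / L * R + R"
        proof (rule add_mono)
          show "1 * P powr r \<le> 1 / L * R" unfolding Pr L_def R_def using rate_ge_const(1)[of \<beta> 1] H by simp
          show "P powr r * ln V powr e \<le> R" unfolding R_def rate_def e_def[symmetric] Pr by simp
        qed
        finally show ?thesis using 1 unfolding C'_def by (simp add: distrib_right)
      qed
      finally have base: "?base powr r \<le> CC powr r * (C' * R)" by (simp add: mult_left_mono)
      have S: "S_T a0 \<sigma> T powr (r/3) \<le> s * V powr (r/3)"
        unfolding s_def V_def using r by (intro S_T_le(3)[OF a0]) auto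
      have "?base powr r * S_T a0 \<sigma> T powr (r/3) \<le> CC powr r * (C' * R) * (s * V powr (r/3))"
        using base S C' R0 by (intro mult_mono) auto
      moreover have "b0 powr (2 * r) \<le> b0 powr (2 * r) / L * R * V powr (r/3)"
      proof -
        have "b0 powr (2 * r) \<le> b0 powr (2 * r) / L * R * 1" unfolding L_def R_def
          using rate_ge_const(2)[of \<beta> "b0 powr (2 * r)"] H by simp
        also have "\<dots> \<le> b0 powr (2 * r) / L * R * V powr (r/3)" using V3 L R0 by (intro mult_left_mono) auto
        finally show ?thesis .
      qed
      ultimately have "A_T a0 b0 \<eta> \<sigma> \<sigma>h \<beta> p q T \<le> CC powr r * (C' * R) * (s * V powr (r/3)) + b0 powr (2 * r) / L * R * V powr (r/3)"
        unfolding A_T_def Let_def K4 r_def[symmetric] P_def using True by simp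
      also have "\<dots> = (CC powr r * C' * s + b0 powr (2 * r) / L) * storm_rate \<sigma> \<beta> p \<Delta> T"
        unfolding storm_rate_eq R_def V_def r_def by (simp add: algebra_simps)
      finally show "A_T a0 b0 \<eta> \<sigma> \<sigma>h \<beta> p q T \<le> (CC powr r * C' * s + b0 powr (2 * r) / L) * storm_rate \<sigma> \<beta> p \<Delta> T" .
    qed
  qed
qed

lemma storm_bound_rate:
  "\<exists>C\<ge>0. \<forall>\<sigma> \<beta> \<Delta> T. 0 \<le> \<sigma> \<and> \<sigma> \<le> \<sigma>m \<and> \<beta>0 \<le> \<beta> \<and> 0 \<le> \<Delta> \<longrightarrow>
     storm_bound a0 b0 \<eta> \<sigma> \<sigma>h \<beta> p q lam \<Delta> T \<le> C * storm_rate \<sigma> \<beta> p \<Delta> T"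
proof -
  from error_rate obtain C1 where C1: "0 \<le> C1" "\<And>\<sigma> \<beta> \<Delta> T. 0 \<le> \<sigma> \<and> \<sigma> \<le> \<sigma>m \<and> \<beta>0 \<le> \<beta> \<and> 0 \<le> \<Delta> \<Longrightarrow>
     A_T a0 b0 \<eta> \<sigma> \<sigma>h \<beta> p q T \<le> C1 * storm_rate \<sigma> \<beta> p \<Delta> T" by blast
  from potential_rate obtain C2 where C2: "0 \<le> C2" "\<And>\<sigma> \<beta> \<Delta> T. 0 \<le> \<sigma> \<and> \<sigma> \<le> \<sigma>m \<and> \<beta>0 \<le> \<beta> \<and> 0 \<le> \<Delta> \<Longrightarrow>
     (K5 a0 b0 \<eta> \<sigma> \<sigma>h \<beta> p lam \<Delta> + (K6 a0 \<eta> \<beta> lam + K7 a0 \<eta> \<sigma>h \<beta> p lam / 3) * ln (S_T a0 \<sigma> T)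
       + K7 a0 \<eta> \<sigma>h \<beta> p lam * ln ((K8 a0 \<eta> \<sigma>h \<beta> lam + K9 a0 \<eta> \<sigma>h \<beta> lam) / b0)) powr (phat p / (1 - p))
     \<le> C2 * rate \<beta> \<Delta> (1 + \<sigma>\<^sup>2 * real T)" by blast
  define s where "s = (1 + 2 / a0\<^sup>2) powr (phat p / 3)"
  have s0: "0 \<le> s" unfolding s_def by simp
  show ?thesis
  proof (intro exI[of _ "4 * C1 + 4 * (C2 * s)"] conjI allI impI)
    show "0 \<le> 4 * C1 + 4 * (C2 * s)" using C1 C2 s0 by simp
    fix \<sigma> \<beta> \<Delta> :: real and T :: nat
    assume H: "0 \<le> \<sigma> \<and> \<sigma> \<le> \<sigma>m \<and> \<beta>0 \<le> \<beta> \<and> 0 \<le> \<Delta>"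
    let ?t = "(K5 a0 b0 \<eta> \<sigma> \<sigma>h \<beta> p lam \<Delta> + (K6 a0 \<eta> \<beta> lam + K7 a0 \<eta> \<sigma>h \<beta> p lam / 3) * ln (S_T a0 \<sigma> T)
       + K7 a0 \<eta> \<sigma>h \<beta> p lam * ln ((K8 a0 \<eta> \<sigma>h \<beta> lam + K9 a0 \<eta> \<sigma>h \<beta> lam) / b0)) powr (phat p / (1 - p))"
    have "?t * S_T a0 \<sigma> T powr (phat p / 3)
       \<le> (C2 * rate \<beta> \<Delta> (1 + \<sigma>\<^sup>2 * real T)) * (s * (1 + \<sigma>\<^sup>2 * real T) powr (phat p / 3))"
      unfolding s_def using C2(1) rate_nonneg phat_bounds(1)[OF p] by (intro mult_mono C2(2)[OF H] S_T_le(3)[OF a0]) auto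
    also have "\<dots> = C2 * s * storm_rate \<sigma> \<beta> p \<Delta> T" unfolding storm_rate_eq by simp
    finally have "?t * S_T a0 \<sigma> T powr (phat p / 3) \<le> C2 * s * storm_rate \<sigma> \<beta> p \<Delta> T" .
    moreover have "storm_bound a0 b0 \<eta> \<sigma> \<sigma>h \<beta> p q lam \<Delta> T
        = 4 * A_T a0 b0 \<eta> \<sigma> \<sigma>h \<beta> p q T + 4 * (?t * S_T a0 \<sigma> T powr (phat p / 3))"
      unfolding storm_bound_def Let_def by simp
    ultimately show "storm_bound a0 b0 \<eta> \<sigma> \<sigma>h \<beta> p q lam \<Delta> T \<le> (4 * C1 + 4 * (C2 * s)) * storm_rate \<sigma> \<beta> p \<Delta> T"
      using C1(2)[OF H, of T] by (simp add: distrib_right)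
  qed
qed

end

lemma phat_range:
  assumes p: "(3 - sqrt 7) / 2 \<le> p" "p \<le> 1/2"
  shows "phat p \<in> {3/7 .. sqrt 7 - 2}"
proof -
  have p0: "0 < p" by (rule phat_ge(1)[OF p])
  have s: "sqrt 7 * sqrt 7 = (7::real)" by simp
  have "3/7 * (4 - p) \<le> 3 * (1 - p)" using p by simp
  then have 1: "3/7 \<le> phat p" unfolding phat_def using p by (simp add: pos_le_divide_eq)
  have "(5 - sqrt 7) * ((3 - sqrt 7) / 2) \<le> (5 - sqrt 7) * p"
  proof (rule mult_left_mono[OF p(1)])
    have "sqrt 7 \<le> 5" by (rule real_le_lsqrt) auto
    then show "0 \<le> 5 - sqrt 7" by simp
  qed
  then have "3 * (1 - p) \<le> (sqrt 7 - 2) * (4 - p)" using s by (simp add: field_simps)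
  then have "phat p \<le> sqrt 7 - 2" unfolding phat_def using p by (simp add: pos_divide_le_eq)
  then show ?thesis using 1 by simp
qed

text \<open>The constant of the O-statement is uniform over all problems, the gap and
  \<open>T\<close>, given bounds \<open>\<beta>0\<close> and \<open>\<sigma>max\<close>. At
  \<open>\<beta> = 1\<close> with \<open>\<sigma> = 0\<close> and no gap the rate vanishes while the
  explicit bound does not, so \<open>\<beta>\<close> has to stay away from 1.\<close>

theorem theoremF1:
  fixes a0 b0 \<eta> p q lam \<sigma>h :: real
  assumes "a0 > 0" "b0 > 0" "\<eta> > 0" "lam > 0" "\<sigma>h \<ge> 0"
    and "(3 - sqrt 7) / 2 \<le> p" "p \<le> 1/2" "p + 2 * q = 1"
  shows
   "phat p \<in> {3/7 .. sqrt 7 - 2} \<and>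
    (\<forall>(M :: 'w measure) \<xi> (D :: 'b measure) \<Xi> (f :: 'a::euclidean_space \<Rightarrow> 'b \<Rightarrow> real) x1 \<sigma> \<beta> T.
       storm_assumptions M \<xi> D \<Xi> f \<sigma> \<sigma>h \<beta> \<longrightarrow> (p \<noteq> 1/2 \<longrightarrow> \<beta> > 0) \<longrightarrow>
       expected_grad_norm M \<xi> D f x1 a0 b0 \<eta> p q T
         \<le> ennreal (storm_bound a0 b0 \<eta> \<sigma> \<sigma>h \<beta> p q lam (objective D f x1 - opt_value D f) T)) \<and>
    (\<forall>\<beta>0>1. \<forall>\<sigma>max. \<exists>C\<ge>0.
       (\<forall>\<sigma> \<beta> \<Delta> T. 0 \<le> \<sigma> \<and> \<sigma> \<le> \<sigma>max \<and> \<beta>0 \<le> \<beta> \<and> 0 \<le> \<Delta> \<longrightarrow>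
          storm_bound a0 b0 \<eta> \<sigma> \<sigma>h \<beta> p q lam \<Delta> T \<le> C * storm_rate \<sigma> \<beta> p \<Delta> T) \<and>
       (\<forall>(M :: 'w measure) \<xi> (D :: 'b measure) \<Xi> (f :: 'a \<Rightarrow> 'b \<Rightarrow> real) x1 \<sigma> \<beta> T.
          storm_assumptions M \<xi> D \<Xi> f \<sigma> \<sigma>h \<beta> \<longrightarrow> \<sigma> \<le> \<sigma>max \<longrightarrow> \<beta>0 \<le> \<beta> \<longrightarrow>
          expected_grad_norm M \<xi> D f x1 a0 b0 \<eta> p q T
            \<le> ennreal (C * storm_rate \<sigma> \<beta> p (objective D f x1 - opt_value D f) T)))"
proof (intro conjI allI impI)
  have p0: "0 < p" by (rule phat_ge(1)[OF assms(6,7)])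
  show "phat p \<in> {3/7 .. sqrt 7 - 2}" by (rule phat_range[OF assms(6,7)])
  show explicit: "expected_grad_norm M \<xi> D f x1 a0 b0 \<eta> p q T
      \<le> ennreal (storm_bound a0 b0 \<eta> \<sigma> \<sigma>h \<beta> p q lam (objective D f x1 - opt_value D f) T)"
    if "storm_assumptions M \<xi> D \<Xi> f \<sigma> \<sigma>h \<beta>" "p \<noteq> 1/2 \<longrightarrow> \<beta> > 0"
    for M :: "'w measure" and \<xi> and D :: "'b measure" and \<Xi> and f :: "'a \<Rightarrow> 'b \<Rightarrow> real" and x1 \<sigma> \<beta> T
    using expected_grad_norm_le[OF assms(1-4,6-8) that] .
  fix \<beta>0 \<sigma>max :: real
  assume \<beta>0: "1 < \<beta>0"
  obtain C where C: "0 \<le> C" "\<And>\<sigma> \<beta> \<Delta> T. 0 \<le> \<sigma> \<and> \<sigma> \<le> \<sigma>max \<and> \<beta>0 \<le> \<beta> \<and> 0 \<le> \<Delta> \<Longrightarrow>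
      storm_bound a0 b0 \<eta> \<sigma> \<sigma>h \<beta> p q lam \<Delta> T \<le> C * storm_rate \<sigma> \<beta> p \<Delta> T"
    using storm_bound_rate[OF assms(1-4) p0 assms(7,8) \<beta>0, of \<sigma>max \<sigma>h] by blast
  show "\<exists>C\<ge>0.
       (\<forall>\<sigma> \<beta> \<Delta> T. 0 \<le> \<sigma> \<and> \<sigma> \<le> \<sigma>max \<and> \<beta>0 \<le> \<beta> \<and> 0 \<le> \<Delta> \<longrightarrow>
          storm_bound a0 b0 \<eta> \<sigma> \<sigma>h \<beta> p q lam \<Delta> T \<le> C * storm_rate \<sigma> \<beta> p \<Delta> T) \<and>
       (\<forall>(M :: 'w measure) \<xi> (D :: 'b measure) \<Xi> (f :: 'a \<Rightarrow> 'b \<Rightarrow> real) x1 \<sigma> \<beta> T.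
          storm_assumptions M \<xi> D \<Xi> f \<sigma> \<sigma>h \<beta> \<longrightarrow> \<sigma> \<le> \<sigma>max \<longrightarrow> \<beta>0 \<le> \<beta> \<longrightarrow>
          expected_grad_norm M \<xi> D f x1 a0 b0 \<eta> p q T
            \<le> ennreal (C * storm_rate \<sigma> \<beta> p (objective D f x1 - opt_value D f) T))"
  proof (intro exI[of _ C] conjI allI impI)
    fix M :: "'w measure" and \<xi> and D :: "'b measure" and \<Xi> and f :: "'a \<Rightarrow> 'b \<Rightarrow> real" and x1 \<sigma> \<beta> T
    assume st: "storm_assumptions M \<xi> D \<Xi> f \<sigma> \<sigma>h \<beta>" and \<sigma>: "\<sigma> \<le> \<sigma>max" and \<beta>: "\<beta>0 \<le> \<beta>"
    have "0 \<le> \<sigma>" "bdd_below (range (objective D f))"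
      using st unfolding storm_assumptions_def bounded_below_def by auto
    then have "0 \<le> \<sigma> \<and> \<sigma> \<le> \<sigma>max \<and> \<beta>0 \<le> \<beta> \<and> 0 \<le> objective D f x1 - opt_value D f"
      unfolding opt_value_def using \<sigma> \<beta> cINF_lower[of "objective D f" UNIV x1] by simp
    note C(2)[OF this]
    moreover have "expected_grad_norm M \<xi> D f x1 a0 b0 \<eta> p q T
      \<le> ennreal (storm_bound a0 b0 \<eta> \<sigma> \<sigma>h \<beta> p q lam (objective D f x1 - opt_value D f) T)"
      by (rule explicit[OF st]) (use \<beta>0 \<beta> in auto)
    ultimately show "expected_grad_norm M \<xi> D f x1 a0 b0 \<eta> p q T
      \<le> ennreal (C * storm_rate \<sigma> \<beta> p (objective D f x1 - opt_value D f) T)"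
      by (meson ennreal_leI order_trans)
  qed (use C in auto)
qed

end
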